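(* Let $S=(\mathbb D,S,m,e)$ and $T=(\mathbb E,T,m,e)$ be monads in the 2-category $\mathsf{PsDbCat}_{\mathsf{lax}}$ of pseudodouble categories, lax functors and vertical transformations, where $\mathbb D$ and $\mathbb E$ are equipments. Let $(F,\phi)\colon S\to T$ and $(G,\psi)\colon T\to S$ form a conjunction $(F,\phi)\dashv(G,\psi)$ in the double category $\mathsf{Mnd}(\mathsf{PsDbCat}_{\mathsf{lax}})$ with unit $\hat\eta$ and counit $\hat\epsilon$, and suppose that $\phi$ and $T\phi$ have strong conjoints. Let $(y,b,\upsilon,\mu)$ be a horizontal lax $T$-algebra. If $\hat\epsilon_y$ and $F\psi_y$ are invertible, then the component $\hat\epsilon_{(y,b,\upsilon,\mu)}$ of the counit of the induced adjunction $F_!\dashv G_!$ is invertible if and only if $\mathsf n^{\hat\epsilon^*}_b\colon FGb\cdot\hat\epsilon_{Ty}^*\to\hat\epsilon_y^*\cdot b$ is invertible.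
   Context: **Pseudodouble categories.** A pseudodouble category has categories $\mathbb D_0$ (0-cells, vertical 1-cells) and $\mathbb D_1$ (horizontal 1-cells $r\colon x\nrightarrow y$, 2-cells), functors $\mathrm{dom},\mathrm{cod}\colon\mathbb D_1\to\mathbb D_0$, $1\colon\mathbb D_0\to\mathbb D_1$ and horizontal composition $-\cdot-$, and globular natural isomorphisms $\lambda\colon1\cdot r\to r$, $\rho\colon r\cdot1\to r$, $\alpha\colon(t\cdot s)\cdot r\to t\cdot(s\cdot r)$ satisfying the unit triangle and the pentagon (globular: dom and cod identities). $\circ$ is vertical composition. A lax functor $F$ has functors $F_0,F_1$ compatible with dom, cod, and globular natural $\mathsf e^F\colon1_{Fx}\to F1_x$, $\mathsf m^F\colon Fs\cdot Fr\to F(s\cdot r)$ with the usual coherence. A vertical transformation $\phi\colon F\to G$ is a pair of natural transformations $F_0\to G_0$, $F_1\to G_1$ compatible with dom, cod with $\phi_{1_x}\circ\mathsf e^F=\mathsf e^G\circ1_{\phi_x}$, $\phi_{s\cdot r}\circ\mathsf m^F=\mathsf m^G\circ(\phi_s\cdot\phi_r)$. **Conjoints, companions.** A conjoint of $f\colon a\to b$ is $f^*\colon b\nrightarrow a$ with $\eta\colon1_a\to f^*$ (dom $f$, cod $\mathrm{id}$), $\epsilon\colon f^*\to1_b$ (dom $\mathrm{id}$, cod $f$), $\epsilon\circ\eta=1_f$, $\eta\cdot\epsilon=\rho^{-1}\circ\lambda$. A companion is $f_!\colon a\nrightarrow b$ with $\nu\colon1_a\to f_!$ (dom $\mathrm{id}$,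 cod $f$), $\delta\colon f_!\to1_b$ (dom $f$, cod $\mathrm{id}$), $\delta\circ\nu=1_f$, $\delta\cdot\nu=\lambda^{-1}\circ\rho$. Equipment: every vertical 1-cell has both. For a vertical transformation $\omega\colon H\to K$ and $r\colon x\nrightarrow y$, $\mathsf n^{\omega^*}_r\colon Hr\cdot\omega_x^*\to\omega_y^*\cdot Kr$ is the unique globular 2-cell with $\lambda\circ(\epsilon\cdot\mathrm{id})\circ\mathsf n^{\omega^*}_r=\rho\circ(\omega_r\cdot\epsilon)$; $\omega$ has a strong conjoint if all these are invertible. $\mathsf n^{\omega_!}_r\colon\omega_{y!}\cdot Hr\to Kr\cdot\omega_{x!}$ is the unique globular 2-cell with $\rho\circ(\mathrm{id}\cdot\delta)\circ\mathsf n^{\omega_!}_r=\lambda\circ(\delta\cdot\omega_r)$. **Monad morphisms, conjunctions.** A monad oplax morphism $(F,\phi)\colon S\to T$: lax functor $F\colon\mathbb D\to\mathbb E$, $\phi\colon FS\to TF$ with $\phi\circ Fe=e_F$, $\phi\circ Fm=m_F\circ T\phi\circ\phi_S$. A monad lax morphism $(G,\psi)\colon T\to S$: lax functor $G\colon\mathbb E\to\mathbb D$, $\psi\colon SG\to GT$ with $\psi\circ e_G=Ge$, $\psi\circ m_G=Gm\circ\psi_T\circ S\psi$. A conjunction $(F,\phi)\dashv(G,\psi)$ amounts to an adjunction $F\dashv G$ in $\mathsf{PsDbCat}_{\mathsf{lax}}$ with unit $\hat\eta$ and counit $\hat\epsilon$ such that $\phi=\hat\epsilon_{TF}\circ F\psi_F\circ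 FS\hat\eta$. **Horizontal lax algebras.** A horizontal lax $T$-algebra $(x,a,\upsilon,\mu)$: $a\colon Tx\nrightarrow x$, $\upsilon\colon1_x\to a$ (dom $e_x$, cod $\mathrm{id}$), $\mu\colon a\cdot Ta\to a$ (dom $m_x$, cod $\mathrm{id}$) with $\mu\circ(\upsilon\cdot e_a)=\lambda$, $\mu\circ(\mathrm{id}\cdot(T\upsilon\circ\mathsf e^T))=\rho$, $\mu\circ(\mathrm{id}\cdot(T\mu\circ\mathsf m^T))=\mu\circ(\mu\cdot m_a)\circ\alpha^{-1}$. Morphisms $(x,a)\to(y,b)$: $(f,\zeta)$ with $f\colon x\to y$ vertical, $\zeta\colon a\to b$ (dom $Tf$, cod $f$), $\zeta\circ\upsilon=\upsilon\circ1_f$, $\zeta\circ\mu=\mu\circ(\zeta\cdot T\zeta)$. They form the category $\mathbb H\mathsf{Lax}\text{-}T\text{-}\mathsf{Alg}$. **$F_!$.** $\mathsf e^{\phi^*}_x\colon1_{Fx}\to\phi_x^*$ (dom $e_{Fx}$, cod $Fe_x$) with $\epsilon\circ\mathsf e^{\phi^*}_x=1_{e_{Fx}}$; $\mathsf m^{\phi^*}_x\colon\phi^*_{Sx}\cdot(T\phi_x)^*\to\phi^*_x$ (dom $m_{Fx}$, cod $Fm_x$) with $\epsilon\circ\mathsf m^{\phi^*}_x=1_{m_{Fx}}\circ\rho\circ((1_{T\phi_x}\circ\epsilon)\cdot\epsilon)$; $\phi^*_f$ (dom $TFf$, cod $FSf$) with $\epsilon\circ\phi^*_f=1_{TFf}\circ\epsilon$;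 $\sigma^T\colon(T\phi_x)^*\to T(\phi_x^* )$ globular with $\sigma^T\circ\eta=T\eta\circ\mathsf e^T$; $\theta$ the inverse of $\mathsf m^T\circ(\mathrm{id}\cdot\sigma^T)\colon TFa\cdot(T\phi_x)^*\to T(Fa\cdot\phi^*_x)$ (all uniquely determined; the last invertible under the hypotheses). $F_!(x,a,\upsilon,\mu)=(Fx,Fa\cdot\phi^*_x,F_!\upsilon,F_!\mu)$, $F_!\upsilon=((F\upsilon\circ\mathsf e^F)\cdot\mathsf e^{\phi^*}_x)\circ\lambda^{-1}$, $F_!\mu$ = (associators suppressed) $\mathrm{id}\cdot\theta$, then $(\mathsf n^{\phi^*}_a)^{-1}$ whiskered by $Fa$ and $(T\phi_x)^*$, then $(F\mu\circ\mathsf m^F)\cdot\mathsf m^{\phi^*}_x$; $F_!(f,\zeta)=(Ff,F\zeta\cdot\phi^*_f)$. **$G_!$.** $\mathsf e^{\psi_!}_y\colon1_{Gy}\to\psi_{y!}$ (dom $e_{Gy}$, cod $Ge_y$) with $\delta\circ\mathsf e^{\psi_!}_y=1_{Ge_y}$; $\mathsf m^{\psi_!}_y\colon\psi_{Ty!}\cdot(S\psi_y)_!\to\psi_{y!}$ (dom $m_{Gy}$, cod $Gm_y$) with $\delta\circ\mathsf m^{\psi_!}_y=1_{Gm_y}\circ\rho\circ(\delta\cdot(1_{\psi_{Ty}}\circ\delta))$; $\psi_{g!}$ (dom $SGg$, cod $GTg$) with $\delta\circ\psi_{g!}=1_{GTg}\circ\delta$; $\tau^S\colon(S\psi_y)_!\to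 S(\psi_{y!})$ globular with $\tau^S\circ\nu=S\nu\circ\mathsf e^S$; $\theta'$ the inverse of $\mathsf m^S\circ(\mathrm{id}\cdot\tau^S)$. $G_!(y,b,\upsilon,\mu)=(Gy,Gb\cdot\psi_{y!},G_!\upsilon,G_!\mu)$, $G_!\upsilon=((G\upsilon\circ\mathsf e^G)\cdot\mathsf e^{\psi_!}_y)\circ\lambda^{-1}$, $G_!\mu$ = (associators suppressed) $\mathrm{id}\cdot\theta'$, then $\mathsf n^{\psi_!}_b$ whiskered, then $(G\mu\circ\mathsf m^G)\cdot\mathsf m^{\psi_!}_y$; $G_!(g,\xi)=(Gg,G\xi\cdot\psi_{g!})$. **The adjunction $F_!\dashv G_!$.** Its hom-bijection sends $(f,\zeta)\colon(x,a)\to G_!(y,b)$ to $(\hat\epsilon_y\circ Ff,\;\rho\circ(\chi\cdot(1_{T(\hat\epsilon_y\circ Ff)}\circ\epsilon)))\colon F_!(x,a)\to(y,b)$, where $\chi=\hat\epsilon_b\circ F(\rho\circ(\mathrm{id}\cdot\delta)\circ\zeta)\colon Fa\to b$. The counit at $(y,b,\upsilon,\mu)$ is the image of the identity of $G_!(y,b,\upsilon,\mu)$.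
   Formalization: Assumes that the 2-cell TFa·(Tφ_x)^* → T(Fa·φ_x^* ), whose inverse θ defines F_!μ, is invertible at the algebra (x,a) underlying G_!(y,b,υ,μ); this can fail under the stated hypotheses, and then the counit component is undefined. *)

theory Defs
  imports Main
begin

section \<open>Categories and functors\<close>

text \<open>
  Everything is carrier-based: the operations are total HOL functions, and only their values on the
  carriers matter.
\<close>

record ('o, 'a) cat =
  Obj :: "'o set"
  Arr :: "'a set"
  Src :: "'a \<Rightarrow> 'o"
  Tgt :: "'a \<Rightarrow> 'o"
  Ide :: "'o \<Rightarrow> 'a"
  Cmp :: "'a \<Rightarrow> 'a \<Rightarrow> 'a"

locale category =
  fixes C :: "('o, 'a) cat"
  assumes Src_in: "f \<in> Arr C \<Longrightarrow> Src C f \<in> Obj C"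
    and Tgt_in: "f \<in> Arr C \<Longrightarrow> Tgt C f \<in> Obj C"
    and Ide_in: "x \<in> Obj C \<Longrightarrow> Ide C x \<in> Arr C"
    and Src_Ide: "x \<in> Obj C \<Longrightarrow> Src C (Ide C x) = x"
    and Tgt_Ide: "x \<in> Obj C \<Longrightarrow> Tgt C (Ide C x) = x"
    and Cmp_in: "\<lbrakk>f \<in> Arr C; g \<in> Arr C; Src C g = Tgt C f\<rbrakk> \<Longrightarrow> Cmp C g f \<in> Arr C"
    and Src_Cmp: "\<lbrakk>f \<in> Arr C; g \<in> Arr C; Src C g = Tgt C f\<rbrakk> \<Longrightarrow> Src C (Cmp C g f) = Src C f"
    and Tgt_Cmp: "\<lbrakk>f \<in> Arr C; g \<in> Arr C; Src C g = Tgt C f\<rbrakk> \<Longrightarrow> Tgt C (Cmp C g f) = Tgt C g"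
    and Cmp_Ide_right: "f \<in> Arr C \<Longrightarrow> Cmp C f (Ide C (Src C f)) = f"
    and Cmp_Ide_left: "f \<in> Arr C \<Longrightarrow> Cmp C (Ide C (Tgt C f)) f = f"
    and Cmp_assoc: "\<lbrakk>f \<in> Arr C; g \<in> Arr C; h \<in> Arr C; Src C g = Tgt C f; Src C h = Tgt C g\<rbrakk>
      \<Longrightarrow> Cmp C h (Cmp C g f) = Cmp C (Cmp C h g) f"

definition inverse_arrows :: "('o, 'a) cat \<Rightarrow> 'a \<Rightarrow> 'a \<Rightarrow> bool" where
  "inverse_arrows C f g \<longleftrightarrow> f \<in> Arr C \<and> g \<in> Arr C \<and> Src C g = Tgt C f \<and> Tgt C g = Src C f \<and>
     Cmp C g f = Ide C (Src C f) \<and> Cmp C f g = Ide C (Tgt C f)"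

definition is_iso :: "('o, 'a) cat \<Rightarrow> 'a \<Rightarrow> bool" where
  "is_iso C f \<longleftrightarrow> (\<exists>g. inverse_arrows C f g)"

definition inverse_in :: "('o, 'a) cat \<Rightarrow> 'a \<Rightarrow> 'a" where
  "inverse_in C f = (THE g. inverse_arrows C f g)"

record ('o, 'a, 'p, 'b) fctr =
  fob :: "'o \<Rightarrow> 'p"
  far :: "'a \<Rightarrow> 'b"

definition is_functor :: "('o, 'a) cat \<Rightarrow> ('p, 'b) cat \<Rightarrow> ('o, 'a, 'p, 'b) fctr \<Rightarrow> bool" where
  "is_functor A B F \<longleftrightarrow>
     (\<forall>x \<in> Obj A. fob F x \<in> Obj B) \<and>
     (\<forall>f \<in> Arr A. far F f \<in> Arr B \<and> Src B (far F f) = fob F (Src A f) \<and>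
        Tgt B (far F f) = fob F (Tgt A f)) \<and>
     (\<forall>x \<in> Obj A. far F (Ide A x) = Ide B (fob F x)) \<and>
     (\<forall>f \<in> Arr A. \<forall>g \<in> Arr A. Src A g = Tgt A f \<longrightarrow>
        far F (Cmp A g f) = Cmp B (far F g) (far F f))"

section \<open>Pseudodouble categories\<close>

text \<open>
  \<open>Ver\<close> is the category of 0-cells and vertical 1-cells, \<open>Hor\<close> that of horizontal 1-cells and
  2-cells; \<open>Src\<close>/\<open>Tgt\<close> are the vertical source and target, \<open>DomF\<close>/\<open>CodF\<close> the horizontal ones.
  Horizontal composition is written in the order of functions: in \<open>hcmp s r\<close>, \<open>r\<close> comes first.
\<close>

record ('o, 'v, 'h, 'c) dbl =
  Ver :: "('o, 'v) cat"
  Hor :: "('h, 'c) cat"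
  DomF :: "('h, 'c, 'o, 'v) fctr"
  CodF :: "('h, 'c, 'o, 'v) fctr"
  UnitF :: "('o, 'v, 'h, 'c) fctr"
  hcmp :: "'h \<Rightarrow> 'h \<Rightarrow> 'h"
  ccmp :: "'c \<Rightarrow> 'c \<Rightarrow> 'c"
  Lam :: "'h \<Rightarrow> 'c"
  Rho :: "'h \<Rightarrow> 'c"
  Alp :: "'h \<Rightarrow> 'h \<Rightarrow> 'h \<Rightarrow> 'c"

abbreviation "hdom D r \<equiv> fob (DomF D) r"
abbreviation "hcod D r \<equiv> fob (CodF D) r"
abbreviation "cdom D \<beta> \<equiv> far (DomF D) \<beta>"
abbreviation "ccod D \<beta> \<equiv> far (CodF D) \<beta>"
abbreviation "hunit D x \<equiv> fob (UnitF D) x"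
abbreviation "cunit D f \<equiv> far (UnitF D) f"
abbreviation "vid D x \<equiv> Ide (Ver D) x"
abbreviation "cid D r \<equiv> Ide (Hor D) r"

text \<open>
  In order: vertical composition of vertical 1-cells and of 2-cells, horizontal composition of
  horizontal 1-cells and of 2-cells.
\<close>

abbreviation dbl_vver ("(_ \<circ>\<^bsub>_\<^esub> _)" [66, 0, 65] 65)
  where "g \<circ>\<^bsub>D\<^esub> f \<equiv> Cmp (Ver D) g f"
abbreviation dbl_vcel ("(_ \<bullet>\<^bsub>_\<^esub> _)" [66, 0, 65] 65)
  where "\<beta> \<bullet>\<^bsub>D\<^esub> \<alpha> \<equiv> Cmp (Hor D) \<beta> \<alpha>"
abbreviation dbl_hhor ("(_ \<cdot>\<^bsub>_\<^esub> _)" [71, 0, 70] 70)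
  where "s \<cdot>\<^bsub>D\<^esub> r \<equiv> hcmp D s r"
abbreviation dbl_hcel ("(_ \<odot>\<^bsub>_\<^esub> _)" [71, 0, 70] 70)
  where "\<beta> \<odot>\<^bsub>D\<^esub> \<alpha> \<equiv> ccmp D \<beta> \<alpha>"

text \<open>\<open>cell D r s f g \<beta>\<close>: \<open>\<beta> : r \<rightarrow> s\<close> is a 2-cell with dom \<open>f\<close> and cod \<open>g\<close>.\<close>

definition cell :: "('o, 'v, 'h, 'c) dbl \<Rightarrow> 'h \<Rightarrow> 'h \<Rightarrow> 'v \<Rightarrow> 'v \<Rightarrow> 'c \<Rightarrow> bool" where
  "cell D r s f g \<beta> \<longleftrightarrow> \<beta> \<in> Arr (Hor D) \<and> Src (Hor D) \<beta> = r \<and> Tgt (Hor D) \<beta> = s \<and>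
     cdom D \<beta> = f \<and> ccod D \<beta> = g"

definition globular :: "('o, 'v, 'h, 'c) dbl \<Rightarrow> 'h \<Rightarrow> 'h \<Rightarrow> 'c \<Rightarrow> bool" where
  "globular D r s \<beta> \<longleftrightarrow> cell D r s (vid D (hdom D r)) (vid D (hcod D r)) \<beta>"

locale pseudodouble_category = ver: category "Ver D" + hor: category "Hor D"
  for D :: "('o, 'v, 'h, 'c) dbl" +
  assumes dom_functor: "is_functor (Hor D) (Ver D) (DomF D)"
    and cod_functor: "is_functor (Hor D) (Ver D) (CodF D)"
    and unit_functor: "is_functor (Ver D) (Hor D) (UnitF D)"
    and hunit_boundary: "x \<in> Obj (Ver D) \<Longrightarrow> hdom D (hunit D x) = x \<and> hcod D (hunit D x) = x"
    and cunit_boundary: "f \<in> Arr (Ver D) \<Longrightarrow> cdom D (cunit D f) = f \<and> ccod D (cunit D f) = f"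
    and hcmp_boundary: "\<lbrakk>r \<in> Obj (Hor D); s \<in> Obj (Hor D); hdom D s = hcod D r\<rbrakk>
      \<Longrightarrow> s \<cdot>\<^bsub>D\<^esub> r \<in> Obj (Hor D) \<and> hdom D (s \<cdot>\<^bsub>D\<^esub> r) = hdom D r \<and> hcod D (s \<cdot>\<^bsub>D\<^esub> r) = hcod D s"
    and ccmp_boundary: "\<lbrakk>cell D r r' f g \<alpha>; cell D s s' g h \<beta>\<rbrakk>
      \<Longrightarrow> cell D (s \<cdot>\<^bsub>D\<^esub> r) (s' \<cdot>\<^bsub>D\<^esub> r') f h (\<beta> \<odot>\<^bsub>D\<^esub> \<alpha>)"
    and ccmp_cid: "\<lbrakk>r \<in> Obj (Hor D); s \<in> Obj (Hor D); hdom D s = hcod D r\<rbrakk>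
      \<Longrightarrow> cid D s \<odot>\<^bsub>D\<^esub> cid D r = cid D (s \<cdot>\<^bsub>D\<^esub> r)"
    and interchange: "\<lbrakk>cell D r r' f g \<alpha>; cell D r' r'' f' g' \<alpha>'; cell D s s' g h \<beta>; cell D s' s'' g' h' \<beta>'\<rbrakk>
      \<Longrightarrow> (\<beta>' \<bullet>\<^bsub>D\<^esub> \<beta>) \<odot>\<^bsub>D\<^esub> (\<alpha>' \<bullet>\<^bsub>D\<^esub> \<alpha>) = (\<beta>' \<odot>\<^bsub>D\<^esub> \<alpha>') \<bullet>\<^bsub>D\<^esub> (\<beta> \<odot>\<^bsub>D\<^esub> \<alpha>)"
    and Lam_globular: "r \<in> Obj (Hor D)
      \<Longrightarrow> globular D (hunit D (hcod D r) \<cdot>\<^bsub>D\<^esub> r) r (Lam D r) \<and> is_iso (Hor D) (Lam D r)"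
    and Lam_natural: "cell D r s f g \<alpha>
      \<Longrightarrow> Lam D s \<bullet>\<^bsub>D\<^esub> (cunit D g \<odot>\<^bsub>D\<^esub> \<alpha>) = \<alpha> \<bullet>\<^bsub>D\<^esub> Lam D r"
    and Rho_globular: "r \<in> Obj (Hor D)
      \<Longrightarrow> globular D (r \<cdot>\<^bsub>D\<^esub> hunit D (hdom D r)) r (Rho D r) \<and> is_iso (Hor D) (Rho D r)"
    and Rho_natural: "cell D r s f g \<alpha>
      \<Longrightarrow> Rho D s \<bullet>\<^bsub>D\<^esub> (\<alpha> \<odot>\<^bsub>D\<^esub> cunit D f) = \<alpha> \<bullet>\<^bsub>D\<^esub> Rho D r"
    and Alp_globular: "\<lbrakk>r \<in> Obj (Hor D); s \<in> Obj (Hor D); t \<in> Obj (Hor D);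
        hdom D s = hcod D r; hdom D t = hcod D s\<rbrakk>
      \<Longrightarrow> globular D ((t \<cdot>\<^bsub>D\<^esub> s) \<cdot>\<^bsub>D\<^esub> r) (t \<cdot>\<^bsub>D\<^esub> (s \<cdot>\<^bsub>D\<^esub> r)) (Alp D t s r) \<and> is_iso (Hor D) (Alp D t s r)"
    and Alp_natural: "\<lbrakk>cell D r r' f g \<alpha>; cell D s s' g h \<beta>; cell D t t' h k \<gamma>\<rbrakk>
      \<Longrightarrow> Alp D t' s' r' \<bullet>\<^bsub>D\<^esub> ((\<gamma> \<odot>\<^bsub>D\<^esub> \<beta>) \<odot>\<^bsub>D\<^esub> \<alpha>) = (\<gamma> \<odot>\<^bsub>D\<^esub> (\<beta> \<odot>\<^bsub>D\<^esub> \<alpha>)) \<bullet>\<^bsub>D\<^esub> Alp D t s r"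
    and triangle: "\<lbrakk>r \<in> Obj (Hor D); s \<in> Obj (Hor D); hdom D s = hcod D r\<rbrakk>
      \<Longrightarrow> (cid D s \<odot>\<^bsub>D\<^esub> Lam D r) \<bullet>\<^bsub>D\<^esub> Alp D s (hunit D (hcod D r)) r = Rho D s \<odot>\<^bsub>D\<^esub> cid D r"
    and pentagon: "\<lbrakk>r \<in> Obj (Hor D); s \<in> Obj (Hor D); t \<in> Obj (Hor D); u \<in> Obj (Hor D);
        hdom D s = hcod D r; hdom D t = hcod D s; hdom D u = hcod D t\<rbrakk>
      \<Longrightarrow> Alp D u t (s \<cdot>\<^bsub>D\<^esub> r) \<bullet>\<^bsub>D\<^esub> Alp D (u \<cdot>\<^bsub>D\<^esub> t) s r
        = (cid D u \<odot>\<^bsub>D\<^esub> Alp D t s r) \<bullet>\<^bsub>D\<^esub> (Alp D u (t \<cdot>\<^bsub>D\<^esub> s) r \<bullet>\<^bsub>D\<^esub> (Alp D u t s \<odot>\<^bsub>D\<^esub> cid D r))"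

section \<open>The 2-category of pseudodouble categories, lax functors and vertical transformations\<close>

record ('o, 'v, 'h, 'c, 'p, 'w, 'k, 'd) laxf =
  F0 :: "('o, 'v, 'p, 'w) fctr"
  F1 :: "('h, 'c, 'k, 'd) fctr"
  fe :: "'o \<Rightarrow> 'd"
  fm :: "'h \<Rightarrow> 'h \<Rightarrow> 'd"

abbreviation "fo F x \<equiv> fob (F0 F) x"
abbreviation "fv F f \<equiv> far (F0 F) f"
abbreviation "fh F r \<equiv> fob (F1 F) r"
abbreviation "fc F \<beta> \<equiv> far (F1 F) \<beta>"

locale lax_functor = dom: pseudodouble_category D + cod: pseudodouble_category E
  for D :: "('o, 'v, 'h, 'c) dbl" and E :: "('p, 'w, 'k, 'd) dbl"
    and F :: "('o, 'v, 'h, 'c, 'p, 'w, 'k, 'd) laxf" +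
  assumes F0_functor: "is_functor (Ver D) (Ver E) (F0 F)"
    and F1_functor: "is_functor (Hor D) (Hor E) (F1 F)"
    and fh_boundary: "r \<in> Obj (Hor D)
      \<Longrightarrow> hdom E (fh F r) = fo F (hdom D r) \<and> hcod E (fh F r) = fo F (hcod D r)"
    and fc_boundary: "\<beta> \<in> Arr (Hor D)
      \<Longrightarrow> cdom E (fc F \<beta>) = fv F (cdom D \<beta>) \<and> ccod E (fc F \<beta>) = fv F (ccod D \<beta>)"
    and fe_globular: "x \<in> Obj (Ver D) \<Longrightarrow> globular E (hunit E (fo F x)) (fh F (hunit D x)) (fe F x)"
    and fe_natural: "f \<in> Arr (Ver D)
      \<Longrightarrow> fe F (Tgt (Ver D) f) \<bullet>\<^bsub>E\<^esub> cunit E (fv F f) = fc F (cunit D f) \<bullet>\<^bsub>E\<^esub> fe F (Src (Ver D) f)"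
    and fm_globular: "\<lbrakk>r \<in> Obj (Hor D); s \<in> Obj (Hor D); hdom D s = hcod D r\<rbrakk>
      \<Longrightarrow> globular E (fh F s \<cdot>\<^bsub>E\<^esub> fh F r) (fh F (s \<cdot>\<^bsub>D\<^esub> r)) (fm F s r)"
    and fm_natural: "\<lbrakk>cell D r r' f g \<alpha>; cell D s s' g h \<beta>\<rbrakk>
      \<Longrightarrow> fm F s' r' \<bullet>\<^bsub>E\<^esub> (fc F \<beta> \<odot>\<^bsub>E\<^esub> fc F \<alpha>) = fc F (\<beta> \<odot>\<^bsub>D\<^esub> \<alpha>) \<bullet>\<^bsub>E\<^esub> fm F s r"
    and fm_unit_left: "r \<in> Obj (Hor D)
      \<Longrightarrow> fc F (Lam D r) \<bullet>\<^bsub>E\<^esub> (fm F (hunit D (hcod D r)) r \<bullet>\<^bsub>E\<^esub> (fe F (hcod D r) \<odot>\<^bsub>E\<^esub> cid E (fh F r)))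
        = Lam E (fh F r)"
    and fm_unit_right: "r \<in> Obj (Hor D)
      \<Longrightarrow> fc F (Rho D r) \<bullet>\<^bsub>E\<^esub> (fm F r (hunit D (hdom D r)) \<bullet>\<^bsub>E\<^esub> (cid E (fh F r) \<odot>\<^bsub>E\<^esub> fe F (hdom D r)))
        = Rho E (fh F r)"
    and fm_assoc: "\<lbrakk>r \<in> Obj (Hor D); s \<in> Obj (Hor D); t \<in> Obj (Hor D);
        hdom D s = hcod D r; hdom D t = hcod D s\<rbrakk>
      \<Longrightarrow> fc F (Alp D t s r) \<bullet>\<^bsub>E\<^esub> (fm F (t \<cdot>\<^bsub>D\<^esub> s) r \<bullet>\<^bsub>E\<^esub> (fm F t s \<odot>\<^bsub>E\<^esub> cid E (fh F r)))
        = fm F t (s \<cdot>\<^bsub>D\<^esub> r) \<bullet>\<^bsub>E\<^esub> ((cid E (fh F t) \<odot>\<^bsub>E\<^esub> fm F s r) \<bullet>\<^bsub>E\<^esub> Alp E (fh F t) (fh F s) (fh F r))"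

definition lax_id :: "('o, 'v, 'h, 'c) dbl \<Rightarrow> ('o, 'v, 'h, 'c, 'o, 'v, 'h, 'c) laxf" where
  "lax_id D = \<lparr>F0 = \<lparr>fob = \<lambda>x. x, far = \<lambda>f. f\<rparr>, F1 = \<lparr>fob = \<lambda>r. r, far = \<lambda>\<beta>. \<beta>\<rparr>,
     fe = \<lambda>x. cid D (hunit D x), fm = \<lambda>s r. cid D (s \<cdot>\<^bsub>D\<^esub> r)\<rparr>"

text \<open>\<open>lax_comp C G F\<close> is \<open>G\<close> after \<open>F\<close>, where \<open>C\<close> is the codomain of \<open>G\<close>.\<close>

definition lax_comp :: "('q, 'z, 'l, 'b) dbl \<Rightarrow> ('p, 'w, 'k, 'd, 'q, 'z, 'l, 'b) laxf \<Rightarrow>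
    ('o, 'v, 'h, 'c, 'p, 'w, 'k, 'd) laxf \<Rightarrow> ('o, 'v, 'h, 'c, 'q, 'z, 'l, 'b) laxf" where
  "lax_comp C G F = \<lparr>F0 = \<lparr>fob = \<lambda>x. fo G (fo F x), far = \<lambda>f. fv G (fv F f)\<rparr>,
     F1 = \<lparr>fob = \<lambda>r. fh G (fh F r), far = \<lambda>\<beta>. fc G (fc F \<beta>)\<rparr>,
     fe = \<lambda>x. fc G (fe F x) \<bullet>\<^bsub>C\<^esub> fe G (fo F x),
     fm = \<lambda>s r. fc G (fm F s r) \<bullet>\<^bsub>C\<^esub> fm G (fh F s) (fh F r)\<rparr>"

record ('o, 'h, 'w, 'd) vtr =
  t0 :: "'o \<Rightarrow> 'w"
  t1 :: "'h \<Rightarrow> 'd"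

locale vertical_transformation = src: lax_functor D E F + tgt: lax_functor D E G
  for D :: "('o, 'v, 'h, 'c) dbl" and E :: "('p, 'w, 'k, 'd) dbl"
    and F G :: "('o, 'v, 'h, 'c, 'p, 'w, 'k, 'd) laxf" and \<phi> :: "('o, 'h, 'w, 'd) vtr" +
  assumes t0_arrow: "x \<in> Obj (Ver D)
      \<Longrightarrow> t0 \<phi> x \<in> Arr (Ver E) \<and> Src (Ver E) (t0 \<phi> x) = fo F x \<and> Tgt (Ver E) (t0 \<phi> x) = fo G x"
    and t0_natural: "f \<in> Arr (Ver D)
      \<Longrightarrow> t0 \<phi> (Tgt (Ver D) f) \<circ>\<^bsub>E\<^esub> fv F f = fv G f \<circ>\<^bsub>E\<^esub> t0 \<phi> (Src (Ver D) f)"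
    and t1_cell: "r \<in> Obj (Hor D)
      \<Longrightarrow> cell E (fh F r) (fh G r) (t0 \<phi> (hdom D r)) (t0 \<phi> (hcod D r)) (t1 \<phi> r)"
    and t1_natural: "\<beta> \<in> Arr (Hor D)
      \<Longrightarrow> t1 \<phi> (Tgt (Hor D) \<beta>) \<bullet>\<^bsub>E\<^esub> fc F \<beta> = fc G \<beta> \<bullet>\<^bsub>E\<^esub> t1 \<phi> (Src (Hor D) \<beta>)"
    and t1_unit: "x \<in> Obj (Ver D)
      \<Longrightarrow> t1 \<phi> (hunit D x) \<bullet>\<^bsub>E\<^esub> fe F x = fe G x \<bullet>\<^bsub>E\<^esub> cunit E (t0 \<phi> x)"
    and t1_comp: "\<lbrakk>r \<in> Obj (Hor D); s \<in> Obj (Hor D); hdom D s = hcod D r\<rbrakk>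
      \<Longrightarrow> t1 \<phi> (s \<cdot>\<^bsub>D\<^esub> r) \<bullet>\<^bsub>E\<^esub> fm F s r = fm G s r \<bullet>\<^bsub>E\<^esub> (t1 \<phi> s \<odot>\<^bsub>E\<^esub> t1 \<phi> r)"

text \<open>
  Equality of vertical transformations out of \<open>D\<close>, composition, identities, and the whiskerings
  \<open>F\<phi>\<close> (\<open>vt_post F \<phi>\<close>) and \<open>\<phi>\<^sub>F\<close> (\<open>vt_pre \<phi> F\<close>).
\<close>

definition vt_eq :: "('o, 'v, 'h, 'c) dbl \<Rightarrow> ('o, 'h, 'w, 'd) vtr \<Rightarrow> ('o, 'h, 'w, 'd) vtr \<Rightarrow> bool" where
  "vt_eq D \<phi> \<psi> \<longleftrightarrow> (\<forall>x \<in> Obj (Ver D). t0 \<phi> x = t0 \<psi> x) \<and> (\<forall>r \<in> Obj (Hor D). t1 \<phi> r = t1 \<psi> r)"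

definition vt_id :: "('p, 'w, 'k, 'd) dbl \<Rightarrow> ('o, 'v, 'h, 'c, 'p, 'w, 'k, 'd) laxf \<Rightarrow> ('o, 'h, 'w, 'd) vtr" where
  "vt_id E F = \<lparr>t0 = \<lambda>x. vid E (fo F x), t1 = \<lambda>r. cid E (fh F r)\<rparr>"

definition vt_comp :: "('p, 'w, 'k, 'd) dbl \<Rightarrow> ('o, 'h, 'w, 'd) vtr \<Rightarrow> ('o, 'h, 'w, 'd) vtr \<Rightarrow> ('o, 'h, 'w, 'd) vtr" where
  "vt_comp E \<psi> \<phi> = \<lparr>t0 = \<lambda>x. t0 \<psi> x \<circ>\<^bsub>E\<^esub> t0 \<phi> x, t1 = \<lambda>r. t1 \<psi> r \<bullet>\<^bsub>E\<^esub> t1 \<phi> r\<rparr>"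

definition vt_post :: "('p, 'w, 'k, 'd, 'q, 'z, 'l, 'b) laxf \<Rightarrow> ('o, 'h, 'w, 'd) vtr \<Rightarrow> ('o, 'h, 'z, 'b) vtr" where
  "vt_post F \<phi> = \<lparr>t0 = \<lambda>x. fv F (t0 \<phi> x), t1 = \<lambda>r. fc F (t1 \<phi> r)\<rparr>"

definition vt_pre :: "('p, 'k, 'w, 'd) vtr \<Rightarrow> ('o, 'v, 'h, 'c, 'p, 'x, 'k, 'y) laxf \<Rightarrow> ('o, 'h, 'w, 'd) vtr" where
  "vt_pre \<phi> F = \<lparr>t0 = \<lambda>x. t0 \<phi> (fo F x), t1 = \<lambda>r. t1 \<phi> (fh F r)\<rparr>"

section \<open>Conjoints and companions\<close>

record ('h, 'c) conj =
  conj_hor :: 'h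
  conj_eta :: 'c
  conj_eps :: 'c

definition is_conjoint :: "('o, 'v, 'h, 'c) dbl \<Rightarrow> 'v \<Rightarrow> ('h, 'c) conj \<Rightarrow> bool" where
  "is_conjoint D f k \<longleftrightarrow>
     (let a = Src (Ver D) f; b = Tgt (Ver D) f; p = conj_hor k in
       p \<in> Obj (Hor D) \<and> hdom D p = b \<and> hcod D p = a \<and>
       cell D (hunit D a) p f (vid D a) (conj_eta k) \<and>
       cell D p (hunit D b) (vid D b) f (conj_eps k) \<and>
       conj_eps k \<bullet>\<^bsub>D\<^esub> conj_eta k = cunit D f \<and>
       conj_eta k \<odot>\<^bsub>D\<^esub> conj_eps k = inverse_in (Hor D) (Rho D p) \<bullet>\<^bsub>D\<^esub> Lam D p)"

record ('h, 'c) comp =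
  comp_hor :: 'h
  comp_nu :: 'c
  comp_delta :: 'c

definition is_companion :: "('o, 'v, 'h, 'c) dbl \<Rightarrow> 'v \<Rightarrow> ('h, 'c) comp \<Rightarrow> bool" where
  "is_companion D f k \<longleftrightarrow>
     (let a = Src (Ver D) f; b = Tgt (Ver D) f; p = comp_hor k in
       p \<in> Obj (Hor D) \<and> hdom D p = a \<and> hcod D p = b \<and>
       cell D (hunit D a) p (vid D a) f (comp_nu k) \<and>
       cell D p (hunit D b) f (vid D b) (comp_delta k) \<and>
       comp_delta k \<bullet>\<^bsub>D\<^esub> comp_nu k = cunit D f \<and>
       comp_delta k \<odot>\<^bsub>D\<^esub> comp_nu k = inverse_in (Hor D) (Lam D p) \<bullet>\<^bsub>D\<^esub> Rho D p)"

definition equipment :: "('o, 'v, 'h, 'c) dbl \<Rightarrow> bool" where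
  "equipment D \<longleftrightarrow> pseudodouble_category D \<and>
     (\<forall>f \<in> Arr (Ver D). (\<exists>k. is_conjoint D f k) \<and> (\<exists>k. is_companion D f k))"

text \<open>
  The notations \<open>f\<^sup>*\<close> and \<open>f\<^sub>!\<close> presuppose a choice, which is kept arbitrary.
\<close>

definition conjoint_choice :: "('o, 'v, 'h, 'c) dbl \<Rightarrow> ('v \<Rightarrow> ('h, 'c) conj) \<Rightarrow> bool" where
  "conjoint_choice D cj \<longleftrightarrow> (\<forall>f \<in> Arr (Ver D). is_conjoint D f (cj f))"

definition companion_choice :: "('o, 'v, 'h, 'c) dbl \<Rightarrow> ('v \<Rightarrow> ('h, 'c) comp) \<Rightarrow> bool" where
  "companion_choice D cp \<longleftrightarrow> (\<forall>f \<in> Arr (Ver D). is_companion D f (cp f))"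

text \<open>
  The comparison 2-cells \<open>Hr \<cdot> \<omega>\<^sub>x\<^sup>* \<rightarrow> \<omega>\<^sub>y\<^sup>* \<cdot> Kr\<close> and \<open>\<omega>\<^sub>y\<^sub>! \<cdot> Hr \<rightarrow> Kr \<cdot> \<omega>\<^sub>x\<^sub>!\<close> of
  a vertical transformation \<open>\<omega> : H \<rightarrow> K\<close> at \<open>r\<close> from \<open>x\<close> to \<open>y\<close>.
\<close>

definition n_conj :: "('o, 'v, 'h, 'c) dbl \<Rightarrow> ('p, 'w, 'k, 'd) dbl \<Rightarrow> ('w \<Rightarrow> ('k, 'd) conj) \<Rightarrow>
    ('o, 'v, 'h, 'c, 'p, 'w, 'k, 'd) laxf \<Rightarrow> ('o, 'v, 'h, 'c, 'p, 'w, 'k, 'd) laxf \<Rightarrow>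
    ('o, 'h, 'w, 'd) vtr \<Rightarrow> 'h \<Rightarrow> 'd" where
  "n_conj D E cj H K \<omega> r =
     (let \<omega>x = cj (t0 \<omega> (hdom D r)); \<omega>y = cj (t0 \<omega> (hcod D r)) in
       THE n. globular E (fh H r \<cdot>\<^bsub>E\<^esub> conj_hor \<omega>x) (conj_hor \<omega>y \<cdot>\<^bsub>E\<^esub> fh K r) n \<and>
         Lam E (fh K r) \<bullet>\<^bsub>E\<^esub> ((conj_eps \<omega>y \<odot>\<^bsub>E\<^esub> cid E (fh K r)) \<bullet>\<^bsub>E\<^esub> n)
           = Rho E (fh K r) \<bullet>\<^bsub>E\<^esub> (t1 \<omega> r \<odot>\<^bsub>E\<^esub> conj_eps \<omega>x))"

definition n_comp :: "('o, 'v, 'h, 'c) dbl \<Rightarrow> ('p, 'w, 'k, 'd) dbl \<Rightarrow> ('w \<Rightarrow> ('k, 'd) comp) \<Rightarrow>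
    ('o, 'v, 'h, 'c, 'p, 'w, 'k, 'd) laxf \<Rightarrow> ('o, 'v, 'h, 'c, 'p, 'w, 'k, 'd) laxf \<Rightarrow>
    ('o, 'h, 'w, 'd) vtr \<Rightarrow> 'h \<Rightarrow> 'd" where
  "n_comp D E cp H K \<omega> r =
     (let \<omega>x = cp (t0 \<omega> (hdom D r)); \<omega>y = cp (t0 \<omega> (hcod D r)) in
       THE n. globular E (comp_hor \<omega>y \<cdot>\<^bsub>E\<^esub> fh H r) (fh K r \<cdot>\<^bsub>E\<^esub> comp_hor \<omega>x) n \<and>
         Rho E (fh K r) \<bullet>\<^bsub>E\<^esub> ((cid E (fh K r) \<odot>\<^bsub>E\<^esub> comp_delta \<omega>x) \<bullet>\<^bsub>E\<^esub> n)
           = Lam E (fh K r) \<bullet>\<^bsub>E\<^esub> (comp_delta \<omega>y \<odot>\<^bsub>E\<^esub> t1 \<omega> r))"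

definition strong_conjoint :: "('o, 'v, 'h, 'c) dbl \<Rightarrow> ('p, 'w, 'k, 'd) dbl \<Rightarrow> ('w \<Rightarrow> ('k, 'd) conj) \<Rightarrow>
    ('o, 'v, 'h, 'c, 'p, 'w, 'k, 'd) laxf \<Rightarrow> ('o, 'v, 'h, 'c, 'p, 'w, 'k, 'd) laxf \<Rightarrow>
    ('o, 'h, 'w, 'd) vtr \<Rightarrow> bool" where
  "strong_conjoint D E cj H K \<omega> \<longleftrightarrow> (\<forall>r \<in> Obj (Hor D). is_iso (Hor E) (n_conj D E cj H K \<omega> r))"

section \<open>Monads, monad morphisms, conjunctions\<close>

record ('o, 'v, 'h, 'c) mnd =
  mfun :: "('o, 'v, 'h, 'c, 'o, 'v, 'h, 'c) laxf"
  mmul :: "('o, 'h, 'v, 'c) vtr"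
  muni :: "('o, 'h, 'v, 'c) vtr"

definition is_monad :: "('o, 'v, 'h, 'c) dbl \<Rightarrow> ('o, 'v, 'h, 'c) mnd \<Rightarrow> bool" where
  "is_monad E T \<longleftrightarrow>
     lax_functor E E (mfun T) \<and>
     vertical_transformation E E (lax_comp E (mfun T) (mfun T)) (mfun T) (mmul T) \<and>
     vertical_transformation E E (lax_id E) (mfun T) (muni T) \<and>
     vt_eq E (vt_comp E (mmul T) (vt_post (mfun T) (mmul T))) (vt_comp E (mmul T) (vt_pre (mmul T) (mfun T))) \<and>
     vt_eq E (vt_comp E (mmul T) (vt_post (mfun T) (muni T))) (vt_id E (mfun T)) \<and>
     vt_eq E (vt_comp E (mmul T) (vt_pre (muni T) (mfun T))) (vt_id E (mfun T))"

definition monad_oplax_morphism :: "('o, 'v, 'h, 'c) dbl \<Rightarrow> ('p, 'w, 'k, 'd) dbl \<Rightarrow>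
    ('o, 'v, 'h, 'c) mnd \<Rightarrow> ('p, 'w, 'k, 'd) mnd \<Rightarrow>
    ('o, 'v, 'h, 'c, 'p, 'w, 'k, 'd) laxf \<Rightarrow> ('o, 'h, 'w, 'd) vtr \<Rightarrow> bool" where
  "monad_oplax_morphism D E S T F \<phi> \<longleftrightarrow>
     lax_functor D E F \<and>
     vertical_transformation D E (lax_comp E F (mfun S)) (lax_comp E (mfun T) F) \<phi> \<and>
     vt_eq D (vt_comp E \<phi> (vt_post F (muni S))) (vt_pre (muni T) F) \<and>
     vt_eq D (vt_comp E \<phi> (vt_post F (mmul S)))
       (vt_comp E (vt_pre (mmul T) F) (vt_comp E (vt_post (mfun T) \<phi>) (vt_pre \<phi> (mfun S))))"

definition monad_lax_morphism :: "('p, 'w, 'k, 'd) dbl \<Rightarrow> ('o, 'v, 'h, 'c) dbl \<Rightarrow>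
    ('p, 'w, 'k, 'd) mnd \<Rightarrow> ('o, 'v, 'h, 'c) mnd \<Rightarrow>
    ('p, 'w, 'k, 'd, 'o, 'v, 'h, 'c) laxf \<Rightarrow> ('p, 'k, 'v, 'c) vtr \<Rightarrow> bool" where
  "monad_lax_morphism E D T S G \<psi> \<longleftrightarrow>
     lax_functor E D G \<and>
     vertical_transformation E D (lax_comp D (mfun S) G) (lax_comp D G (mfun T)) \<psi> \<and>
     vt_eq E (vt_comp D \<psi> (vt_pre (muni S) G)) (vt_post G (muni T)) \<and>
     vt_eq E (vt_comp D \<psi> (vt_pre (mmul S) G))
       (vt_comp D (vt_post G (mmul T)) (vt_comp D (vt_pre \<psi> (mfun T)) (vt_post (mfun S) \<psi>)))"

definition lax_adjunction :: "('o, 'v, 'h, 'c) dbl \<Rightarrow> ('p, 'w, 'k, 'd) dbl \<Rightarrow>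
    ('o, 'v, 'h, 'c, 'p, 'w, 'k, 'd) laxf \<Rightarrow> ('p, 'w, 'k, 'd, 'o, 'v, 'h, 'c) laxf \<Rightarrow>
    ('o, 'h, 'v, 'c) vtr \<Rightarrow> ('p, 'k, 'w, 'd) vtr \<Rightarrow> bool" where
  "lax_adjunction D E F G \<eta> \<epsilon> \<longleftrightarrow>
     lax_functor D E F \<and> lax_functor E D G \<and>
     vertical_transformation D D (lax_id D) (lax_comp D G F) \<eta> \<and>
     vertical_transformation E E (lax_comp E F G) (lax_id E) \<epsilon> \<and>
     vt_eq D (vt_comp E (vt_pre \<epsilon> F) (vt_post F \<eta>)) (vt_id E F) \<and>
     vt_eq E (vt_comp D (vt_post G \<epsilon>) (vt_pre \<eta> G)) (vt_id D G)"

definition conjunction :: "('o, 'v, 'h, 'c) dbl \<Rightarrow> ('p, 'w, 'k, 'd) dbl \<Rightarrow>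
    ('o, 'v, 'h, 'c) mnd \<Rightarrow> ('p, 'w, 'k, 'd) mnd \<Rightarrow>
    ('o, 'v, 'h, 'c, 'p, 'w, 'k, 'd) laxf \<Rightarrow> ('o, 'h, 'w, 'd) vtr \<Rightarrow>
    ('p, 'w, 'k, 'd, 'o, 'v, 'h, 'c) laxf \<Rightarrow> ('p, 'k, 'v, 'c) vtr \<Rightarrow>
    ('o, 'h, 'v, 'c) vtr \<Rightarrow> ('p, 'k, 'w, 'd) vtr \<Rightarrow> bool" where
  "conjunction D E S T F \<phi> G \<psi> \<eta> \<epsilon> \<longleftrightarrow>
     monad_oplax_morphism D E S T F \<phi> \<and>
     monad_lax_morphism E D T S G \<psi> \<and>
     lax_adjunction D E F G \<eta> \<epsilon> \<and>
     vt_eq D \<phi> (vt_comp E (vt_pre \<epsilon> (lax_comp E (mfun T) F))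
       (vt_comp E (vt_post F (vt_pre \<psi> F)) (vt_post F (vt_post (mfun S) \<eta>))))"

section \<open>Horizontal lax algebras\<close>

type_synonym ('o, 'h, 'c) halg = "'o \<times> 'h \<times> 'c \<times> 'c"

definition is_hlax_algebra :: "('o, 'v, 'h, 'c) dbl \<Rightarrow> ('o, 'v, 'h, 'c) mnd \<Rightarrow> ('o, 'h, 'c) halg \<Rightarrow> bool" where
  "is_hlax_algebra E T = (\<lambda>(x, a, \<upsilon>, \<mu>).
     (let Ta = fh (mfun T) a; TTa = fh (mfun T) Ta in
       x \<in> Obj (Ver E) \<and> a \<in> Obj (Hor E) \<and> hdom E a = fo (mfun T) x \<and> hcod E a = x \<and>
       cell E (hunit E x) a (t0 (muni T) x) (vid E x) \<upsilon> \<and>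
       cell E (a \<cdot>\<^bsub>E\<^esub> Ta) a (t0 (mmul T) x) (vid E x) \<mu> \<and>
       \<mu> \<bullet>\<^bsub>E\<^esub> (\<upsilon> \<odot>\<^bsub>E\<^esub> t1 (muni T) a) = Lam E a \<and>
       \<mu> \<bullet>\<^bsub>E\<^esub> (cid E a \<odot>\<^bsub>E\<^esub> (fc (mfun T) \<upsilon> \<bullet>\<^bsub>E\<^esub> fe (mfun T) x)) = Rho E a \<and>
       \<mu> \<bullet>\<^bsub>E\<^esub> (cid E a \<odot>\<^bsub>E\<^esub> (fc (mfun T) \<mu> \<bullet>\<^bsub>E\<^esub> fm (mfun T) a Ta))
         = \<mu> \<bullet>\<^bsub>E\<^esub> ((\<mu> \<odot>\<^bsub>E\<^esub> t1 (mmul T) a) \<bullet>\<^bsub>E\<^esub> inverse_in (Hor E) (Alp E a Ta TTa))))"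

definition is_hlax_morphism :: "('o, 'v, 'h, 'c) dbl \<Rightarrow> ('o, 'v, 'h, 'c) mnd \<Rightarrow>
    ('o, 'h, 'c) halg \<Rightarrow> 'v \<times> 'c \<Rightarrow> ('o, 'h, 'c) halg \<Rightarrow> bool" where
  "is_hlax_morphism E T = (\<lambda>(x, a, \<upsilon>, \<mu>) (f, \<zeta>) (y, b, \<upsilon>', \<mu>').
     f \<in> Arr (Ver E) \<and> Src (Ver E) f = x \<and> Tgt (Ver E) f = y \<and>
     cell E a b (fv (mfun T) f) f \<zeta> \<and>
     \<zeta> \<bullet>\<^bsub>E\<^esub> \<upsilon> = \<upsilon>' \<bullet>\<^bsub>E\<^esub> cunit E f \<and>
     \<zeta> \<bullet>\<^bsub>E\<^esub> \<mu> = \<mu>' \<bullet>\<^bsub>E\<^esub> (\<zeta> \<odot>\<^bsub>E\<^esub> fc (mfun T) \<zeta>))"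

text \<open>
  The category of horizontal lax algebras. As \<open>(f, \<zeta>)\<close> does not determine the structure cells of
  its source and target, arrows carry their source and target algebra.
\<close>

type_synonym ('o, 'v, 'h, 'c) harr = "('o, 'h, 'c) halg \<times> ('v \<times> 'c) \<times> ('o, 'h, 'c) halg"

definition HLaxAlg :: "('o, 'v, 'h, 'c) dbl \<Rightarrow> ('o, 'v, 'h, 'c) mnd \<Rightarrow>
    (('o, 'h, 'c) halg, ('o, 'v, 'h, 'c) harr) cat" where
  "HLaxAlg E T = \<lparr>
     Obj = {A. is_hlax_algebra E T A},
     Arr = {(A, f, B). is_hlax_algebra E T A \<and> is_hlax_algebra E T B \<and> is_hlax_morphism E T A f B},
     Src = (\<lambda>(A, f, B). A),
     Tgt = (\<lambda>(A, f, B). B),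
     Ide = (\<lambda>A. (A, (case A of (x, a, \<upsilon>, \<mu>) \<Rightarrow> (vid E x, cid E a)), A)),
     Cmp = (\<lambda>(B', (g, \<xi>), C) (A, (f, \<zeta>), B). (A, (g \<circ>\<^bsub>E\<^esub> f, \<xi> \<bullet>\<^bsub>E\<^esub> \<zeta>), C))\<rparr>"

text \<open>
  For \<open>c : q \<cdot> r \<rightarrow> q' \<cdot> r'\<close> globular, the whiskered 2-cell
  \<open>(p \<cdot> q) \<cdot> (r \<cdot> s) \<rightarrow> (p \<cdot> q') \<cdot> (r' \<cdot> s)\<close> with the associators written out.
\<close>

definition mid_whisker :: "('o, 'v, 'h, 'c) dbl \<Rightarrow> 'h \<Rightarrow> 'h \<Rightarrow> 'h \<Rightarrow> 'h \<Rightarrow> 'h \<Rightarrow> 'h \<Rightarrow> 'c \<Rightarrow> 'c" where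
  "mid_whisker D p q r q' r' s c =
     inverse_in (Hor D) (Alp D p q' (r' \<cdot>\<^bsub>D\<^esub> s)) \<bullet>\<^bsub>D\<^esub>
     ((cid D p \<odot>\<^bsub>D\<^esub> Alp D q' r' s) \<bullet>\<^bsub>D\<^esub>
     ((cid D p \<odot>\<^bsub>D\<^esub> (c \<odot>\<^bsub>D\<^esub> cid D s)) \<bullet>\<^bsub>D\<^esub>
     ((cid D p \<odot>\<^bsub>D\<^esub> inverse_in (Hor D) (Alp D q r s)) \<bullet>\<^bsub>D\<^esub>
     Alp D p q (r \<cdot>\<^bsub>D\<^esub> s))))"

section \<open>The assignment \<open>F\<^sub>!\<close> on algebras\<close>

text \<open>
  Below \<open>(F, \<phi>)\<close> is a monad oplax morphism from \<open>S\<close> on \<open>D\<close> to \<open>T\<close> on \<open>E\<close>, and \<open>cj\<close> a choice of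
  conjoints in \<open>E\<close>.
\<close>

definition e_conj :: "('p, 'w, 'k, 'd) dbl \<Rightarrow>
    ('o, 'v, 'h, 'c) mnd \<Rightarrow> ('p, 'w, 'k, 'd) mnd \<Rightarrow>
    ('o, 'v, 'h, 'c, 'p, 'w, 'k, 'd) laxf \<Rightarrow> ('o, 'h, 'w, 'd) vtr \<Rightarrow>
    ('w \<Rightarrow> ('k, 'd) conj) \<Rightarrow> 'o \<Rightarrow> 'd" where
  "e_conj E S T F \<phi> cj x =
     (let k = cj (t0 \<phi> x) in
       THE c. cell E (hunit E (fo F x)) (conj_hor k) (t0 (muni T) (fo F x)) (fv F (t0 (muni S) x)) c \<and>
         conj_eps k \<bullet>\<^bsub>E\<^esub> c = cunit E (t0 (muni T) (fo F x)))"

definition m_conj :: "('p, 'w, 'k, 'd) dbl \<Rightarrow>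
    ('o, 'v, 'h, 'c) mnd \<Rightarrow> ('p, 'w, 'k, 'd) mnd \<Rightarrow>
    ('o, 'v, 'h, 'c, 'p, 'w, 'k, 'd) laxf \<Rightarrow> ('o, 'h, 'w, 'd) vtr \<Rightarrow>
    ('w \<Rightarrow> ('k, 'd) conj) \<Rightarrow> 'o \<Rightarrow> 'd" where
  "m_conj E S T F \<phi> cj x =
     (let T\<phi> = fv (mfun T) (t0 \<phi> x);
          k = cj (t0 \<phi> x); kS = cj (t0 \<phi> (fo (mfun S) x)); kT = cj T\<phi>;
          TTFx = fo (mfun T) (fo (mfun T) (fo F x)) in
       THE c. cell E (conj_hor kS \<cdot>\<^bsub>E\<^esub> conj_hor kT) (conj_hor k)
           (t0 (mmul T) (fo F x)) (fv F (t0 (mmul S) x)) c \<and>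
         conj_eps k \<bullet>\<^bsub>E\<^esub> c
           = cunit E (t0 (mmul T) (fo F x)) \<bullet>\<^bsub>E\<^esub>
             (Rho E (hunit E TTFx) \<bullet>\<^bsub>E\<^esub>
              ((cunit E T\<phi> \<bullet>\<^bsub>E\<^esub> conj_eps kS) \<odot>\<^bsub>E\<^esub> conj_eps kT)))"

definition sigma_conj :: "('p, 'w, 'k, 'd) dbl \<Rightarrow> ('p, 'w, 'k, 'd, 'p, 'w, 'k, 'd) laxf \<Rightarrow>
    ('w \<Rightarrow> ('k, 'd) conj) \<Rightarrow> 'w \<Rightarrow> 'd" where
  "sigma_conj E T cj f =
     (let k = cj f; kT = cj (fv T f) in
       THE c. globular E (conj_hor kT) (fh T (conj_hor k)) c \<and>
         c \<bullet>\<^bsub>E\<^esub> conj_eta kT = fc T (conj_eta k) \<bullet>\<^bsub>E\<^esub> fe T (Src (Ver E) f))"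

text \<open>
  The 2-cell \<open>Tp \<cdot> (Tf)\<^sup>* \<rightarrow> T(p \<cdot> f\<^sup>*)\<close>. It need not be invertible for a lax \<open>T\<close>; the
  multiplication of \<open>F_shriek\<close> is meaningful only where the instance it inverts is.
\<close>

definition theta_cmp :: "('p, 'w, 'k, 'd) dbl \<Rightarrow> ('p, 'w, 'k, 'd, 'p, 'w, 'k, 'd) laxf \<Rightarrow>
    ('w \<Rightarrow> ('k, 'd) conj) \<Rightarrow> 'k \<Rightarrow> 'w \<Rightarrow> 'd" where
  "theta_cmp E T cj p f =
     fm T p (conj_hor (cj f)) \<bullet>\<^bsub>E\<^esub> (cid E (fh T p) \<odot>\<^bsub>E\<^esub> sigma_conj E T cj f)"

definition F_shriek :: "('o, 'v, 'h, 'c) dbl \<Rightarrow> ('p, 'w, 'k, 'd) dbl \<Rightarrow>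
    ('o, 'v, 'h, 'c) mnd \<Rightarrow> ('p, 'w, 'k, 'd) mnd \<Rightarrow>
    ('o, 'v, 'h, 'c, 'p, 'w, 'k, 'd) laxf \<Rightarrow> ('o, 'h, 'w, 'd) vtr \<Rightarrow>
    ('w \<Rightarrow> ('k, 'd) conj) \<Rightarrow> ('o, 'h, 'c) halg \<Rightarrow> ('p, 'k, 'd) halg" where
  "F_shriek D E S T F \<phi> cj = (\<lambda>(x, a, \<upsilon>, \<mu>).
     (let Sx = fo (mfun S) x; Sa = fh (mfun S) a; Fa = fh F a; FSa = fh F Sa; TFa = fh (mfun T) Fa;
          p = conj_hor (cj (t0 \<phi> x)); pS = conj_hor (cj (t0 \<phi> Sx));
          pT = conj_hor (cj (fv (mfun T) (t0 \<phi> x)));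
          \<theta> = inverse_in (Hor E) (theta_cmp E (mfun T) cj Fa (t0 \<phi> x));
          n = n_conj D E cj (lax_comp E F (mfun S)) (lax_comp E (mfun T) F) \<phi> a
      in (fo F x,
          Fa \<cdot>\<^bsub>E\<^esub> p,
          ((fc F \<upsilon> \<bullet>\<^bsub>E\<^esub> fe F x) \<odot>\<^bsub>E\<^esub> e_conj E S T F \<phi> cj x)
            \<bullet>\<^bsub>E\<^esub> inverse_in (Hor E) (Lam E (hunit E (fo F x))),
          ((fc F \<mu> \<bullet>\<^bsub>E\<^esub> fm F a Sa) \<odot>\<^bsub>E\<^esub> m_conj E S T F \<phi> cj x) \<bullet>\<^bsub>E\<^esub>
          (mid_whisker E Fa p TFa FSa pS pT (inverse_in (Hor E) n) \<bullet>\<^bsub>E\<^esub>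
           (cid E (Fa \<cdot>\<^bsub>E\<^esub> p) \<odot>\<^bsub>E\<^esub> \<theta>)))))"

section \<open>The assignment \<open>G\<^sub>!\<close> on algebras\<close>

text \<open>
  Below \<open>(G, \<psi>)\<close> is a monad lax morphism from \<open>T\<close> on \<open>E\<close> to \<open>S\<close> on \<open>D\<close>, and \<open>cp\<close> a choice of
  companions in \<open>D\<close>.
\<close>

definition e_comp :: "('o, 'v, 'h, 'c) dbl \<Rightarrow>
    ('p, 'w, 'k, 'd) mnd \<Rightarrow> ('o, 'v, 'h, 'c) mnd \<Rightarrow>
    ('p, 'w, 'k, 'd, 'o, 'v, 'h, 'c) laxf \<Rightarrow> ('p, 'k, 'v, 'c) vtr \<Rightarrow>
    ('v \<Rightarrow> ('h, 'c) comp) \<Rightarrow> 'p \<Rightarrow> 'c" where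
  "e_comp D T S G \<psi> cp y =
     (let k = cp (t0 \<psi> y) in
       THE c. cell D (hunit D (fo G y)) (comp_hor k) (t0 (muni S) (fo G y)) (fv G (t0 (muni T) y)) c \<and>
         comp_delta k \<bullet>\<^bsub>D\<^esub> c = cunit D (fv G (t0 (muni T) y)))"

definition m_comp :: "('o, 'v, 'h, 'c) dbl \<Rightarrow>
    ('p, 'w, 'k, 'd) mnd \<Rightarrow> ('o, 'v, 'h, 'c) mnd \<Rightarrow>
    ('p, 'w, 'k, 'd, 'o, 'v, 'h, 'c) laxf \<Rightarrow> ('p, 'k, 'v, 'c) vtr \<Rightarrow>
    ('v \<Rightarrow> ('h, 'c) comp) \<Rightarrow> 'p \<Rightarrow> 'c" where
  "m_comp D T S G \<psi> cp y =
     (let \<psi>T = t0 \<psi> (fo (mfun T) y);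
          k = cp (t0 \<psi> y); kT = cp \<psi>T; kS = cp (fv (mfun S) (t0 \<psi> y));
          GTTy = fo G (fo (mfun T) (fo (mfun T) y)) in
       THE c. cell D (comp_hor kT \<cdot>\<^bsub>D\<^esub> comp_hor kS) (comp_hor k)
           (t0 (mmul S) (fo G y)) (fv G (t0 (mmul T) y)) c \<and>
         comp_delta k \<bullet>\<^bsub>D\<^esub> c
           = cunit D (fv G (t0 (mmul T) y)) \<bullet>\<^bsub>D\<^esub>
             (Rho D (hunit D GTTy) \<bullet>\<^bsub>D\<^esub>
              (comp_delta kT \<odot>\<^bsub>D\<^esub> (cunit D \<psi>T \<bullet>\<^bsub>D\<^esub> comp_delta kS))))"

definition tau_comp :: "('o, 'v, 'h, 'c) dbl \<Rightarrow> ('o, 'v, 'h, 'c, 'o, 'v, 'h, 'c) laxf \<Rightarrow>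
    ('v \<Rightarrow> ('h, 'c) comp) \<Rightarrow> 'v \<Rightarrow> 'c" where
  "tau_comp D S cp f =
     (let k = cp f; kS = cp (fv S f) in
       THE c. globular D (comp_hor kS) (fh S (comp_hor k)) c \<and>
         c \<bullet>\<^bsub>D\<^esub> comp_nu kS = fc S (comp_nu k) \<bullet>\<^bsub>D\<^esub> fe S (Src (Ver D) f))"

text \<open>
  The 2-cell \<open>Sp \<cdot> (Sf)\<^sub>! \<rightarrow> S(p \<cdot> f\<^sub>!)\<close>; unlike \<open>theta_cmp\<close> it is always invertible.
\<close>

definition theta'_cmp :: "('o, 'v, 'h, 'c) dbl \<Rightarrow> ('o, 'v, 'h, 'c, 'o, 'v, 'h, 'c) laxf \<Rightarrow>
    ('v \<Rightarrow> ('h, 'c) comp) \<Rightarrow> 'h \<Rightarrow> 'v \<Rightarrow> 'c" where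
  "theta'_cmp D S cp p f =
     fm S p (comp_hor (cp f)) \<bullet>\<^bsub>D\<^esub> (cid D (fh S p) \<odot>\<^bsub>D\<^esub> tau_comp D S cp f)"

definition G_shriek :: "('p, 'w, 'k, 'd) dbl \<Rightarrow> ('o, 'v, 'h, 'c) dbl \<Rightarrow>
    ('p, 'w, 'k, 'd) mnd \<Rightarrow> ('o, 'v, 'h, 'c) mnd \<Rightarrow>
    ('p, 'w, 'k, 'd, 'o, 'v, 'h, 'c) laxf \<Rightarrow> ('p, 'k, 'v, 'c) vtr \<Rightarrow>
    ('v \<Rightarrow> ('h, 'c) comp) \<Rightarrow> ('p, 'k, 'd) halg \<Rightarrow> ('o, 'h, 'c) halg" where
  "G_shriek E D T S G \<psi> cp = (\<lambda>(y, b, \<upsilon>, \<mu>).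
     (let Ty = fo (mfun T) y; Tb = fh (mfun T) b; Gb = fh G b; GTb = fh G Tb; SGb = fh (mfun S) Gb;
          q = comp_hor (cp (t0 \<psi> y)); qT = comp_hor (cp (t0 \<psi> Ty));
          qS = comp_hor (cp (fv (mfun S) (t0 \<psi> y)));
          \<theta> = inverse_in (Hor D) (theta'_cmp D (mfun S) cp Gb (t0 \<psi> y));
          n = n_comp E D cp (lax_comp D (mfun S) G) (lax_comp D G (mfun T)) \<psi> b
      in (fo G y,
          Gb \<cdot>\<^bsub>D\<^esub> q,
          ((fc G \<upsilon> \<bullet>\<^bsub>D\<^esub> fe G y) \<odot>\<^bsub>D\<^esub> e_comp D T S G \<psi> cp y)
            \<bullet>\<^bsub>D\<^esub> inverse_in (Hor D) (Lam D (hunit D (fo G y))),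
          ((fc G \<mu> \<bullet>\<^bsub>D\<^esub> fm G b Tb) \<odot>\<^bsub>D\<^esub> m_comp D T S G \<psi> cp y) \<bullet>\<^bsub>D\<^esub>
          (mid_whisker D Gb q SGb GTb qT qS n \<bullet>\<^bsub>D\<^esub>
           (cid D (Gb \<cdot>\<^bsub>D\<^esub> q) \<odot>\<^bsub>D\<^esub> \<theta>)))))"

section \<open>The adjunction \<open>F\<^sub>! \<stileturn> G\<^sub>!\<close>\<close>

text \<open>
  The hom-bijection from arrows \<open>A \<rightarrow> G\<^sub>!(y, b, \<upsilon>, \<mu>)\<close> to arrows \<open>F\<^sub>! A \<rightarrow> (y, b, \<upsilon>, \<mu>)\<close>.
\<close>

definition shriek_transpose :: "('o, 'v, 'h, 'c) dbl \<Rightarrow> ('p, 'w, 'k, 'd) dbl \<Rightarrow>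
    ('o, 'v, 'h, 'c) mnd \<Rightarrow> ('p, 'w, 'k, 'd) mnd \<Rightarrow>
    ('o, 'v, 'h, 'c, 'p, 'w, 'k, 'd) laxf \<Rightarrow> ('o, 'h, 'w, 'd) vtr \<Rightarrow>
    ('p, 'w, 'k, 'd, 'o, 'v, 'h, 'c) laxf \<Rightarrow> ('p, 'k, 'v, 'c) vtr \<Rightarrow> ('p, 'k, 'w, 'd) vtr \<Rightarrow>
    ('w \<Rightarrow> ('k, 'd) conj) \<Rightarrow> ('v \<Rightarrow> ('h, 'c) comp) \<Rightarrow>
    ('p, 'k, 'd) halg \<Rightarrow> ('o, 'v, 'h, 'c) harr \<Rightarrow> ('p, 'w, 'k, 'd) harr" where
  "shriek_transpose D E S T F \<phi> G \<psi> \<epsilon> cj cp = (\<lambda>(y, b, \<upsilon>, \<mu>) (A, (f, \<zeta>), B).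
     (let x = fst A; Gb = fh G b; g = t0 \<epsilon> y \<circ>\<^bsub>E\<^esub> fv F f;
          \<chi> = t1 \<epsilon> b \<bullet>\<^bsub>E\<^esub> fc F (Rho D Gb \<bullet>\<^bsub>D\<^esub> ((cid D Gb \<odot>\<^bsub>D\<^esub> comp_delta (cp (t0 \<psi> y))) \<bullet>\<^bsub>D\<^esub> \<zeta>))
      in (F_shriek D E S T F \<phi> cj A,
          (g, Rho E b \<bullet>\<^bsub>E\<^esub> (\<chi> \<odot>\<^bsub>E\<^esub> (cunit E (fv (mfun T) g) \<bullet>\<^bsub>E\<^esub> conj_eps (cj (t0 \<phi> x))))),
          (y, b, \<upsilon>, \<mu>))))"

definition shriek_counit :: "('o, 'v, 'h, 'c) dbl \<Rightarrow> ('p, 'w, 'k, 'd) dbl \<Rightarrow>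
    ('o, 'v, 'h, 'c) mnd \<Rightarrow> ('p, 'w, 'k, 'd) mnd \<Rightarrow>
    ('o, 'v, 'h, 'c, 'p, 'w, 'k, 'd) laxf \<Rightarrow> ('o, 'h, 'w, 'd) vtr \<Rightarrow>
    ('p, 'w, 'k, 'd, 'o, 'v, 'h, 'c) laxf \<Rightarrow> ('p, 'k, 'v, 'c) vtr \<Rightarrow> ('p, 'k, 'w, 'd) vtr \<Rightarrow>
    ('w \<Rightarrow> ('k, 'd) conj) \<Rightarrow> ('v \<Rightarrow> ('h, 'c) comp) \<Rightarrow>
    ('p, 'k, 'd) halg \<Rightarrow> ('p, 'w, 'k, 'd) harr" where
  "shriek_counit D E S T F \<phi> G \<psi> \<epsilon> cj cp Y =
     shriek_transpose D E S T F \<phi> G \<psi> \<epsilon> cj cp Y (Ide (HLaxAlg D S) (G_shriek E D T S G \<psi> cp Y))"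

end

theory Submission
  imports Defs
begin

text \<open>
  Let \<open>a = Gb \<cdot> \<psi>\<^sub>y\<^sub>!\<close> be the carrier of \<open>G\<^sub>!(y, b)\<close>. The cell \<open>\<rho> \<circ> (id \<cdot> \<delta>) : a \<rightarrow> Gb\<close> is a restriction
  along \<open>\<psi>\<^sub>y\<close>, and a lax functor inverts it as soon as it inverts \<open>\<psi>\<^sub>y\<close>. Let \<open>p\<close> be the counit cell of the
  conjoint of \<open>\<epsilon>\<^sub>T\<^sub>y\<close>. The cell \<open>\<zeta>\<close> of the counit at \<open>(y, b)\<close> is \<open>\<rho> \<circ> (\<epsilon>\<^sub>b \<cdot> p)\<close> after a horizontal composite of two
  invertible cells: \<open>F\<close> of the restriction above, and the cell \<open>\<phi>\<^sup>* \<rightarrow> (\<epsilon>\<^sub>T\<^sub>y)\<^sup>*\<close> induced by the mate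
  identity \<open>T\<epsilon>\<^sub>y \<circ> \<phi> = \<epsilon>\<^sub>T\<^sub>y \<circ> F\<psi>\<^sub>y\<close>. As \<open>\<epsilon>\<^sub>y\<close> is invertible, \<open>\<rho> \<circ> (\<epsilon>\<^sub>b \<cdot> p)\<close> is \<open>n\<close> followed by an invertible cell.
  Hence \<open>\<zeta>\<close> is invertible if and only if \<open>n\<close> is. Moreover \<open>\<zeta>\<close> commutes with units and multiplications; so
  when it is invertible, the algebra laws of \<open>F\<^sub>!G\<^sub>!(y, b)\<close> follow from those of \<open>(y, b)\<close> by cancelling \<open>\<zeta>\<close>, and
  \<open>\<zeta>\<close> is an isomorphism of algebras.
\<close>

section \<open>Categories and isomorphisms\<close>

text \<open>The multiplications of \<open>F\<^sub>!\<close> and \<open>G\<^sub>!\<close> are the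
  obstacle: each nests associators, an inverted \<theta> and a comparison \<open>n\<close>. They are
  therefore evaluated only after composition with a cell of the shape \<rho> o (\<chi> . E), where E
  ends in a unit; there every auxiliary cell can be replaced by its defining equation, stated
  through \<open>conj_eps\<close> or \<open>comp_delta\<close>. One calculation,
  \<open>unitor_tensor\<close>, then serves both sides: with \<open>n\<close> itself for companions
  in \<open>D\<close>, and with the inverse of \<open>n\<close> for conjoints in \<open>E\<close>.
  Laxness separates companions from conjoints. The composite p . \<open>f\<^sub>!\<close> is a
  restriction of p, and lax functors preserve such restrictions, so \<theta>' is always invertible.
  The composite p . \<open>f\<^sup>*\<close> is an extension, whose preservation by \<open>T\<close>
  has to be supplied as invertibility of \<theta>.\<close>

context category begin

lemma inverse_arrows_unique:
  assumes "inverse_arrows C f g" and "inverse_arrows C f h"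
  shows "g = h"
proof -
  note * = assms[unfolded inverse_arrows_def]
  have "g = Cmp C (Cmp C h f) g"
    using * Cmp_Ide_left[of g] by simp
  also have "\<dots> = Cmp C h (Cmp C f g)"
    using * Cmp_assoc[of g f h] by simp
  also have "\<dots> = h"
    using * Cmp_Ide_right[of h] by simp
  finally show ?thesis .
qed

lemma inverse_in_eqI: "inverse_arrows C f g \<Longrightarrow> inverse_in C f = g"
  unfolding inverse_in_def by (blast intro: inverse_arrows_unique)

lemma inverse_arrows_inverse_in: "is_iso C f \<Longrightarrow> inverse_arrows C f (inverse_in C f)"
  using inverse_in_eqI unfolding is_iso_def by auto

lemma inverse_in_simps:
  assumes "is_iso C f"
  shows "inverse_in C f \<in> Arr C" "Src C (inverse_in C f) = Tgt C f" "Tgt C (inverse_in C f) = Src C f"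
    "Cmp C (inverse_in C f) f = Ide C (Src C f)" "Cmp C f (inverse_in C f) = Ide C (Tgt C f)"
  using inverse_arrows_inverse_in[OF assms] unfolding inverse_arrows_def by auto

lemma is_iso_Arr: "is_iso C f \<Longrightarrow> f \<in> Arr C"
  by (auto simp: is_iso_def inverse_arrows_def)

lemma is_iso_inverse_in: "is_iso C f \<Longrightarrow> is_iso C (inverse_in C f)"
  using inverse_arrows_inverse_in[of f] unfolding is_iso_def inverse_arrows_def by metis

lemma is_iso_Cmp:
  assumes "is_iso C f" "is_iso C g" "Src C g = Tgt C f"
  shows "is_iso C (Cmp C g f)"
proof -
  let ?f = "inverse_in C f" and ?g = "inverse_in C g"
  note f = inverse_in_simps[OF assms(1)] is_iso_Arr[OF assms(1)]
  note g = inverse_in_simps[OF assms(2)] is_iso_Arr[OF assms(2)]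
  have "Cmp C (Cmp C ?f ?g) (Cmp C g f) = Cmp C ?f (Cmp C ?g (Cmp C g f))"
    using f g assms(3) by (intro Cmp_assoc[symmetric]) (simp_all add: Cmp_in Tgt_Cmp)
  also have "Cmp C ?g (Cmp C g f) = f"
    using f g assms(3) Cmp_assoc[of f g ?g] Cmp_Ide_left[of f] by simp
  finally have 1: "Cmp C (Cmp C ?f ?g) (Cmp C g f) = Ide C (Src C f)"
    using f by simp
  have "Cmp C (Cmp C g f) (Cmp C ?f ?g) = Cmp C g (Cmp C f (Cmp C ?f ?g))"
    using f g assms(3) by (intro Cmp_assoc[symmetric]) (simp_all add: Cmp_in Tgt_Cmp)
  also have "Cmp C f (Cmp C ?f ?g) = ?g"
    using f g assms(3) Cmp_assoc[of ?g ?f f] Cmp_Ide_left[of ?g] by simp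
  finally have "Cmp C (Cmp C g f) (Cmp C ?f ?g) = Ide C (Tgt C g)"
    using g by simp
  with 1 have "inverse_arrows C (Cmp C g f) (Cmp C ?f ?g)"
    using f g assms(3) by (simp add: inverse_arrows_def Cmp_in Src_Cmp Tgt_Cmp)
  then show ?thesis unfolding is_iso_def by blast
qed

lemma Cmp_left_cancel:
  assumes "is_iso C h" "f \<in> Arr C" "g \<in> Arr C" "Tgt C f = Src C h" "Tgt C g = Src C h"
    and "Cmp C h f = Cmp C h g"
  shows "f = g"
  using assms inverse_in_simps[OF assms(1)] is_iso_Arr[OF assms(1)] Cmp_assoc[of f h "inverse_in C h"]
    Cmp_assoc[of g h "inverse_in C h"] Cmp_Ide_left[of f] Cmp_Ide_left[of g]
  by simp

lemma Cmp_right_cancel: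
  assumes "is_iso C h" "f \<in> Arr C" "g \<in> Arr C" "Src C f = Tgt C h" "Src C g = Tgt C h"
    and "Cmp C f h = Cmp C g h"
  shows "f = g"
  using assms inverse_in_simps[OF assms(1)] is_iso_Arr[OF assms(1)] Cmp_assoc[of "inverse_in C h" h f]
    Cmp_assoc[of "inverse_in C h" h g] Cmp_Ide_right[of f] Cmp_Ide_right[of g]
  by simp

lemma is_iso_Cmp_right_iff:
  assumes "is_iso C h" "f \<in> Arr C" "Src C f = Tgt C h"
  shows "is_iso C (Cmp C f h) \<longleftrightarrow> is_iso C f"
proof
  assume "is_iso C (Cmp C f h)"
  from is_iso_Cmp[OF is_iso_inverse_in[OF assms(1)] this]
  have "is_iso C (Cmp C (Cmp C f h) (inverse_in C h))"
    using assms inverse_in_simps[OF assms(1)] is_iso_Arr[OF assms(1)] by (simp add: Src_Cmp)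
  moreover have "Cmp C (Cmp C f h) (inverse_in C h) = f"
    using assms inverse_in_simps[OF assms(1)] is_iso_Arr[OF assms(1)]
      Cmp_assoc[of "inverse_in C h" h f] Cmp_Ide_right[of f] by simp
  ultimately show "is_iso C f" by simp
qed (use assms is_iso_Cmp in auto)

lemma is_iso_Cmp_left_iff:
  assumes "is_iso C h" "f \<in> Arr C" "Tgt C f = Src C h"
  shows "is_iso C (Cmp C h f) \<longleftrightarrow> is_iso C f"
proof
  assume "is_iso C (Cmp C h f)"
  from is_iso_Cmp[OF this is_iso_inverse_in[OF assms(1)]]
  have "is_iso C (Cmp C (inverse_in C h) (Cmp C h f))"
    using assms inverse_in_simps[OF assms(1)] is_iso_Arr[OF assms(1)] by (simp add: Tgt_Cmp)
  moreover have "Cmp C (inverse_in C h) (Cmp C h f) = f"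
    using assms inverse_in_simps[OF assms(1)] is_iso_Arr[OF assms(1)]
      Cmp_assoc[of f h "inverse_in C h"] Cmp_Ide_left[of f] by simp
  ultimately show "is_iso C f" by simp
qed (use assms is_iso_Cmp in auto)

end

section \<open>Calculating in a pseudodouble category\<close>

context pseudodouble_category begin

lemma functor_simps:
  "r \<in> Obj (Hor D) \<Longrightarrow> hdom D r \<in> Obj (Ver D)"
  "r \<in> Obj (Hor D) \<Longrightarrow> hcod D r \<in> Obj (Ver D)"
  "x \<in> Obj (Ver D) \<Longrightarrow> hunit D x \<in> Obj (Hor D)"
  "x \<in> Obj (Ver D) \<Longrightarrow> hdom D (hunit D x) = x"
  "x \<in> Obj (Ver D) \<Longrightarrow> hcod D (hunit D x) = x"
  "\<beta> \<in> Arr (Hor D) \<Longrightarrow> cdom D \<beta> \<in> Arr (Ver D)"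
  "\<beta> \<in> Arr (Hor D) \<Longrightarrow> ccod D \<beta> \<in> Arr (Ver D)"
  "\<beta> \<in> Arr (Hor D) \<Longrightarrow> Src (Ver D) (cdom D \<beta>) = hdom D (Src (Hor D) \<beta>)"
  "\<beta> \<in> Arr (Hor D) \<Longrightarrow> Src (Ver D) (ccod D \<beta>) = hcod D (Src (Hor D) \<beta>)"
  "\<beta> \<in> Arr (Hor D) \<Longrightarrow> Tgt (Ver D) (cdom D \<beta>) = hdom D (Tgt (Hor D) \<beta>)"
  "\<beta> \<in> Arr (Hor D) \<Longrightarrow> Tgt (Ver D) (ccod D \<beta>) = hcod D (Tgt (Hor D) \<beta>)"
  "r \<in> Obj (Hor D) \<Longrightarrow> cdom D (cid D r) = vid D (hdom D r)"
  "r \<in> Obj (Hor D) \<Longrightarrow> ccod D (cid D r) = vid D (hcod D r)"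
  "f \<in> Arr (Ver D) \<Longrightarrow> cunit D f \<in> Arr (Hor D)"
  "f \<in> Arr (Ver D) \<Longrightarrow> Src (Hor D) (cunit D f) = hunit D (Src (Ver D) f)"
  "f \<in> Arr (Ver D) \<Longrightarrow> Tgt (Hor D) (cunit D f) = hunit D (Tgt (Ver D) f)"
  "f \<in> Arr (Ver D) \<Longrightarrow> cdom D (cunit D f) = f"
  "f \<in> Arr (Ver D) \<Longrightarrow> ccod D (cunit D f) = f"
  "x \<in> Obj (Ver D) \<Longrightarrow> cunit D (vid D x) = cid D (hunit D x)"
  "\<lbrakk>\<beta> \<in> Arr (Hor D); \<gamma> \<in> Arr (Hor D); Src (Hor D) \<gamma> = Tgt (Hor D) \<beta>\<rbrakk>
     \<Longrightarrow> cdom D (\<gamma> \<bullet>\<^bsub>D\<^esub> \<beta>) = cdom D \<gamma> \<circ>\<^bsub>D\<^esub> cdom D \<beta>"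
  "\<lbrakk>\<beta> \<in> Arr (Hor D); \<gamma> \<in> Arr (Hor D); Src (Hor D) \<gamma> = Tgt (Hor D) \<beta>\<rbrakk>
     \<Longrightarrow> ccod D (\<gamma> \<bullet>\<^bsub>D\<^esub> \<beta>) = ccod D \<gamma> \<circ>\<^bsub>D\<^esub> ccod D \<beta>"
  using dom_functor cod_functor unit_functor hunit_boundary cunit_boundary
  unfolding is_functor_def by auto

lemma cunit_Cmp:
  "\<lbrakk>f \<in> Arr (Ver D); g \<in> Arr (Ver D); Src (Ver D) g = Tgt (Ver D) f\<rbrakk>
     \<Longrightarrow> cunit D g \<bullet>\<^bsub>D\<^esub> cunit D f = cunit D (g \<circ>\<^bsub>D\<^esub> f)"
  using unit_functor unfolding is_functor_def by auto

lemma hcmp_simps: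
  assumes "r \<in> Obj (Hor D)" "s \<in> Obj (Hor D)" "hdom D s = hcod D r"
  shows "s \<cdot>\<^bsub>D\<^esub> r \<in> Obj (Hor D)" "hdom D (s \<cdot>\<^bsub>D\<^esub> r) = hdom D r" "hcod D (s \<cdot>\<^bsub>D\<^esub> r) = hcod D s"
  using hcmp_boundary[OF assms] by auto

lemma ccmp_simps:
  assumes "\<alpha> \<in> Arr (Hor D)" "\<beta> \<in> Arr (Hor D)" "cdom D \<beta> = ccod D \<alpha>"
  shows "\<beta> \<odot>\<^bsub>D\<^esub> \<alpha> \<in> Arr (Hor D)"
    "Src (Hor D) (\<beta> \<odot>\<^bsub>D\<^esub> \<alpha>) = Src (Hor D) \<beta> \<cdot>\<^bsub>D\<^esub> Src (Hor D) \<alpha>"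
    "Tgt (Hor D) (\<beta> \<odot>\<^bsub>D\<^esub> \<alpha>) = Tgt (Hor D) \<beta> \<cdot>\<^bsub>D\<^esub> Tgt (Hor D) \<alpha>"
    "cdom D (\<beta> \<odot>\<^bsub>D\<^esub> \<alpha>) = cdom D \<alpha>" "ccod D (\<beta> \<odot>\<^bsub>D\<^esub> \<alpha>) = ccod D \<beta>"
  using ccmp_boundary[where \<alpha> = \<alpha> and r = "Src (Hor D) \<alpha>" and r' = "Tgt (Hor D) \<alpha>" and f = "cdom D \<alpha>"
      and g = "ccod D \<alpha>" and \<beta> = \<beta> and s = "Src (Hor D) \<beta>" and s' = "Tgt (Hor D) \<beta>" and h = "ccod D \<beta>"] assms
  unfolding cell_def by auto

lemma globular_simps:
  assumes "globular D r s \<beta>" "r \<in> Obj (Hor D)"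
  shows "\<beta> \<in> Arr (Hor D)" "Src (Hor D) \<beta> = r" "Tgt (Hor D) \<beta> = s"
    "cdom D \<beta> = vid D (hdom D r)" "ccod D \<beta> = vid D (hcod D r)"
  using assms unfolding globular_def cell_def by auto


text \<open>These rules let the simplifier decide the boundary conditions of composites, so that
  later calculations only have to list the boundaries of their atomic cells.\<close>

lemmas dbl_simps [simp] =
  ver.Src_in ver.Tgt_in ver.Ide_in ver.Src_Ide ver.Tgt_Ide ver.Cmp_in ver.Src_Cmp ver.Tgt_Cmp
  hor.Src_in hor.Tgt_in hor.Ide_in hor.Src_Ide hor.Tgt_Ide hor.Cmp_in hor.Src_Cmp hor.Tgt_Cmp
  functor_simps hcmp_simps ccmp_simps cunit_Cmp ccmp_cid

lemma Cmp_vid [simp]: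
  "\<lbrakk>f \<in> Arr (Ver D); Src (Ver D) f = x\<rbrakk> \<Longrightarrow> f \<circ>\<^bsub>D\<^esub> vid D x = f"
  "\<lbrakk>f \<in> Arr (Ver D); Tgt (Ver D) f = x\<rbrakk> \<Longrightarrow> vid D x \<circ>\<^bsub>D\<^esub> f = f"
  using ver.Cmp_Ide_right ver.Cmp_Ide_left by auto

lemma Cmp_cid [simp]:
  "\<lbrakk>\<beta> \<in> Arr (Hor D); Src (Hor D) \<beta> = r\<rbrakk> \<Longrightarrow> \<beta> \<bullet>\<^bsub>D\<^esub> cid D r = \<beta>"
  "\<lbrakk>\<beta> \<in> Arr (Hor D); Tgt (Hor D) \<beta> = r\<rbrakk> \<Longrightarrow> cid D r \<bullet>\<^bsub>D\<^esub> \<beta> = \<beta>"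
  using hor.Cmp_Ide_right hor.Cmp_Ide_left by auto

lemma vassoc [simp]:
  "\<lbrakk>f \<in> Arr (Ver D); g \<in> Arr (Ver D); h \<in> Arr (Ver D);
    Src (Ver D) g = Tgt (Ver D) f; Src (Ver D) h = Tgt (Ver D) g\<rbrakk>
    \<Longrightarrow> (h \<circ>\<^bsub>D\<^esub> g) \<circ>\<^bsub>D\<^esub> f = h \<circ>\<^bsub>D\<^esub> (g \<circ>\<^bsub>D\<^esub> f)"
  using ver.Cmp_assoc by simp

text \<open>Kept out of the simp set, unlike \<open>vassoc\<close>: calculations with cells
  rebracket in both directions, whereas vertical boundaries need a single normal form.\<close>

lemma cassoc:
  "\<lbrakk>\<alpha> \<in> Arr (Hor D); \<beta> \<in> Arr (Hor D); \<gamma> \<in> Arr (Hor D);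
    Src (Hor D) \<beta> = Tgt (Hor D) \<alpha>; Src (Hor D) \<gamma> = Tgt (Hor D) \<beta>\<rbrakk>
    \<Longrightarrow> (\<gamma> \<bullet>\<^bsub>D\<^esub> \<beta>) \<bullet>\<^bsub>D\<^esub> \<alpha> = \<gamma> \<bullet>\<^bsub>D\<^esub> (\<beta> \<bullet>\<^bsub>D\<^esub> \<alpha>)"
  using hor.Cmp_assoc by simp

lemma cunit_Cmp_extend:
  "\<lbrakk>f \<in> Arr (Ver D); g \<in> Arr (Ver D); Src (Ver D) g = Tgt (Ver D) f; \<alpha> \<in> Arr (Hor D);
     Tgt (Hor D) \<alpha> = hunit D (Src (Ver D) f)\<rbrakk>
     \<Longrightarrow> cunit D g \<bullet>\<^bsub>D\<^esub> (cunit D f \<bullet>\<^bsub>D\<^esub> \<alpha>) = cunit D (g \<circ>\<^bsub>D\<^esub> f) \<bullet>\<^bsub>D\<^esub> \<alpha>"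
  by (simp add: cassoc[symmetric])

text \<open>The interchange law oriented to join two horizontal composites into one, with its typing
  premises restated as equations between boundaries that the simplifier can discharge.\<close>

lemma ccmp_merge:
  assumes "\<alpha> \<in> Arr (Hor D)" "\<alpha>' \<in> Arr (Hor D)" "\<beta> \<in> Arr (Hor D)" "\<beta>' \<in> Arr (Hor D)"
    "Src (Hor D) \<alpha>' = Tgt (Hor D) \<alpha>" "Src (Hor D) \<beta>' = Tgt (Hor D) \<beta>"
    "cdom D \<beta> = ccod D \<alpha>" "cdom D \<beta>' = ccod D \<alpha>'"
  shows "(\<beta>' \<odot>\<^bsub>D\<^esub> \<alpha>') \<bullet>\<^bsub>D\<^esub> (\<beta> \<odot>\<^bsub>D\<^esub> \<alpha>) = (\<beta>' \<bullet>\<^bsub>D\<^esub> \<beta>) \<odot>\<^bsub>D\<^esub> (\<alpha>' \<bullet>\<^bsub>D\<^esub> \<alpha>)"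
  using assms interchange[where \<alpha> = \<alpha> and r = "Src (Hor D) \<alpha>" and r' = "Tgt (Hor D) \<alpha>" and f = "cdom D \<alpha>"
      and g = "ccod D \<alpha>" and \<alpha>' = \<alpha>' and r'' = "Tgt (Hor D) \<alpha>'" and f' = "cdom D \<alpha>'" and g' = "ccod D \<alpha>'"
      and \<beta> = \<beta> and s = "Src (Hor D) \<beta>" and s' = "Tgt (Hor D) \<beta>" and h = "ccod D \<beta>"
      and \<beta>' = \<beta>' and s'' = "Tgt (Hor D) \<beta>'" and h' = "ccod D \<beta>'"]
  by (simp add: cell_def)

text \<open>Form of \<open>ccmp_merge\<close> for the head of a right-nested composite, where the
  remaining cells have been pushed into \<gamma>.\<close>

lemma ccmp_merge_extend:
  assumes "\<alpha> \<in> Arr (Hor D)" "\<alpha>' \<in> Arr (Hor D)" "\<beta> \<in> Arr (Hor D)" "\<beta>' \<in> Arr (Hor D)"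
    "Src (Hor D) \<alpha>' = Tgt (Hor D) \<alpha>" "Src (Hor D) \<beta>' = Tgt (Hor D) \<beta>"
    "cdom D \<beta> = ccod D \<alpha>" "cdom D \<beta>' = ccod D \<alpha>'"
    "\<gamma> \<in> Arr (Hor D)" "Tgt (Hor D) \<gamma> = Src (Hor D) \<beta> \<cdot>\<^bsub>D\<^esub> Src (Hor D) \<alpha>"
  shows "(\<beta>' \<odot>\<^bsub>D\<^esub> \<alpha>') \<bullet>\<^bsub>D\<^esub> ((\<beta> \<odot>\<^bsub>D\<^esub> \<alpha>) \<bullet>\<^bsub>D\<^esub> \<gamma>) = ((\<beta>' \<bullet>\<^bsub>D\<^esub> \<beta>) \<odot>\<^bsub>D\<^esub> (\<alpha>' \<bullet>\<^bsub>D\<^esub> \<alpha>)) \<bullet>\<^bsub>D\<^esub> \<gamma>"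
  using assms by (simp add: cassoc[symmetric] ccmp_merge)

lemma cellD:
  assumes "cell D r s f g \<beta>"
  shows "\<beta> \<in> Arr (Hor D)" "Src (Hor D) \<beta> = r" "Tgt (Hor D) \<beta> = s" "cdom D \<beta> = f" "ccod D \<beta> = g"
    "r \<in> Obj (Hor D)" "s \<in> Obj (Hor D)" "f \<in> Arr (Ver D)" "g \<in> Arr (Ver D)"
    "Src (Ver D) f = hdom D r" "Tgt (Ver D) f = hdom D s"
    "Src (Ver D) g = hcod D r" "Tgt (Ver D) g = hcod D s"
  using assms unfolding cell_def by auto

lemma Lam_facts [simp]:
  assumes "r \<in> Obj (Hor D)"
  shows "Lam D r \<in> Arr (Hor D)" "Src (Hor D) (Lam D r) = hunit D (hcod D r) \<cdot>\<^bsub>D\<^esub> r"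
    "Tgt (Hor D) (Lam D r) = r"
    "cdom D (Lam D r) = vid D (hdom D r)" "ccod D (Lam D r) = vid D (hcod D r)"
    "is_iso (Hor D) (Lam D r)"
  using Lam_globular[OF assms] assms unfolding globular_def cell_def by auto

lemma Rho_facts [simp]:
  assumes "r \<in> Obj (Hor D)"
  shows "Rho D r \<in> Arr (Hor D)" "Src (Hor D) (Rho D r) = r \<cdot>\<^bsub>D\<^esub> hunit D (hdom D r)"
    "Tgt (Hor D) (Rho D r) = r"
    "cdom D (Rho D r) = vid D (hdom D r)" "ccod D (Rho D r) = vid D (hcod D r)"
    "is_iso (Hor D) (Rho D r)"
  using Rho_globular[OF assms] assms unfolding globular_def cell_def by auto

lemma Alp_facts [simp]:
  assumes "r \<in> Obj (Hor D)" "s \<in> Obj (Hor D)" "t \<in> Obj (Hor D)" "hdom D s = hcod D r" "hdom D t = hcod D s"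
  shows "Alp D t s r \<in> Arr (Hor D)" "Src (Hor D) (Alp D t s r) = (t \<cdot>\<^bsub>D\<^esub> s) \<cdot>\<^bsub>D\<^esub> r"
    "Tgt (Hor D) (Alp D t s r) = t \<cdot>\<^bsub>D\<^esub> (s \<cdot>\<^bsub>D\<^esub> r)"
    "cdom D (Alp D t s r) = vid D (hdom D r)" "ccod D (Alp D t s r) = vid D (hcod D t)"
    "is_iso (Hor D) (Alp D t s r)"
  using Alp_globular[OF assms] assms unfolding globular_def cell_def by auto

lemma inverse_in_facts:
  assumes "is_iso (Hor D) \<beta>"
  shows "inverse_in (Hor D) \<beta> \<in> Arr (Hor D)"
    "Src (Hor D) (inverse_in (Hor D) \<beta>) = Tgt (Hor D) \<beta>"
    "Tgt (Hor D) (inverse_in (Hor D) \<beta>) = Src (Hor D) \<beta>"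
    "inverse_in (Hor D) \<beta> \<bullet>\<^bsub>D\<^esub> \<beta> = cid D (Src (Hor D) \<beta>)"
    "\<beta> \<bullet>\<^bsub>D\<^esub> inverse_in (Hor D) \<beta> = cid D (Tgt (Hor D) \<beta>)"
    "is_iso (Hor D) (inverse_in (Hor D) \<beta>)"
  using hor.inverse_in_simps[OF assms] hor.is_iso_inverse_in[OF assms] by auto

text \<open>Invertibility in \<open>Hor D\<close> speaks of 2-cells alone. Functoriality of dom and
  cod makes the boundaries of the inverse cancel those of \<beta>, so they are identities when the
  latter are.\<close>

lemma inverse_in_boundary:
  assumes "is_iso (Hor D) \<beta>" "cdom D \<beta> = vid D x" "ccod D \<beta> = vid D y"
    "hdom D (Src (Hor D) \<beta>) = x" "hcod D (Src (Hor D) \<beta>) = y"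
  shows "cdom D (inverse_in (Hor D) \<beta>) = vid D x" "ccod D (inverse_in (Hor D) \<beta>) = vid D y"
proof -
  note b = inverse_in_facts[OF assms(1)] hor.is_iso_Arr[OF assms(1)]
  have x: "x = hdom D (Tgt (Hor D) \<beta>)" "y = hcod D (Tgt (Hor D) \<beta>)"
    using b assms functor_simps(10,11)[OF b(7)] by auto
  have "cdom D (inverse_in (Hor D) \<beta>) \<circ>\<^bsub>D\<^esub> cdom D \<beta> = vid D x"
    "ccod D (inverse_in (Hor D) \<beta>) \<circ>\<^bsub>D\<^esub> ccod D \<beta> = vid D y"
    using b assms functor_simps(20,21)[OF b(7) b(1,2)] by simp_all
  then show "cdom D (inverse_in (Hor D) \<beta>) = vid D x" "ccod D (inverse_in (Hor D) \<beta>) = vid D y"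
    using b assms x by simp_all
qed

section \<open>Inverse unitors and associators and their naturality\<close>

abbreviation "LamI r \<equiv> inverse_in (Hor D) (Lam D r)"
abbreviation "RhoI r \<equiv> inverse_in (Hor D) (Rho D r)"
abbreviation "AlpI t s r \<equiv> inverse_in (Hor D) (Alp D t s r)"

lemma LamI_facts [simp]:
  assumes "r \<in> Obj (Hor D)"
  shows "LamI r \<in> Arr (Hor D)" "Src (Hor D) (LamI r) = r" "Tgt (Hor D) (LamI r) = hunit D (hcod D r) \<cdot>\<^bsub>D\<^esub> r"
    "cdom D (LamI r) = vid D (hdom D r)" "ccod D (LamI r) = vid D (hcod D r)"
    "is_iso (Hor D) (LamI r)" "Lam D r \<bullet>\<^bsub>D\<^esub> LamI r = cid D r" "LamI r \<bullet>\<^bsub>D\<^esub> Lam D r = cid D (hunit D (hcod D r) \<cdot>\<^bsub>D\<^esub> r)"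
  by (rule inverse_in_boundary[where x = "hdom D r" and y = "hcod D r"] | simp add: assms inverse_in_facts)+

lemma RhoI_facts [simp]:
  assumes "r \<in> Obj (Hor D)"
  shows "RhoI r \<in> Arr (Hor D)" "Src (Hor D) (RhoI r) = r" "Tgt (Hor D) (RhoI r) = r \<cdot>\<^bsub>D\<^esub> hunit D (hdom D r)"
    "cdom D (RhoI r) = vid D (hdom D r)" "ccod D (RhoI r) = vid D (hcod D r)"
    "is_iso (Hor D) (RhoI r)" "Rho D r \<bullet>\<^bsub>D\<^esub> RhoI r = cid D r" "RhoI r \<bullet>\<^bsub>D\<^esub> Rho D r = cid D (r \<cdot>\<^bsub>D\<^esub> hunit D (hdom D r))"
  by (rule inverse_in_boundary[where x = "hdom D r" and y = "hcod D r"] | simp add: assms inverse_in_facts)+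

lemma AlpI_facts [simp]:
  assumes "r \<in> Obj (Hor D)" "s \<in> Obj (Hor D)" "t \<in> Obj (Hor D)" "hdom D s = hcod D r" "hdom D t = hcod D s"
  shows "AlpI t s r \<in> Arr (Hor D)" "Src (Hor D) (AlpI t s r) = t \<cdot>\<^bsub>D\<^esub> (s \<cdot>\<^bsub>D\<^esub> r)"
    "Tgt (Hor D) (AlpI t s r) = (t \<cdot>\<^bsub>D\<^esub> s) \<cdot>\<^bsub>D\<^esub> r"
    "cdom D (AlpI t s r) = vid D (hdom D r)" "ccod D (AlpI t s r) = vid D (hcod D t)"
    "is_iso (Hor D) (AlpI t s r)" "Alp D t s r \<bullet>\<^bsub>D\<^esub> AlpI t s r = cid D (t \<cdot>\<^bsub>D\<^esub> (s \<cdot>\<^bsub>D\<^esub> r))"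
    "AlpI t s r \<bullet>\<^bsub>D\<^esub> Alp D t s r = cid D ((t \<cdot>\<^bsub>D\<^esub> s) \<cdot>\<^bsub>D\<^esub> r)"
  by (rule inverse_in_boundary[where x = "hdom D r" and y = "hcod D t"] | simp add: assms inverse_in_facts)+

lemma Lam_nat:
  "\<lbrakk>\<alpha> \<in> Arr (Hor D); Tgt (Hor D) \<alpha> = s; ccod D \<alpha> = g\<rbrakk>
     \<Longrightarrow> Lam D s \<bullet>\<^bsub>D\<^esub> (cunit D g \<odot>\<^bsub>D\<^esub> \<alpha>) = \<alpha> \<bullet>\<^bsub>D\<^esub> Lam D (Src (Hor D) \<alpha>)"
  using Lam_natural unfolding cell_def by auto

lemma Rho_nat:
  "\<lbrakk>\<alpha> \<in> Arr (Hor D); Tgt (Hor D) \<alpha> = s; cdom D \<alpha> = f\<rbrakk>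
     \<Longrightarrow> Rho D s \<bullet>\<^bsub>D\<^esub> (\<alpha> \<odot>\<^bsub>D\<^esub> cunit D f) = \<alpha> \<bullet>\<^bsub>D\<^esub> Rho D (Src (Hor D) \<alpha>)"
  using Rho_natural unfolding cell_def by auto

lemma Alp_nat:
  "\<lbrakk>\<alpha> \<in> Arr (Hor D); \<beta> \<in> Arr (Hor D); \<gamma> \<in> Arr (Hor D); cdom D \<beta> = ccod D \<alpha>; cdom D \<gamma> = ccod D \<beta>;
    Tgt (Hor D) \<alpha> = r'; Tgt (Hor D) \<beta> = s'; Tgt (Hor D) \<gamma> = t'\<rbrakk>
     \<Longrightarrow> Alp D t' s' r' \<bullet>\<^bsub>D\<^esub> ((\<gamma> \<odot>\<^bsub>D\<^esub> \<beta>) \<odot>\<^bsub>D\<^esub> \<alpha>)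
       = (\<gamma> \<odot>\<^bsub>D\<^esub> (\<beta> \<odot>\<^bsub>D\<^esub> \<alpha>)) \<bullet>\<^bsub>D\<^esub> Alp D (Src (Hor D) \<gamma>) (Src (Hor D) \<beta>) (Src (Hor D) \<alpha>)"
  using Alp_natural unfolding cell_def by auto

lemma LamI_nat:
  assumes "\<alpha> \<in> Arr (Hor D)" "Tgt (Hor D) \<alpha> = s"
  shows "LamI s \<bullet>\<^bsub>D\<^esub> \<alpha> = (cunit D (ccod D \<alpha>) \<odot>\<^bsub>D\<^esub> \<alpha>) \<bullet>\<^bsub>D\<^esub> LamI (Src (Hor D) \<alpha>)"
proof -
  have "LamI s \<bullet>\<^bsub>D\<^esub> \<alpha> = LamI s \<bullet>\<^bsub>D\<^esub> ((\<alpha> \<bullet>\<^bsub>D\<^esub> Lam D (Src (Hor D) \<alpha>)) \<bullet>\<^bsub>D\<^esub> LamI (Src (Hor D) \<alpha>))"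
    by (simp add: assms(1) assms(2)[symmetric] cassoc)
  also have "\<dots> = LamI s \<bullet>\<^bsub>D\<^esub> ((Lam D s \<bullet>\<^bsub>D\<^esub> (cunit D (ccod D \<alpha>) \<odot>\<^bsub>D\<^esub> \<alpha>)) \<bullet>\<^bsub>D\<^esub> LamI (Src (Hor D) \<alpha>))"
    using assms by (simp add: Lam_nat)
  also have "\<dots> = (LamI s \<bullet>\<^bsub>D\<^esub> Lam D s) \<bullet>\<^bsub>D\<^esub> ((cunit D (ccod D \<alpha>) \<odot>\<^bsub>D\<^esub> \<alpha>) \<bullet>\<^bsub>D\<^esub> LamI (Src (Hor D) \<alpha>))"
    by (simp add: assms(1) assms(2)[symmetric] cassoc del: LamI_facts(8))
  finally show ?thesis by (simp add: assms(1) assms(2)[symmetric])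
qed

lemma RhoI_nat:
  assumes "\<alpha> \<in> Arr (Hor D)" "Tgt (Hor D) \<alpha> = s"
  shows "RhoI s \<bullet>\<^bsub>D\<^esub> \<alpha> = (\<alpha> \<odot>\<^bsub>D\<^esub> cunit D (cdom D \<alpha>)) \<bullet>\<^bsub>D\<^esub> RhoI (Src (Hor D) \<alpha>)"
proof -
  have "RhoI s \<bullet>\<^bsub>D\<^esub> \<alpha> = RhoI s \<bullet>\<^bsub>D\<^esub> ((\<alpha> \<bullet>\<^bsub>D\<^esub> Rho D (Src (Hor D) \<alpha>)) \<bullet>\<^bsub>D\<^esub> RhoI (Src (Hor D) \<alpha>))"
    by (simp add: assms(1) assms(2)[symmetric] cassoc)
  also have "\<dots> = RhoI s \<bullet>\<^bsub>D\<^esub> ((Rho D s \<bullet>\<^bsub>D\<^esub> (\<alpha> \<odot>\<^bsub>D\<^esub> cunit D (cdom D \<alpha>))) \<bullet>\<^bsub>D\<^esub> RhoI (Src (Hor D) \<alpha>))"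
    using assms by (simp add: Rho_nat)
  also have "\<dots> = (RhoI s \<bullet>\<^bsub>D\<^esub> Rho D s) \<bullet>\<^bsub>D\<^esub> ((\<alpha> \<odot>\<^bsub>D\<^esub> cunit D (cdom D \<alpha>)) \<bullet>\<^bsub>D\<^esub> RhoI (Src (Hor D) \<alpha>))"
    by (simp add: assms(1) assms(2)[symmetric] cassoc del: RhoI_facts(8))
  finally show ?thesis by (simp add: assms(1) assms(2)[symmetric])
qed

lemma AlpI_nat:
  assumes "\<alpha> \<in> Arr (Hor D)" "\<beta> \<in> Arr (Hor D)" "\<gamma> \<in> Arr (Hor D)" "cdom D \<beta> = ccod D \<alpha>" "cdom D \<gamma> = ccod D \<beta>"
    "Tgt (Hor D) \<alpha> = r'" "Tgt (Hor D) \<beta> = s'" "Tgt (Hor D) \<gamma> = t'"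
  shows "AlpI t' s' r' \<bullet>\<^bsub>D\<^esub> (\<gamma> \<odot>\<^bsub>D\<^esub> (\<beta> \<odot>\<^bsub>D\<^esub> \<alpha>))
    = ((\<gamma> \<odot>\<^bsub>D\<^esub> \<beta>) \<odot>\<^bsub>D\<^esub> \<alpha>) \<bullet>\<^bsub>D\<^esub> AlpI (Src (Hor D) \<gamma>) (Src (Hor D) \<beta>) (Src (Hor D) \<alpha>)"
proof -
  let ?A = "Alp D (Src (Hor D) \<gamma>) (Src (Hor D) \<beta>) (Src (Hor D) \<alpha>)"
  let ?B = "AlpI (Src (Hor D) \<gamma>) (Src (Hor D) \<beta>) (Src (Hor D) \<alpha>)"
  have o: "hdom D (Src (Hor D) \<beta>) = hcod D (Src (Hor D) \<alpha>)" "hdom D (Src (Hor D) \<gamma>) = hcod D (Src (Hor D) \<beta>)"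
    "hdom D (Tgt (Hor D) \<beta>) = hcod D (Tgt (Hor D) \<alpha>)" "hdom D (Tgt (Hor D) \<gamma>) = hcod D (Tgt (Hor D) \<beta>)"
    using assms functor_simps(8-11) by metis+
  have "AlpI t' s' r' \<bullet>\<^bsub>D\<^esub> (\<gamma> \<odot>\<^bsub>D\<^esub> (\<beta> \<odot>\<^bsub>D\<^esub> \<alpha>)) = AlpI t' s' r' \<bullet>\<^bsub>D\<^esub> (((\<gamma> \<odot>\<^bsub>D\<^esub> (\<beta> \<odot>\<^bsub>D\<^esub> \<alpha>)) \<bullet>\<^bsub>D\<^esub> ?A) \<bullet>\<^bsub>D\<^esub> ?B)"
    using assms(1-5) o by (simp add: cassoc assms(6-8)[symmetric])
  also have "\<dots> = AlpI t' s' r' \<bullet>\<^bsub>D\<^esub> ((Alp D t' s' r' \<bullet>\<^bsub>D\<^esub> ((\<gamma> \<odot>\<^bsub>D\<^esub> \<beta>) \<odot>\<^bsub>D\<^esub> \<alpha>)) \<bullet>\<^bsub>D\<^esub> ?B)"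
    using assms by (simp add: Alp_nat)
  also have "\<dots> = (AlpI t' s' r' \<bullet>\<^bsub>D\<^esub> Alp D t' s' r') \<bullet>\<^bsub>D\<^esub> (((\<gamma> \<odot>\<^bsub>D\<^esub> \<beta>) \<odot>\<^bsub>D\<^esub> \<alpha>) \<bullet>\<^bsub>D\<^esub> ?B)"
    using assms(1-5) o by (simp add: cassoc assms(6-8)[symmetric] del: AlpI_facts(8))
  finally show ?thesis using assms(1-5) o by (simp add: assms(6-8)[symmetric])
qed

text \<open>Naturality of \<lambda> makes whiskering with a unit conjugation by \<lambda>, which can
  be cancelled. Coherence equations may therefore be proved after such a whiskering.\<close>

lemma unit_whisker_faithful:
  assumes "\<alpha> \<in> Arr (Hor D)" "\<beta> \<in> Arr (Hor D)" "Src (Hor D) \<alpha> = Src (Hor D) \<beta>" "Tgt (Hor D) \<alpha> = Tgt (Hor D) \<beta>"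
    "ccod D \<alpha> = ccod D \<beta>" "cunit D (ccod D \<alpha>) \<odot>\<^bsub>D\<^esub> \<alpha> = cunit D (ccod D \<beta>) \<odot>\<^bsub>D\<^esub> \<beta>"
  shows "\<alpha> = \<beta>"
proof -
  have "\<alpha> \<bullet>\<^bsub>D\<^esub> Lam D (Src (Hor D) \<alpha>) = \<beta> \<bullet>\<^bsub>D\<^esub> Lam D (Src (Hor D) \<alpha>)"
    using assms Lam_nat[of \<alpha> "Tgt (Hor D) \<alpha>" "ccod D \<alpha>"] Lam_nat[of \<beta> "Tgt (Hor D) \<alpha>" "ccod D \<alpha>"] by simp
  then show ?thesis
    using assms by - (rule hor.Cmp_right_cancel[of "Lam D (Src (Hor D) \<alpha>)"], simp_all)
qed

lemma whisker_unit_faithful: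
  assumes "\<alpha> \<in> Arr (Hor D)" "\<beta> \<in> Arr (Hor D)" "Src (Hor D) \<alpha> = Src (Hor D) \<beta>" "Tgt (Hor D) \<alpha> = Tgt (Hor D) \<beta>"
    "cdom D \<alpha> = cdom D \<beta>" "\<alpha> \<odot>\<^bsub>D\<^esub> cunit D (cdom D \<alpha>) = \<beta> \<odot>\<^bsub>D\<^esub> cunit D (cdom D \<beta>)"
  shows "\<alpha> = \<beta>"
proof -
  have "\<alpha> \<bullet>\<^bsub>D\<^esub> Rho D (Src (Hor D) \<alpha>) = \<beta> \<bullet>\<^bsub>D\<^esub> Rho D (Src (Hor D) \<alpha>)"
    using assms Rho_nat[of \<alpha> "Tgt (Hor D) \<alpha>" "cdom D \<alpha>"] Rho_nat[of \<beta> "Tgt (Hor D) \<alpha>" "cdom D \<alpha>"] by simp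
  then show ?thesis
    using assms by - (rule hor.Cmp_right_cancel[of "Rho D (Src (Hor D) \<alpha>)"], simp_all)
qed

end

section \<open>Invertible horizontal composites and coherence of the unitors\<close>

context pseudodouble_category begin

text \<open>The inverses are horizontally composable because their facing boundaries,
  \<open>ccod D ?a\<close> and \<open>cdom D ?b\<close>, are both inverse to the common vertical
  1-cell between \<alpha> and \<beta>; interchange does the rest.\<close>

lemma is_iso_ccmp:
  assumes "is_iso (Hor D) \<alpha>" "is_iso (Hor D) \<beta>" "cdom D \<beta> = ccod D \<alpha>"
  shows "is_iso (Hor D) (\<beta> \<odot>\<^bsub>D\<^esub> \<alpha>)"
proof -
  let ?a = "inverse_in (Hor D) \<alpha>" and ?b = "inverse_in (Hor D) \<beta>"
  note a = inverse_in_facts[OF assms(1)] hor.is_iso_Arr[OF assms(1)]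
  note b = inverse_in_facts[OF assms(2)] hor.is_iso_Arr[OF assms(2)]
  have o: "hdom D (Src (Hor D) \<beta>) = hcod D (Src (Hor D) \<alpha>)" "hdom D (Tgt (Hor D) \<beta>) = hcod D (Tgt (Hor D) \<alpha>)"
    using assms(3) a(7) b(7) functor_simps(8-11) by metis+
  have l: "ccod D ?a \<circ>\<^bsub>D\<^esub> ccod D \<alpha> = vid D (hcod D (Src (Hor D) \<alpha>))"
      "cdom D ?b \<circ>\<^bsub>D\<^esub> cdom D \<beta> = vid D (hdom D (Src (Hor D) \<beta>))"
      "cdom D \<beta> \<circ>\<^bsub>D\<^esub> cdom D ?b = vid D (hdom D (Tgt (Hor D) \<beta>))"
    using a b functor_simps(21)[OF a(7) a(1,2)] functor_simps(20)[OF b(7) b(1,2)]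
      functor_simps(20)[OF b(1) b(7) b(3)[symmetric]] by simp_all
  have "ccod D ?a = ccod D ?a \<circ>\<^bsub>D\<^esub> (cdom D \<beta> \<circ>\<^bsub>D\<^esub> cdom D ?b)"
    using a b o l(3) by simp
  also have "\<dots> = (ccod D ?a \<circ>\<^bsub>D\<^esub> ccod D \<alpha>) \<circ>\<^bsub>D\<^esub> cdom D ?b"
    using a b o assms(3) ver.Cmp_assoc[of "cdom D ?b" "ccod D \<alpha>" "ccod D ?a"] by simp
  also have "\<dots> = cdom D ?b"
    using a b o l by simp
  finally have c: "cdom D ?b = ccod D ?a" ..
  have "inverse_arrows (Hor D) (\<beta> \<odot>\<^bsub>D\<^esub> \<alpha>) (?b \<odot>\<^bsub>D\<^esub> ?a)"
    unfolding inverse_arrows_def using a b c o assms(3) by (simp add: ccmp_merge)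
  then show ?thesis unfolding is_iso_def by blast
qed

lemma is_iso_cid [simp]: "r \<in> Obj (Hor D) \<Longrightarrow> is_iso (Hor D) (cid D r)"
  unfolding is_iso_def inverse_arrows_def by (intro exI[of _ "cid D r"]) simp

text \<open>Kelly's derivation of unit coherence at a composite: whiskered with a unit on the left,
  the equation becomes one face of a pentagon whose other faces are triangles and naturality squares
  of the associator.\<close>

lemma Lam_hcmp:
  assumes "r \<in> Obj (Hor D)" "s \<in> Obj (Hor D)" "hdom D s = hcod D r"
  shows "Lam D (s \<cdot>\<^bsub>D\<^esub> r) \<bullet>\<^bsub>D\<^esub> Alp D (hunit D (hcod D s)) s r = Lam D s \<odot>\<^bsub>D\<^esub> cid D r"
proof -
  let ?u = "hunit D (hcod D s)"
  \<comment> \<open>The associators appended on the right complete the left factor to the longer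
    side of the pentagon for \<open>?u\<close>, \<open>?u\<close>, \<open>s\<close>,
    \<open>r\<close>; being invertible, they are cancelled at the end.\<close>
  have "(cid D ?u \<odot>\<^bsub>D\<^esub> (Lam D (s \<cdot>\<^bsub>D\<^esub> r) \<bullet>\<^bsub>D\<^esub> Alp D ?u s r)) \<bullet>\<^bsub>D\<^esub> (Alp D ?u (?u \<cdot>\<^bsub>D\<^esub> s) r \<bullet>\<^bsub>D\<^esub> (Alp D ?u ?u s \<odot>\<^bsub>D\<^esub> cid D r))
      = (cid D ?u \<odot>\<^bsub>D\<^esub> Lam D (s \<cdot>\<^bsub>D\<^esub> r)) \<bullet>\<^bsub>D\<^esub>
        ((cid D ?u \<odot>\<^bsub>D\<^esub> Alp D ?u s r) \<bullet>\<^bsub>D\<^esub> (Alp D ?u (?u \<cdot>\<^bsub>D\<^esub> s) r \<bullet>\<^bsub>D\<^esub> (Alp D ?u ?u s \<odot>\<^bsub>D\<^esub> cid D r)))"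
    using assms by (simp add: ccmp_merge_extend)
  also have "\<dots> = ((cid D ?u \<odot>\<^bsub>D\<^esub> Lam D (s \<cdot>\<^bsub>D\<^esub> r)) \<bullet>\<^bsub>D\<^esub> Alp D ?u ?u (s \<cdot>\<^bsub>D\<^esub> r)) \<bullet>\<^bsub>D\<^esub> Alp D (?u \<cdot>\<^bsub>D\<^esub> ?u) s r"
    using assms pentagon[of r s ?u ?u] by (simp add: cassoc)
  also have "\<dots> = (Rho D ?u \<odot>\<^bsub>D\<^esub> (cid D s \<odot>\<^bsub>D\<^esub> cid D r)) \<bullet>\<^bsub>D\<^esub> Alp D (?u \<cdot>\<^bsub>D\<^esub> ?u) s r"
    using assms triangle[of "s \<cdot>\<^bsub>D\<^esub> r" ?u] by simp
  also have "\<dots> = Alp D ?u s r \<bullet>\<^bsub>D\<^esub> ((Rho D ?u \<odot>\<^bsub>D\<^esub> cid D s) \<odot>\<^bsub>D\<^esub> cid D r)"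
    using assms Alp_nat[of "cid D r" "cid D s" "Rho D ?u" r s ?u] by (simp del: ccmp_cid)
  also have "\<dots> = Alp D ?u s r \<bullet>\<^bsub>D\<^esub> (((cid D ?u \<odot>\<^bsub>D\<^esub> Lam D s) \<bullet>\<^bsub>D\<^esub> Alp D ?u ?u s) \<odot>\<^bsub>D\<^esub> cid D r)"
    using assms triangle[of s ?u] by simp
  also have "\<dots> = (Alp D ?u s r \<bullet>\<^bsub>D\<^esub> ((cid D ?u \<odot>\<^bsub>D\<^esub> Lam D s) \<odot>\<^bsub>D\<^esub> cid D r)) \<bullet>\<^bsub>D\<^esub> (Alp D ?u ?u s \<odot>\<^bsub>D\<^esub> cid D r)"
    using assms by (simp add: ccmp_merge cassoc)
  also have "\<dots> = (cid D ?u \<odot>\<^bsub>D\<^esub> (Lam D s \<odot>\<^bsub>D\<^esub> cid D r)) \<bullet>\<^bsub>D\<^esub> (Alp D ?u (?u \<cdot>\<^bsub>D\<^esub> s) r \<bullet>\<^bsub>D\<^esub> (Alp D ?u ?u s \<odot>\<^bsub>D\<^esub> cid D r))"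
    using assms Alp_nat[of "cid D r" "Lam D s" "cid D ?u" r s ?u] by (simp add: cassoc)
  finally have "cid D ?u \<odot>\<^bsub>D\<^esub> (Lam D (s \<cdot>\<^bsub>D\<^esub> r) \<bullet>\<^bsub>D\<^esub> Alp D ?u s r) = cid D ?u \<odot>\<^bsub>D\<^esub> (Lam D s \<odot>\<^bsub>D\<^esub> cid D r)"
    using assms
    by - (rule hor.Cmp_right_cancel[of "Alp D ?u (?u \<cdot>\<^bsub>D\<^esub> s) r \<bullet>\<^bsub>D\<^esub> (Alp D ?u ?u s \<odot>\<^bsub>D\<^esub> cid D r)"],
      simp_all add: hor.is_iso_Cmp is_iso_ccmp)
  then show ?thesis
    using assms by - (rule unit_whisker_faithful, simp_all)
qed

text \<open>Mirror image of \<open>Lam_hcmp\<close>: whiskering on the right, and the pentagon for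
  \<open>s\<close>, \<open>r\<close> and two units.\<close>

lemma Rho_hcmp:
  assumes "r \<in> Obj (Hor D)" "s \<in> Obj (Hor D)" "hdom D s = hcod D r"
  shows "(cid D s \<odot>\<^bsub>D\<^esub> Rho D r) \<bullet>\<^bsub>D\<^esub> Alp D s r (hunit D (hdom D r)) = Rho D (s \<cdot>\<^bsub>D\<^esub> r)"
proof -
  let ?u = "hunit D (hdom D r)"
  have "Alp D s r ?u \<bullet>\<^bsub>D\<^esub> (Rho D (s \<cdot>\<^bsub>D\<^esub> r) \<odot>\<^bsub>D\<^esub> cid D ?u)
      = (Alp D s r ?u \<bullet>\<^bsub>D\<^esub> ((cid D s \<odot>\<^bsub>D\<^esub> cid D r) \<odot>\<^bsub>D\<^esub> Lam D ?u)) \<bullet>\<^bsub>D\<^esub> Alp D (s \<cdot>\<^bsub>D\<^esub> r) ?u ?u"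
    using assms triangle[of ?u "s \<cdot>\<^bsub>D\<^esub> r"] by (simp add: cassoc)
  also have "\<dots> = (cid D s \<odot>\<^bsub>D\<^esub> (cid D r \<odot>\<^bsub>D\<^esub> Lam D ?u)) \<bullet>\<^bsub>D\<^esub> (Alp D s r (?u \<cdot>\<^bsub>D\<^esub> ?u) \<bullet>\<^bsub>D\<^esub> Alp D (s \<cdot>\<^bsub>D\<^esub> r) ?u ?u)"
    using assms Alp_nat[of "Lam D ?u" "cid D r" "cid D s" ?u r s] by (simp add: cassoc del: ccmp_cid)
  also have "\<dots> = (cid D s \<odot>\<^bsub>D\<^esub> (cid D r \<odot>\<^bsub>D\<^esub> Lam D ?u)) \<bullet>\<^bsub>D\<^esub>
      ((cid D s \<odot>\<^bsub>D\<^esub> Alp D r ?u ?u) \<bullet>\<^bsub>D\<^esub> (Alp D s (r \<cdot>\<^bsub>D\<^esub> ?u) ?u \<bullet>\<^bsub>D\<^esub> (Alp D s r ?u \<odot>\<^bsub>D\<^esub> cid D ?u)))"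
    using assms pentagon[of ?u ?u r s] by simp
  also have "\<dots> = (cid D s \<odot>\<^bsub>D\<^esub> (Rho D r \<odot>\<^bsub>D\<^esub> cid D ?u)) \<bullet>\<^bsub>D\<^esub> (Alp D s (r \<cdot>\<^bsub>D\<^esub> ?u) ?u \<bullet>\<^bsub>D\<^esub> (Alp D s r ?u \<odot>\<^bsub>D\<^esub> cid D ?u))"
    using assms triangle[of ?u r] by (simp add: ccmp_merge_extend)
  also have "\<dots> = Alp D s r ?u \<bullet>\<^bsub>D\<^esub> (((cid D s \<odot>\<^bsub>D\<^esub> Rho D r) \<odot>\<^bsub>D\<^esub> cid D ?u) \<bullet>\<^bsub>D\<^esub> (Alp D s r ?u \<odot>\<^bsub>D\<^esub> cid D ?u))"
    using assms Alp_nat[of "cid D ?u" "Rho D r" "cid D s" ?u r s] by (simp add: cassoc[symmetric])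
  also have "\<dots> = Alp D s r ?u \<bullet>\<^bsub>D\<^esub> (((cid D s \<odot>\<^bsub>D\<^esub> Rho D r) \<bullet>\<^bsub>D\<^esub> Alp D s r ?u) \<odot>\<^bsub>D\<^esub> cid D ?u)"
    using assms by (simp add: ccmp_merge)
  finally have "Rho D (s \<cdot>\<^bsub>D\<^esub> r) \<odot>\<^bsub>D\<^esub> cid D ?u = ((cid D s \<odot>\<^bsub>D\<^esub> Rho D r) \<bullet>\<^bsub>D\<^esub> Alp D s r ?u) \<odot>\<^bsub>D\<^esub> cid D ?u"
    using assms by - (rule hor.Cmp_left_cancel[of "Alp D s r ?u"], simp_all)
  then show ?thesis
    using assms by - (rule whisker_unit_faithful, simp_all)
qed

text \<open>Naturality of \<lambda> at the cell \<lambda> itself identifies id . \<lambda> with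
  \<lambda> at the composite of two units; \<open>Lam_hcmp\<close> and the triangle then compare
  \<lambda> . id with \<rho> . id.\<close>

lemma Lam_hunit:
  assumes "x \<in> Obj (Ver D)"
  shows "Lam D (hunit D x) = Rho D (hunit D x)"
proof -
  let ?u = "hunit D x"
  have "Lam D ?u \<bullet>\<^bsub>D\<^esub> (cid D ?u \<odot>\<^bsub>D\<^esub> Lam D ?u) = Lam D ?u \<bullet>\<^bsub>D\<^esub> Lam D (?u \<cdot>\<^bsub>D\<^esub> ?u)"
    using assms Lam_nat[of "Lam D ?u" ?u "vid D x"] by simp
  then have "cid D ?u \<odot>\<^bsub>D\<^esub> Lam D ?u = Lam D (?u \<cdot>\<^bsub>D\<^esub> ?u)"
    using assms by - (rule hor.Cmp_left_cancel[of "Lam D ?u"], simp_all)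
  then have "Lam D ?u \<odot>\<^bsub>D\<^esub> cid D ?u = Rho D ?u \<odot>\<^bsub>D\<^esub> cid D ?u"
    using assms Lam_hcmp[of ?u ?u] triangle[of ?u ?u] by simp
  then show ?thesis
    using assms by - (rule whisker_unit_faithful, simp_all)
qed

section \<open>Universal properties of conjoints and companions\<close>

lemma is_conjointD:
  assumes "is_conjoint D f k" "f \<in> Arr (Ver D)"
  shows "conj_hor k \<in> Obj (Hor D)" "hdom D (conj_hor k) = Tgt (Ver D) f" "hcod D (conj_hor k) = Src (Ver D) f"
    "conj_eta k \<in> Arr (Hor D)" "Src (Hor D) (conj_eta k) = hunit D (Src (Ver D) f)"
    "Tgt (Hor D) (conj_eta k) = conj_hor k" "cdom D (conj_eta k) = f" "ccod D (conj_eta k) = vid D (Src (Ver D) f)"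
    "conj_eps k \<in> Arr (Hor D)" "Src (Hor D) (conj_eps k) = conj_hor k"
    "Tgt (Hor D) (conj_eps k) = hunit D (Tgt (Ver D) f)"
    "cdom D (conj_eps k) = vid D (Tgt (Ver D) f)" "ccod D (conj_eps k) = f"
    "conj_eps k \<bullet>\<^bsub>D\<^esub> conj_eta k = cunit D f"
    "conj_eta k \<odot>\<^bsub>D\<^esub> conj_eps k = RhoI (conj_hor k) \<bullet>\<^bsub>D\<^esub> Lam D (conj_hor k)"
  using assms unfolding is_conjoint_def cell_def by (simp_all add: Let_def)

lemma is_companionD:
  assumes "is_companion D f k" "f \<in> Arr (Ver D)"
  shows "comp_hor k \<in> Obj (Hor D)" "hdom D (comp_hor k) = Src (Ver D) f" "hcod D (comp_hor k) = Tgt (Ver D) f"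
    "comp_nu k \<in> Arr (Hor D)" "Src (Hor D) (comp_nu k) = hunit D (Src (Ver D) f)"
    "Tgt (Hor D) (comp_nu k) = comp_hor k" "cdom D (comp_nu k) = vid D (Src (Ver D) f)" "ccod D (comp_nu k) = f"
    "comp_delta k \<in> Arr (Hor D)" "Src (Hor D) (comp_delta k) = comp_hor k"
    "Tgt (Hor D) (comp_delta k) = hunit D (Tgt (Ver D) f)"
    "cdom D (comp_delta k) = f" "ccod D (comp_delta k) = vid D (Tgt (Ver D) f)"
    "comp_delta k \<bullet>\<^bsub>D\<^esub> comp_nu k = cunit D f"
    "comp_delta k \<odot>\<^bsub>D\<^esub> comp_nu k = LamI (comp_hor k) \<bullet>\<^bsub>D\<^esub> Rho D (comp_hor k)"
  using assms unfolding is_companion_def cell_def by (simp_all add: Let_def)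

text \<open>The second conjoint equation with \<open>t\<close> carried along: an associator brings
  \<open>conj_eta\<close> next to \<open>conj_eps\<close>, and the triangle supplies the \<rho> that
  cancels the inverse one. It gives uniqueness in \<open>conjoint_whisker_lift\<close>.\<close>

lemma conjoint_zigzag:
  assumes "is_conjoint D f k" "f \<in> Arr (Ver D)" "t \<in> Obj (Hor D)" "hcod D t = Tgt (Ver D) f"
  shows "(conj_eta k \<odot>\<^bsub>D\<^esub> (Lam D t \<bullet>\<^bsub>D\<^esub> (conj_eps k \<odot>\<^bsub>D\<^esub> cid D t))) = Lam D (conj_hor k \<cdot>\<^bsub>D\<^esub> t)"
proof -
  note k = is_conjointD[OF assms(1,2)] assms(2-)
  let ?p = "conj_hor k" and ?a = "hunit D (Src (Ver D) f)" and ?b = "hunit D (Tgt (Ver D) f)"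
  have "conj_eta k \<odot>\<^bsub>D\<^esub> (Lam D t \<bullet>\<^bsub>D\<^esub> (conj_eps k \<odot>\<^bsub>D\<^esub> cid D t))
      = (cid D ?p \<odot>\<^bsub>D\<^esub> Lam D t) \<bullet>\<^bsub>D\<^esub> (conj_eta k \<odot>\<^bsub>D\<^esub> (conj_eps k \<odot>\<^bsub>D\<^esub> cid D t))"
    by (simp add: k ccmp_merge)
  also have "\<dots> = (cid D ?p \<odot>\<^bsub>D\<^esub> Lam D t) \<bullet>\<^bsub>D\<^esub> ((conj_eta k \<odot>\<^bsub>D\<^esub> (conj_eps k \<odot>\<^bsub>D\<^esub> cid D t)) \<bullet>\<^bsub>D\<^esub> (Alp D ?a ?p t \<bullet>\<^bsub>D\<^esub> AlpI ?a ?p t))"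
    by (simp add: k)
  also have "\<dots> = (cid D ?p \<odot>\<^bsub>D\<^esub> Lam D t) \<bullet>\<^bsub>D\<^esub> ((Alp D ?p ?b t \<bullet>\<^bsub>D\<^esub> ((conj_eta k \<odot>\<^bsub>D\<^esub> conj_eps k) \<odot>\<^bsub>D\<^esub> cid D t)) \<bullet>\<^bsub>D\<^esub> AlpI ?a ?p t)"
    using Alp_nat[of "cid D t" "conj_eps k" "conj_eta k" t ?b ?p] by (simp add: k cassoc del: AlpI_facts(7))
  also have "\<dots> = ((cid D ?p \<odot>\<^bsub>D\<^esub> Lam D t) \<bullet>\<^bsub>D\<^esub> Alp D ?p ?b t) \<bullet>\<^bsub>D\<^esub> (((RhoI ?p \<bullet>\<^bsub>D\<^esub> Lam D ?p) \<odot>\<^bsub>D\<^esub> cid D t) \<bullet>\<^bsub>D\<^esub> AlpI ?a ?p t)"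
    by (simp add: k cassoc)
  also have "\<dots> = ((Rho D ?p \<bullet>\<^bsub>D\<^esub> (RhoI ?p \<bullet>\<^bsub>D\<^esub> Lam D ?p)) \<odot>\<^bsub>D\<^esub> cid D t) \<bullet>\<^bsub>D\<^esub> AlpI ?a ?p t"
    using triangle[of t ?p] by (simp add: k ccmp_merge_extend)
  also have "\<dots> = (Lam D ?p \<odot>\<^bsub>D\<^esub> cid D t) \<bullet>\<^bsub>D\<^esub> AlpI ?a ?p t"
    by (simp add: k cassoc[symmetric])
  also have "\<dots> = Lam D (?p \<cdot>\<^bsub>D\<^esub> t) \<bullet>\<^bsub>D\<^esub> (Alp D ?a ?p t \<bullet>\<^bsub>D\<^esub> AlpI ?a ?p t)"
    using Lam_hcmp[of t ?p] by (simp add: k cassoc[symmetric] del: AlpI_facts(7))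
  finally show ?thesis by (simp add: k)
qed

text \<open>Counterpart of \<open>conjoint_zigzag\<close>: the second companion equation leaves an
  inverse \<lambda>, which the \<lambda> coming from the triangle cancels.\<close>

lemma companion_zigzag:
  assumes "is_companion D f k" "f \<in> Arr (Ver D)" "t \<in> Obj (Hor D)" "hdom D t = Tgt (Ver D) f"
  shows "((Rho D t \<bullet>\<^bsub>D\<^esub> (cid D t \<odot>\<^bsub>D\<^esub> comp_delta k)) \<odot>\<^bsub>D\<^esub> comp_nu k) = Rho D (t \<cdot>\<^bsub>D\<^esub> comp_hor k)"
proof -
  note k = is_companionD[OF assms(1,2)] assms(2-)
  let ?p = "comp_hor k" and ?a = "hunit D (Src (Ver D) f)" and ?b = "hunit D (Tgt (Ver D) f)"
  have "(Rho D t \<bullet>\<^bsub>D\<^esub> (cid D t \<odot>\<^bsub>D\<^esub> comp_delta k)) \<odot>\<^bsub>D\<^esub> comp_nu k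
      = (Rho D t \<odot>\<^bsub>D\<^esub> cid D ?p) \<bullet>\<^bsub>D\<^esub> ((cid D t \<odot>\<^bsub>D\<^esub> comp_delta k) \<odot>\<^bsub>D\<^esub> comp_nu k)"
    by (simp add: k ccmp_merge)
  also have "\<dots> = (cid D t \<odot>\<^bsub>D\<^esub> Lam D ?p) \<bullet>\<^bsub>D\<^esub> (Alp D t ?b ?p \<bullet>\<^bsub>D\<^esub> ((cid D t \<odot>\<^bsub>D\<^esub> comp_delta k) \<odot>\<^bsub>D\<^esub> comp_nu k))"
    using triangle[of ?p t, symmetric] by (simp add: k cassoc)
  also have "\<dots> = (cid D t \<odot>\<^bsub>D\<^esub> Lam D ?p) \<bullet>\<^bsub>D\<^esub> ((cid D t \<odot>\<^bsub>D\<^esub> (comp_delta k \<odot>\<^bsub>D\<^esub> comp_nu k)) \<bullet>\<^bsub>D\<^esub> Alp D t ?p ?a)"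
    using Alp_nat[of "comp_nu k" "comp_delta k" "cid D t" ?p ?b t] by (simp add: k)
  also have "\<dots> = (cid D t \<odot>\<^bsub>D\<^esub> (Lam D ?p \<bullet>\<^bsub>D\<^esub> (LamI ?p \<bullet>\<^bsub>D\<^esub> Rho D ?p))) \<bullet>\<^bsub>D\<^esub> Alp D t ?p ?a"
    by (simp add: k ccmp_merge_extend)
  also have "\<dots> = (cid D t \<odot>\<^bsub>D\<^esub> Rho D ?p) \<bullet>\<^bsub>D\<^esub> Alp D t ?p ?a"
    by (simp add: k cassoc[symmetric])
  also have "\<dots> = Rho D (t \<cdot>\<^bsub>D\<^esub> ?p)"
    using Rho_hcmp[of ?p t] by (simp add: k)
  finally show ?thesis .
qed

text \<open>The cell \<lambda> o (\<epsilon> . id) exhibits \<open>f\<^sup>*\<close> . t as the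
  restriction of \<open>t\<close> along \<open>f\<close> on the codomain side. The lift of \<xi> is
  its tensor with \<eta> o \<open>1\<^sub>h\<close>, preceded by an inverse \<lambda>. With
  \<open>h\<close> an identity this is the universal property behind \<open>n_conj\<close>.\<close>

lemma conjoint_whisker_lift:
  assumes "is_conjoint D f k" "f \<in> Arr (Ver D)" "h \<in> Arr (Ver D)" "Tgt (Ver D) h = Src (Ver D) f"
    and "cell D s t g (f \<circ>\<^bsub>D\<^esub> h) \<xi>" "Src (Ver D) h = hcod D s"
  shows "\<exists>!c. cell D s (conj_hor k \<cdot>\<^bsub>D\<^esub> t) g h c \<and> Lam D t \<bullet>\<^bsub>D\<^esub> ((conj_eps k \<odot>\<^bsub>D\<^esub> cid D t) \<bullet>\<^bsub>D\<^esub> c) = \<xi>"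
proof -
  have t: "hcod D t = Tgt (Ver D) f"
    using cellD(13)[OF assms(5)] assms by simp
  note k = is_conjointD[OF assms(1,2)] assms(2-4,6) cellD(1-8,10-11)[OF assms(5)] t
  let ?c = "((conj_eta k \<bullet>\<^bsub>D\<^esub> cunit D h) \<odot>\<^bsub>D\<^esub> \<xi>) \<bullet>\<^bsub>D\<^esub> LamI s"
  have "Lam D t \<bullet>\<^bsub>D\<^esub> ((conj_eps k \<odot>\<^bsub>D\<^esub> cid D t) \<bullet>\<^bsub>D\<^esub> ?c)
      = Lam D t \<bullet>\<^bsub>D\<^esub> (((conj_eps k \<bullet>\<^bsub>D\<^esub> (conj_eta k \<bullet>\<^bsub>D\<^esub> cunit D h)) \<odot>\<^bsub>D\<^esub> \<xi>) \<bullet>\<^bsub>D\<^esub> LamI s)"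
    by (simp add: k ccmp_merge_extend)
  also have "\<dots> = Lam D t \<bullet>\<^bsub>D\<^esub> (LamI t \<bullet>\<^bsub>D\<^esub> \<xi>)"
    using LamI_nat[of \<xi> t] by (simp add: k cassoc[symmetric])
  also have "\<dots> = \<xi>"
    by (simp add: k cassoc[symmetric])
  finally have c: "Lam D t \<bullet>\<^bsub>D\<^esub> ((conj_eps k \<odot>\<^bsub>D\<^esub> cid D t) \<bullet>\<^bsub>D\<^esub> ?c) = \<xi>" .
  moreover have "cell D s (conj_hor k \<cdot>\<^bsub>D\<^esub> t) g h ?c"
    unfolding cell_def by (simp add: k)
  moreover have "c = ?c" if c: "cell D s (conj_hor k \<cdot>\<^bsub>D\<^esub> t) g h c"
      "Lam D t \<bullet>\<^bsub>D\<^esub> ((conj_eps k \<odot>\<^bsub>D\<^esub> cid D t) \<bullet>\<^bsub>D\<^esub> c) = \<xi>" for c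
  proof -
    note cf = cellD(1-5)[OF c(1)]
    have "?c = ((conj_eta k \<odot>\<^bsub>D\<^esub> (Lam D t \<bullet>\<^bsub>D\<^esub> (conj_eps k \<odot>\<^bsub>D\<^esub> cid D t))) \<bullet>\<^bsub>D\<^esub> (cunit D h \<odot>\<^bsub>D\<^esub> c)) \<bullet>\<^bsub>D\<^esub> LamI s"
      by (simp add: k cf c(2)[symmetric] ccmp_merge cassoc)
    also have "\<dots> = Lam D (conj_hor k \<cdot>\<^bsub>D\<^esub> t) \<bullet>\<^bsub>D\<^esub> (LamI (conj_hor k \<cdot>\<^bsub>D\<^esub> t) \<bullet>\<^bsub>D\<^esub> c)"
      using LamI_nat[of c "conj_hor k \<cdot>\<^bsub>D\<^esub> t"] conjoint_zigzag[OF assms(1,2) _ t] by (simp add: k cf cassoc)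
    finally show ?thesis by (simp add: k cf cassoc[symmetric])
  qed
  ultimately show ?thesis by blast
qed

text \<open>The case of \<open>t\<close> a unit in \<open>conjoint_whisker_lift\<close>, transported
  along \<rho> from \<open>f\<^sup>*\<close> . 1 to \<open>f\<^sup>*\<close>. The two unitors at the
  unit agree by \<open>Lam_hunit\<close>.\<close>

lemma conjoint_lift:
  assumes "is_conjoint D f k" "f \<in> Arr (Ver D)" "h \<in> Arr (Ver D)" "Tgt (Ver D) h = Src (Ver D) f"
    and "cell D s (hunit D (Tgt (Ver D) f)) g (f \<circ>\<^bsub>D\<^esub> h) \<xi>" "Src (Ver D) h = hcod D s"
  shows "\<exists>!c. cell D s (conj_hor k) g h c \<and> conj_eps k \<bullet>\<^bsub>D\<^esub> c = \<xi>"
proof -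
  note k = is_conjointD[OF assms(1,2)] assms(2-4,6) cellD(1-11)[OF assms(5)]
  let ?p = "conj_hor k" and ?b = "hunit D (Tgt (Ver D) f)"
  let ?Q = "\<lambda>c. cell D s (?p \<cdot>\<^bsub>D\<^esub> ?b) g h c \<and> Lam D ?b \<bullet>\<^bsub>D\<^esub> ((conj_eps k \<odot>\<^bsub>D\<^esub> cid D ?b) \<bullet>\<^bsub>D\<^esub> c) = \<xi>"
  have ex1: "\<exists>!c. ?Q c" by (rule conjoint_whisker_lift[OF assms])
  have eps: "Lam D ?b \<bullet>\<^bsub>D\<^esub> ((conj_eps k \<odot>\<^bsub>D\<^esub> cid D ?b) \<bullet>\<^bsub>D\<^esub> c) = conj_eps k \<bullet>\<^bsub>D\<^esub> (Rho D ?p \<bullet>\<^bsub>D\<^esub> c)"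
    if "cell D s (?p \<cdot>\<^bsub>D\<^esub> ?b) g h c" for c
    using Rho_nat[of "conj_eps k" ?b "vid D (Tgt (Ver D) f)"] cellD(1-5)[OF that]
    by (simp add: k cassoc[symmetric] Lam_hunit)
  obtain c where c: "?Q c" using ex1 by blast
  have "cell D s ?p g h (Rho D ?p \<bullet>\<^bsub>D\<^esub> c)"
    using cellD(1-5)[OF conjunct1[OF c]] unfolding cell_def by (simp add: k)
  moreover have "conj_eps k \<bullet>\<^bsub>D\<^esub> (Rho D ?p \<bullet>\<^bsub>D\<^esub> c) = \<xi>"
    using eps[OF conjunct1[OF c]] c by simp
  moreover have "d = Rho D ?p \<bullet>\<^bsub>D\<^esub> c" if d: "cell D s ?p g h d" "conj_eps k \<bullet>\<^bsub>D\<^esub> d = \<xi>" for d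
  proof -
    note df = cellD(1-5)[OF d(1)]
    have e: "Rho D ?p \<bullet>\<^bsub>D\<^esub> (RhoI ?p \<bullet>\<^bsub>D\<^esub> d) = d"
      by (simp add: k df cassoc[symmetric])
    have c2: "cell D s (?p \<cdot>\<^bsub>D\<^esub> ?b) g h (RhoI ?p \<bullet>\<^bsub>D\<^esub> d)"
      unfolding cell_def by (simp add: k df)
    then have "?Q (RhoI ?p \<bullet>\<^bsub>D\<^esub> d)"
      using eps[OF c2] e d(2) by simp
    then have "RhoI ?p \<bullet>\<^bsub>D\<^esub> d = c" using c ex1 by blast
    then show ?thesis using e by simp
  qed
  ultimately show ?thesis by blast
qed

text \<open>The dual property: \<eta> exhibits \<open>f\<^sup>*\<close> as an extension of a unit,
  so cells out of \<open>f\<^sup>*\<close> are determined by their composite with \<eta>. The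
  comparison \<open>sigma_conj\<close> arises from it.\<close>

lemma conjoint_extend:
  assumes "is_conjoint D f k" "f \<in> Arr (Ver D)" "g \<in> Arr (Ver D)" "Src (Ver D) g = Tgt (Ver D) f"
    and "cell D (hunit D (Src (Ver D) f)) s (g \<circ>\<^bsub>D\<^esub> f) h \<xi>" "Tgt (Ver D) g = hdom D s"
  shows "\<exists>!c. cell D (conj_hor k) s g h c \<and> c \<bullet>\<^bsub>D\<^esub> conj_eta k = \<xi>"
proof -
  note k = is_conjointD[OF assms(1,2)] assms(2-4,6) cellD(1-11)[OF assms(5)] cellD(12,13)[OF assms(5)]
  let ?p = "conj_hor k" and ?a = "hunit D (Src (Ver D) f)"
  let ?c = "Rho D s \<bullet>\<^bsub>D\<^esub> ((\<xi> \<odot>\<^bsub>D\<^esub> (cunit D g \<bullet>\<^bsub>D\<^esub> conj_eps k)) \<bullet>\<^bsub>D\<^esub> LamI ?p)"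
  have "?c \<bullet>\<^bsub>D\<^esub> conj_eta k = Rho D s \<bullet>\<^bsub>D\<^esub> ((\<xi> \<odot>\<^bsub>D\<^esub> (cunit D g \<bullet>\<^bsub>D\<^esub> conj_eps k)) \<bullet>\<^bsub>D\<^esub> ((cid D ?a \<odot>\<^bsub>D\<^esub> conj_eta k) \<bullet>\<^bsub>D\<^esub> LamI ?a))"
    using LamI_nat[of "conj_eta k" ?p] by (simp add: k cassoc)
  also have "\<dots> = (Rho D s \<bullet>\<^bsub>D\<^esub> (\<xi> \<odot>\<^bsub>D\<^esub> cunit D (g \<circ>\<^bsub>D\<^esub> f))) \<bullet>\<^bsub>D\<^esub> LamI ?a"
    by (simp add: k cassoc ccmp_merge_extend)
  also have "\<dots> = \<xi> \<bullet>\<^bsub>D\<^esub> (Lam D ?a \<bullet>\<^bsub>D\<^esub> LamI ?a)"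
    using Rho_nat[of \<xi> s "g \<circ>\<^bsub>D\<^esub> f"] by (simp add: k cassoc Lam_hunit del: LamI_facts(7) RhoI_facts(7))
  finally have "?c \<bullet>\<^bsub>D\<^esub> conj_eta k = \<xi>" by (simp add: k)
  moreover have "cell D ?p s g h ?c"
    unfolding cell_def by (simp add: k)
  moreover have "c = ?c" if c: "cell D ?p s g h c" "c \<bullet>\<^bsub>D\<^esub> conj_eta k = \<xi>" for c
  proof -
    note cf = cellD(1-5)[OF c(1)]
    \<comment> \<open>The second conjoint equation is withheld from this rewriting, so that the
      horizontal composite of \<open>conj_eta k\<close> and \<open>conj_eps k\<close> stays visible
      for the next step.\<close>
    have "?c = Rho D s \<bullet>\<^bsub>D\<^esub> (((c \<odot>\<^bsub>D\<^esub> cunit D g) \<bullet>\<^bsub>D\<^esub> (conj_eta k \<odot>\<^bsub>D\<^esub> conj_eps k)) \<bullet>\<^bsub>D\<^esub> LamI ?p)"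
      by (simp add: k(1-14) k(16-) cf c(2)[symmetric] ccmp_merge)
    also have "\<dots> = Rho D s \<bullet>\<^bsub>D\<^esub> ((c \<odot>\<^bsub>D\<^esub> cunit D g) \<bullet>\<^bsub>D\<^esub> (RhoI ?p \<bullet>\<^bsub>D\<^esub> (Lam D ?p \<bullet>\<^bsub>D\<^esub> LamI ?p)))"
      by (simp add: k cf cassoc del: LamI_facts(7))
    also have "\<dots> = (c \<bullet>\<^bsub>D\<^esub> Rho D ?p) \<bullet>\<^bsub>D\<^esub> RhoI ?p"
      using Rho_nat[of c s g] by (simp add: k cf cassoc[symmetric])
    finally show ?thesis by (simp add: k cf cassoc)
  qed
  ultimately show ?thesis by blast
qed

text \<open>Mirror image of \<open>conjoint_whisker_lift\<close>: \<rho> o (id . \<delta>) exhibits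
  t . \<open>f\<^sub>!\<close> as the restriction of \<open>t\<close> along \<open>f\<close> on the
  domain side.\<close>

lemma companion_whisker_lift:
  assumes "is_companion D f k" "f \<in> Arr (Ver D)" "h \<in> Arr (Ver D)" "Tgt (Ver D) h = Src (Ver D) f"
    and "cell D s t (f \<circ>\<^bsub>D\<^esub> h) g \<xi>" "Src (Ver D) h = hdom D s"
  shows "\<exists>!c. cell D s (t \<cdot>\<^bsub>D\<^esub> comp_hor k) h g c \<and> Rho D t \<bullet>\<^bsub>D\<^esub> ((cid D t \<odot>\<^bsub>D\<^esub> comp_delta k) \<bullet>\<^bsub>D\<^esub> c) = \<xi>"
proof -
  have t: "hdom D t = Tgt (Ver D) f"
    using cellD(11)[OF assms(5)] assms by simp
  note k = is_companionD[OF assms(1,2)] assms(2-4,6) cellD(1-7,9,12,13)[OF assms(5)] t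
  let ?c = "(\<xi> \<odot>\<^bsub>D\<^esub> (comp_nu k \<bullet>\<^bsub>D\<^esub> cunit D h)) \<bullet>\<^bsub>D\<^esub> RhoI s"
  have "Rho D t \<bullet>\<^bsub>D\<^esub> ((cid D t \<odot>\<^bsub>D\<^esub> comp_delta k) \<bullet>\<^bsub>D\<^esub> ?c)
      = Rho D t \<bullet>\<^bsub>D\<^esub> ((\<xi> \<odot>\<^bsub>D\<^esub> (comp_delta k \<bullet>\<^bsub>D\<^esub> (comp_nu k \<bullet>\<^bsub>D\<^esub> cunit D h))) \<bullet>\<^bsub>D\<^esub> RhoI s)"
    by (simp add: k ccmp_merge_extend)
  also have "\<dots> = Rho D t \<bullet>\<^bsub>D\<^esub> (RhoI t \<bullet>\<^bsub>D\<^esub> \<xi>)"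
    using RhoI_nat[of \<xi> t] by (simp add: k cassoc[symmetric])
  also have "\<dots> = \<xi>"
    by (simp add: k cassoc[symmetric])
  finally have c: "Rho D t \<bullet>\<^bsub>D\<^esub> ((cid D t \<odot>\<^bsub>D\<^esub> comp_delta k) \<bullet>\<^bsub>D\<^esub> ?c) = \<xi>" .
  moreover have "cell D s (t \<cdot>\<^bsub>D\<^esub> comp_hor k) h g ?c"
    unfolding cell_def by (simp add: k)
  moreover have "c = ?c" if c: "cell D s (t \<cdot>\<^bsub>D\<^esub> comp_hor k) h g c"
      "Rho D t \<bullet>\<^bsub>D\<^esub> ((cid D t \<odot>\<^bsub>D\<^esub> comp_delta k) \<bullet>\<^bsub>D\<^esub> c) = \<xi>" for c
  proof -
    note cf = cellD(1-5)[OF c(1)]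
    have "?c = (((Rho D t \<bullet>\<^bsub>D\<^esub> (cid D t \<odot>\<^bsub>D\<^esub> comp_delta k)) \<odot>\<^bsub>D\<^esub> comp_nu k) \<bullet>\<^bsub>D\<^esub> (c \<odot>\<^bsub>D\<^esub> cunit D h)) \<bullet>\<^bsub>D\<^esub> RhoI s"
      by (simp add: k cf c(2)[symmetric] ccmp_merge cassoc)
    also have "\<dots> = Rho D (t \<cdot>\<^bsub>D\<^esub> comp_hor k) \<bullet>\<^bsub>D\<^esub> (RhoI (t \<cdot>\<^bsub>D\<^esub> comp_hor k) \<bullet>\<^bsub>D\<^esub> c)"
      using RhoI_nat[of c "t \<cdot>\<^bsub>D\<^esub> comp_hor k"] companion_zigzag[OF assms(1,2) _ t] by (simp add: k cf cassoc)
    finally show ?thesis by (simp add: k cf cassoc[symmetric])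
  qed
  ultimately show ?thesis by blast
qed

lemma companion_lift:
  assumes "is_companion D f k" "f \<in> Arr (Ver D)" "h \<in> Arr (Ver D)" "Tgt (Ver D) h = Src (Ver D) f"
    and "cell D s (hunit D (Tgt (Ver D) f)) (f \<circ>\<^bsub>D\<^esub> h) g \<xi>" "Src (Ver D) h = hdom D s"
  shows "\<exists>!c. cell D s (comp_hor k) h g c \<and> comp_delta k \<bullet>\<^bsub>D\<^esub> c = \<xi>"
proof -
  note k = is_companionD[OF assms(1,2)] assms(2-4,6) cellD(1-7,9,12,13)[OF assms(5)]
  let ?p = "comp_hor k" and ?b = "hunit D (Tgt (Ver D) f)"
  let ?Q = "\<lambda>c. cell D s (?b \<cdot>\<^bsub>D\<^esub> ?p) h g c \<and> Rho D ?b \<bullet>\<^bsub>D\<^esub> ((cid D ?b \<odot>\<^bsub>D\<^esub> comp_delta k) \<bullet>\<^bsub>D\<^esub> c) = \<xi>"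
  have ex1: "\<exists>!c. ?Q c" by (rule companion_whisker_lift[OF assms])
  have eps: "Rho D ?b \<bullet>\<^bsub>D\<^esub> ((cid D ?b \<odot>\<^bsub>D\<^esub> comp_delta k) \<bullet>\<^bsub>D\<^esub> c) = comp_delta k \<bullet>\<^bsub>D\<^esub> (Lam D ?p \<bullet>\<^bsub>D\<^esub> c)"
    if "cell D s (?b \<cdot>\<^bsub>D\<^esub> ?p) h g c" for c
    using Lam_nat[of "comp_delta k" ?b "vid D (Tgt (Ver D) f)"] cellD(1-5)[OF that]
    by (simp add: k cassoc[symmetric] Lam_hunit)
  obtain c where c: "?Q c" using ex1 by blast
  have "cell D s ?p h g (Lam D ?p \<bullet>\<^bsub>D\<^esub> c)"
    using cellD(1-5)[OF conjunct1[OF c]] unfolding cell_def by (simp add: k)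
  moreover have "comp_delta k \<bullet>\<^bsub>D\<^esub> (Lam D ?p \<bullet>\<^bsub>D\<^esub> c) = \<xi>"
    using eps[OF conjunct1[OF c]] c by simp
  moreover have "d = Lam D ?p \<bullet>\<^bsub>D\<^esub> c" if d: "cell D s ?p h g d" "comp_delta k \<bullet>\<^bsub>D\<^esub> d = \<xi>" for d
  proof -
    note df = cellD(1-5)[OF d(1)]
    have e: "Lam D ?p \<bullet>\<^bsub>D\<^esub> (LamI ?p \<bullet>\<^bsub>D\<^esub> d) = d"
      by (simp add: k df cassoc[symmetric])
    have c2: "cell D s (?b \<cdot>\<^bsub>D\<^esub> ?p) h g (LamI ?p \<bullet>\<^bsub>D\<^esub> d)"
      unfolding cell_def by (simp add: k df)
    then have "?Q (LamI ?p \<bullet>\<^bsub>D\<^esub> d)"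
      using eps[OF c2] e d(2) by simp
    then have "LamI ?p \<bullet>\<^bsub>D\<^esub> d = c" using c ex1 by blast
    then show ?thesis using e by simp
  qed
  ultimately show ?thesis by blast
qed

text \<open>Two cells out of \<open>f\<^sub>!\<close> with the same boundary need only be compared
  after \<nu>. This defines \<open>tau_comp\<close> and later identifies its behaviour under
  \<delta>.\<close>

lemma companion_extend:
  assumes "is_companion D f k" "f \<in> Arr (Ver D)" "g \<in> Arr (Ver D)" "Src (Ver D) g = Tgt (Ver D) f"
    and "cell D (hunit D (Src (Ver D) f)) s h (g \<circ>\<^bsub>D\<^esub> f) \<xi>" "Tgt (Ver D) g = hcod D s"
  shows "\<exists>!c. cell D (comp_hor k) s h g c \<and> c \<bullet>\<^bsub>D\<^esub> comp_nu k = \<xi>"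
proof -
  note k = is_companionD[OF assms(1,2)] assms(2-4,6) cellD(1-13)[OF assms(5)]
  let ?p = "comp_hor k" and ?a = "hunit D (Src (Ver D) f)"
  let ?c = "Lam D s \<bullet>\<^bsub>D\<^esub> (((cunit D g \<bullet>\<^bsub>D\<^esub> comp_delta k) \<odot>\<^bsub>D\<^esub> \<xi>) \<bullet>\<^bsub>D\<^esub> RhoI ?p)"
  have "?c \<bullet>\<^bsub>D\<^esub> comp_nu k = Lam D s \<bullet>\<^bsub>D\<^esub> (((cunit D g \<bullet>\<^bsub>D\<^esub> comp_delta k) \<odot>\<^bsub>D\<^esub> \<xi>) \<bullet>\<^bsub>D\<^esub> ((comp_nu k \<odot>\<^bsub>D\<^esub> cid D ?a) \<bullet>\<^bsub>D\<^esub> RhoI ?a))"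
    using RhoI_nat[of "comp_nu k" ?p] by (simp add: k cassoc)
  also have "\<dots> = (Lam D s \<bullet>\<^bsub>D\<^esub> (cunit D (g \<circ>\<^bsub>D\<^esub> f) \<odot>\<^bsub>D\<^esub> \<xi>)) \<bullet>\<^bsub>D\<^esub> RhoI ?a"
    by (simp add: k cassoc ccmp_merge_extend)
  also have "\<dots> = \<xi> \<bullet>\<^bsub>D\<^esub> (Rho D ?a \<bullet>\<^bsub>D\<^esub> RhoI ?a)"
    using Lam_nat[of \<xi> s "g \<circ>\<^bsub>D\<^esub> f"] by (simp add: k cassoc Lam_hunit del: LamI_facts(7) RhoI_facts(7))
  finally have "?c \<bullet>\<^bsub>D\<^esub> comp_nu k = \<xi>" by (simp add: k)
  moreover have "cell D ?p s h g ?c"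
    unfolding cell_def by (simp add: k)
  moreover have "c = ?c" if c: "cell D ?p s h g c" "c \<bullet>\<^bsub>D\<^esub> comp_nu k = \<xi>" for c
  proof -
    note cf = cellD(1-5)[OF c(1)]
    have "?c = Lam D s \<bullet>\<^bsub>D\<^esub> (((cunit D g \<odot>\<^bsub>D\<^esub> c) \<bullet>\<^bsub>D\<^esub> (comp_delta k \<odot>\<^bsub>D\<^esub> comp_nu k)) \<bullet>\<^bsub>D\<^esub> RhoI ?p)"
      by (simp add: k(1-14) k(16-) cf c(2)[symmetric] ccmp_merge)
    also have "\<dots> = Lam D s \<bullet>\<^bsub>D\<^esub> ((cunit D g \<odot>\<^bsub>D\<^esub> c) \<bullet>\<^bsub>D\<^esub> (LamI ?p \<bullet>\<^bsub>D\<^esub> (Rho D ?p \<bullet>\<^bsub>D\<^esub> RhoI ?p)))"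
      by (simp add: k cf cassoc del: RhoI_facts(7))
    also have "\<dots> = (c \<bullet>\<^bsub>D\<^esub> Lam D ?p) \<bullet>\<^bsub>D\<^esub> LamI ?p"
      using Lam_nat[of c s g] by (simp add: k cf cassoc[symmetric])
    finally show ?thesis by (simp add: k cf cassoc)
  qed
  ultimately show ?thesis by blast
qed

section \<open>Invertible cells between conjoints\<close>

lemma conjoint_endo_unique:
  assumes "is_conjoint D f k" "f \<in> Arr (Ver D)"
    and "c \<in> Arr (Hor D)" "Src (Hor D) c = conj_hor k" "Tgt (Hor D) c = conj_hor k"
      "cdom D c = vid D (Tgt (Ver D) f)" "ccod D c = vid D (Src (Ver D) f)"
    and "conj_eps k \<bullet>\<^bsub>D\<^esub> c = conj_eps k"
  shows "c = cid D (conj_hor k)"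
proof -
  note k = is_conjointD[OF assms(1,2)] assms(2-)
  have "\<exists>!c. cell D (conj_hor k) (conj_hor k) (vid D (Tgt (Ver D) f)) (vid D (Src (Ver D) f)) c \<and> conj_eps k \<bullet>\<^bsub>D\<^esub> c = conj_eps k"
    by (rule conjoint_lift[OF assms(1,2)]) (simp_all add: cell_def k)
  moreover have "cell D (conj_hor k) (conj_hor k) (vid D (Tgt (Ver D) f)) (vid D (Src (Ver D) f)) c"
    "cell D (conj_hor k) (conj_hor k) (vid D (Tgt (Ver D) f)) (vid D (Src (Ver D) f)) (cid D (conj_hor k))"
    by (simp_all add: cell_def k)
  ultimately show ?thesis
    using assms(8) k(1,9,10) by (metis Cmp_cid(1))
qed

text \<open>The inverse of \<epsilon> is \<eta> after the unit cell of the inverse of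
  \<open>f\<close>: the first conjoint equation gives one composite, uniqueness of lifts the
  other.\<close>

lemma conjoint_eps_is_iso:
  assumes "is_conjoint D f k" "is_iso (Ver D) f"
  shows "is_iso (Hor D) (conj_eps k)"
proof -
  define h where "h = inverse_in (Ver D) f"
  have f: "f \<in> Arr (Ver D)" using assms(2) by (rule ver.is_iso_Arr)
  have h: "h \<in> Arr (Ver D)" "Src (Ver D) h = Tgt (Ver D) f" "Tgt (Ver D) h = Src (Ver D) f"
    "h \<circ>\<^bsub>D\<^esub> f = vid D (Src (Ver D) f)" "f \<circ>\<^bsub>D\<^esub> h = vid D (Tgt (Ver D) f)"
    using ver.inverse_in_simps[OF assms(2)] unfolding h_def by simp_all
  note k = is_conjointD[OF assms(1) f] f h
  have "conj_eps k \<bullet>\<^bsub>D\<^esub> (conj_eta k \<bullet>\<^bsub>D\<^esub> cunit D h) = cid D (hunit D (Tgt (Ver D) f))"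
    by (simp add: k cassoc[symmetric])
  moreover from this have "(conj_eta k \<bullet>\<^bsub>D\<^esub> cunit D h) \<bullet>\<^bsub>D\<^esub> conj_eps k = cid D (conj_hor k)"
    by (intro conjoint_endo_unique[OF assms(1) f]) (simp_all add: k cassoc[symmetric])
  ultimately have "inverse_arrows (Hor D) (conj_eps k) (conj_eta k \<bullet>\<^bsub>D\<^esub> cunit D h)"
    unfolding inverse_arrows_def by (simp add: k)
  then show ?thesis unfolding is_iso_def by blast
qed

text \<open>The square and its inverse both lift through the conjoint counits, and either composite
  of the lifts fixes a counit, hence is an identity. Only the sides \<open>g\<close> and
  \<open>h\<close> are inverted; \<open>f\<close> and \<open>f'\<close> need not be
  invertible.\<close>

lemma conjoint_square_iso:
  assumes "is_conjoint D f k" "f \<in> Arr (Ver D)" "is_conjoint D f' k'" "f' \<in> Arr (Ver D)"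
    and "is_iso (Ver D) g" "is_iso (Ver D) h" "Src (Ver D) g = Tgt (Ver D) f" "Tgt (Ver D) g = Tgt (Ver D) f'"
    and "Src (Ver D) h = Src (Ver D) f" "Tgt (Ver D) h = Src (Ver D) f'" "g \<circ>\<^bsub>D\<^esub> f = f' \<circ>\<^bsub>D\<^esub> h"
  obtains \<tau> where "cell D (conj_hor k) (conj_hor k') g h \<tau>" "conj_eps k' \<bullet>\<^bsub>D\<^esub> \<tau> = cunit D g \<bullet>\<^bsub>D\<^esub> conj_eps k"
    "is_iso (Hor D) \<tau>"
proof -
  define gi hi where "gi = inverse_in (Ver D) g" and "hi = inverse_in (Ver D) h"
  have i: "g \<in> Arr (Ver D)" "h \<in> Arr (Ver D)" using assms(5,6) by (auto intro: ver.is_iso_Arr)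
  have g: "gi \<in> Arr (Ver D)" "Src (Ver D) gi = Tgt (Ver D) f'" "Tgt (Ver D) gi = Tgt (Ver D) f"
    "gi \<circ>\<^bsub>D\<^esub> g = vid D (Tgt (Ver D) f)" "g \<circ>\<^bsub>D\<^esub> gi = vid D (Tgt (Ver D) f')"
    using ver.inverse_in_simps[OF assms(5)] assms(7,8) unfolding gi_def by simp_all
  have h: "hi \<in> Arr (Ver D)" "Src (Ver D) hi = Src (Ver D) f'" "Tgt (Ver D) hi = Src (Ver D) f"
    "hi \<circ>\<^bsub>D\<^esub> h = vid D (Src (Ver D) f)" "h \<circ>\<^bsub>D\<^esub> hi = vid D (Src (Ver D) f')"
    using ver.inverse_in_simps[OF assms(6)] assms(9,10) unfolding hi_def by simp_all
  note k = is_conjointD[OF assms(1,2)] is_conjointD[OF assms(3,4)] assms(2,4,7-10) i g h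
  \<comment> \<open>The inverted square must commute as well: this equation is the codomain
    condition for the lift in the opposite direction.\<close>
  have "gi \<circ>\<^bsub>D\<^esub> f' = gi \<circ>\<^bsub>D\<^esub> (f' \<circ>\<^bsub>D\<^esub> (h \<circ>\<^bsub>D\<^esub> hi))"
    by (simp add: k)
  also have "\<dots> = gi \<circ>\<^bsub>D\<^esub> ((g \<circ>\<^bsub>D\<^esub> f) \<circ>\<^bsub>D\<^esub> hi)"
    by (simp only: assms(11)) (simp add: k(16-) del: h(5))
  also have "\<dots> = (gi \<circ>\<^bsub>D\<^esub> g) \<circ>\<^bsub>D\<^esub> (f \<circ>\<^bsub>D\<^esub> hi)"
    by (simp add: k del: g(4))
  finally have gf: "gi \<circ>\<^bsub>D\<^esub> f' = f \<circ>\<^bsub>D\<^esub> hi" by (simp add: k)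
  have "\<exists>!c. cell D (conj_hor k) (conj_hor k') g h c \<and> conj_eps k' \<bullet>\<^bsub>D\<^esub> c = cunit D g \<bullet>\<^bsub>D\<^esub> conj_eps k"
    by (rule conjoint_lift[OF assms(3,4)]) (simp_all add: cell_def k assms(11))
  then obtain \<tau> where t: "cell D (conj_hor k) (conj_hor k') g h \<tau>" "conj_eps k' \<bullet>\<^bsub>D\<^esub> \<tau> = cunit D g \<bullet>\<^bsub>D\<^esub> conj_eps k"
    by blast
  have "\<exists>!c. cell D (conj_hor k') (conj_hor k) gi hi c \<and> conj_eps k \<bullet>\<^bsub>D\<^esub> c = cunit D gi \<bullet>\<^bsub>D\<^esub> conj_eps k'"
    by (rule conjoint_lift[OF assms(1,2)]) (simp_all add: cell_def k gf)
  then obtain \<tau>' where t': "cell D (conj_hor k') (conj_hor k) gi hi \<tau>'" "conj_eps k \<bullet>\<^bsub>D\<^esub> \<tau>' = cunit D gi \<bullet>\<^bsub>D\<^esub> conj_eps k'"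
    by blast
  note tf = cellD(1-5)[OF t(1)] cellD(1-5)[OF t'(1)]
  have "conj_eps k \<bullet>\<^bsub>D\<^esub> (\<tau>' \<bullet>\<^bsub>D\<^esub> \<tau>) = cunit D gi \<bullet>\<^bsub>D\<^esub> (conj_eps k' \<bullet>\<^bsub>D\<^esub> \<tau>)"
    using t'(2) by (simp add: k tf cassoc[symmetric])
  also have "\<dots> = conj_eps k"
    unfolding t(2) by (simp add: k cassoc[symmetric])
  finally have 1: "\<tau>' \<bullet>\<^bsub>D\<^esub> \<tau> = cid D (conj_hor k)"
    by (intro conjoint_endo_unique[OF assms(1,2)]) (simp_all add: k tf)
  have "conj_eps k' \<bullet>\<^bsub>D\<^esub> (\<tau> \<bullet>\<^bsub>D\<^esub> \<tau>') = cunit D g \<bullet>\<^bsub>D\<^esub> (conj_eps k \<bullet>\<^bsub>D\<^esub> \<tau>')"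
    using t(2) by (simp add: k tf cassoc[symmetric])
  also have "\<dots> = conj_eps k'"
    unfolding t'(2) by (simp add: k cassoc[symmetric])
  finally have "\<tau> \<bullet>\<^bsub>D\<^esub> \<tau>' = cid D (conj_hor k')"
    by (intro conjoint_endo_unique[OF assms(3,4)]) (simp_all add: k tf)
  with 1 have "is_iso (Hor D) \<tau>"
    unfolding is_iso_def inverse_arrows_def using tf by (intro exI[of _ \<tau>']) simp
  then show ?thesis using that t by blast
qed

section \<open>Middle four whiskering\<close>

text \<open>
  The computation behind both multiplications: tensoring two cells by means of the unitors turns a
  comparison \<open>c\<close> between the inner factors into \<open>mid_whisker\<close>.
\<close>

lemma unitor_tensor:
  assumes "cell D p P f g \<chi>" "cell D q (hunit D u) f' f E" "cell D r R h f' X"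
    and "cell D s (hunit D w) i h E'" "cell D q' R l f V" "cell D r' (hunit D w) h l E1"
    and "globular D (q \<cdot>\<^bsub>D\<^esub> r) (q' \<cdot>\<^bsub>D\<^esub> r') c"
    and "u \<in> Obj (Ver D)" "w \<in> Obj (Ver D)" "hcod D q = hdom D p" "hcod D r = hdom D q" "hcod D s = hdom D r"
      "hcod D q' = hdom D p" "hcod D r' = hdom D q'" "hdom D r' = hdom D r"
    and n: "Lam D R \<bullet>\<^bsub>D\<^esub> (E \<odot>\<^bsub>D\<^esub> X) = Rho D R \<bullet>\<^bsub>D\<^esub> ((V \<odot>\<^bsub>D\<^esub> E1) \<bullet>\<^bsub>D\<^esub> c)"
  shows "(Rho D P \<bullet>\<^bsub>D\<^esub> (\<chi> \<odot>\<^bsub>D\<^esub> E)) \<odot>\<^bsub>D\<^esub> (Rho D R \<bullet>\<^bsub>D\<^esub> (X \<odot>\<^bsub>D\<^esub> E'))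
    = Rho D (P \<cdot>\<^bsub>D\<^esub> R) \<bullet>\<^bsub>D\<^esub> (((\<chi> \<odot>\<^bsub>D\<^esub> V) \<odot>\<^bsub>D\<^esub> (Rho D (hunit D w) \<bullet>\<^bsub>D\<^esub> (E1 \<odot>\<^bsub>D\<^esub> E'))) \<bullet>\<^bsub>D\<^esub> mid_whisker D p q r q' r' s c)"
proof -
  note c1 = cellD(1-9)[OF assms(1)] and c2 = cellD(1-9)[OF assms(2)] and c3 = cellD(1-9)[OF assms(3)]
    and c4 = cellD(1-9)[OF assms(4)] and c5 = cellD(1-9)[OF assms(5)] and c6 = cellD(1-9)[OF assms(6)]
  have Pu: "hdom D P = u" "hcod D R = u" "hdom D R = w" "Tgt (Ver D) f = u" "Tgt (Ver D) h = w" "Tgt (Ver D) f' = u"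
    "Tgt (Ver D) l = w"
    using cellD(11,13)[OF assms(1)] cellD(11,13)[OF assms(2)] cellD(11,13)[OF assms(3)]
      cellD(11,13)[OF assms(4)] cellD(13)[OF assms(6)] assms(8,9) by auto
  have "q \<cdot>\<^bsub>D\<^esub> r \<in> Obj (Hor D)"
    using c2 c3 assms(8-15) by simp
  note cc = globular_simps[OF assms(7) this]
  note k = c1 c2 c3 c4 c5 c6 assms(8-15) Pu cc
  let ?u = "hunit D u" and ?w = "hunit D w"
  let ?Z = "Rho D R \<bullet>\<^bsub>D\<^esub> (X \<odot>\<^bsub>D\<^esub> E')" and ?W = "Rho D ?w \<bullet>\<^bsub>D\<^esub> (E1 \<odot>\<^bsub>D\<^esub> E')" and ?X = "Rho D R \<bullet>\<^bsub>D\<^esub> (V \<odot>\<^bsub>D\<^esub> E1)"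
  \<comment> \<open>Coherence of \<lambda> at a composite rebrackets \<open>E\<close>,
    \<open>X\<close>, \<open>E'\<close> so that \<open>E\<close> and \<open>X\<close> stand
    together; hypothesis \<open>n\<close> then trades them for \<open>V\<close>, \<open>E1\<close>
    and the comparison \<open>c\<close>.\<close>
  have "Lam D R \<bullet>\<^bsub>D\<^esub> (E \<odot>\<^bsub>D\<^esub> ?Z) = (Lam D R \<bullet>\<^bsub>D\<^esub> (cid D ?u \<odot>\<^bsub>D\<^esub> Rho D R)) \<bullet>\<^bsub>D\<^esub> (E \<odot>\<^bsub>D\<^esub> (X \<odot>\<^bsub>D\<^esub> E'))"
    by (simp add: k ccmp_merge cassoc)
  also have "\<dots> = (Rho D R \<bullet>\<^bsub>D\<^esub> Lam D (R \<cdot>\<^bsub>D\<^esub> ?w)) \<bullet>\<^bsub>D\<^esub> ((E \<odot>\<^bsub>D\<^esub> (X \<odot>\<^bsub>D\<^esub> E')) \<bullet>\<^bsub>D\<^esub> (Alp D q r s \<bullet>\<^bsub>D\<^esub> AlpI q r s))"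
    using Lam_nat[of "Rho D R" R "vid D u"] by (simp add: k)
  also have "\<dots> = Rho D R \<bullet>\<^bsub>D\<^esub> (Lam D (R \<cdot>\<^bsub>D\<^esub> ?w) \<bullet>\<^bsub>D\<^esub> ((Alp D ?u R ?w \<bullet>\<^bsub>D\<^esub> ((E \<odot>\<^bsub>D\<^esub> X) \<odot>\<^bsub>D\<^esub> E')) \<bullet>\<^bsub>D\<^esub> AlpI q r s))"
    using Alp_nat[of E' X E ?w R ?u] by (simp add: k cassoc del: AlpI_facts(7))
  also have "\<dots> = Rho D R \<bullet>\<^bsub>D\<^esub> (((Lam D R \<odot>\<^bsub>D\<^esub> cid D ?w) \<bullet>\<^bsub>D\<^esub> ((E \<odot>\<^bsub>D\<^esub> X) \<odot>\<^bsub>D\<^esub> E')) \<bullet>\<^bsub>D\<^esub> AlpI q r s)"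
    using Lam_hcmp[of ?w R] by (simp add: k cassoc[symmetric])
  also have "\<dots> = Rho D R \<bullet>\<^bsub>D\<^esub> (((?X \<bullet>\<^bsub>D\<^esub> c) \<odot>\<^bsub>D\<^esub> E') \<bullet>\<^bsub>D\<^esub> AlpI q r s)"
    by (simp add: k ccmp_merge n cassoc)
  also have "\<dots> = (Rho D R \<bullet>\<^bsub>D\<^esub> (?X \<odot>\<^bsub>D\<^esub> E')) \<bullet>\<^bsub>D\<^esub> ((c \<odot>\<^bsub>D\<^esub> cid D s) \<bullet>\<^bsub>D\<^esub> AlpI q r s)"
    by (simp add: k ccmp_merge_extend cassoc)
  finally have 1: "Lam D R \<bullet>\<^bsub>D\<^esub> (E \<odot>\<^bsub>D\<^esub> ?Z) = (Rho D R \<bullet>\<^bsub>D\<^esub> (?X \<odot>\<^bsub>D\<^esub> E')) \<bullet>\<^bsub>D\<^esub> ((c \<odot>\<^bsub>D\<^esub> cid D s) \<bullet>\<^bsub>D\<^esub> AlpI q r s)" .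
  \<comment> \<open>The same rebracketing on the \<rho> side: the units below \<open>E1\<close> and
    \<open>E'\<close> are merged, which leaves the single right factor \<open>?W\<close>.\<close>
  have "Rho D R \<bullet>\<^bsub>D\<^esub> (?X \<odot>\<^bsub>D\<^esub> E') = (Rho D R \<bullet>\<^bsub>D\<^esub> (Rho D R \<odot>\<^bsub>D\<^esub> cid D ?w)) \<bullet>\<^bsub>D\<^esub> ((V \<odot>\<^bsub>D\<^esub> E1) \<odot>\<^bsub>D\<^esub> E')"
    by (simp add: k ccmp_merge cassoc)
  also have "\<dots> = Rho D R \<bullet>\<^bsub>D\<^esub> (Rho D (R \<cdot>\<^bsub>D\<^esub> ?w) \<bullet>\<^bsub>D\<^esub> ((V \<odot>\<^bsub>D\<^esub> E1) \<odot>\<^bsub>D\<^esub> E'))"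
    using Rho_nat[of "Rho D R" R "vid D w"] by (simp add: k cassoc)
  also have "\<dots> = Rho D R \<bullet>\<^bsub>D\<^esub> ((cid D R \<odot>\<^bsub>D\<^esub> Rho D ?w) \<bullet>\<^bsub>D\<^esub> (Alp D R ?w ?w \<bullet>\<^bsub>D\<^esub> ((V \<odot>\<^bsub>D\<^esub> E1) \<odot>\<^bsub>D\<^esub> E')))"
    using Rho_hcmp[of ?w R] by (simp add: k cassoc[symmetric])
  also have "\<dots> = Rho D R \<bullet>\<^bsub>D\<^esub> ((V \<odot>\<^bsub>D\<^esub> ?W) \<bullet>\<^bsub>D\<^esub> Alp D q' r' s)"
    using Alp_nat[of E' E1 V ?w ?w R] by (simp add: k ccmp_merge_extend)
  finally have 2: "Rho D R \<bullet>\<^bsub>D\<^esub> (?X \<odot>\<^bsub>D\<^esub> E') = Rho D R \<bullet>\<^bsub>D\<^esub> ((V \<odot>\<^bsub>D\<^esub> ?W) \<bullet>\<^bsub>D\<^esub> Alp D q' r' s)" .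
  \<comment> \<open>The triangle turns the \<rho> on the left factor into a \<lambda> on the right
    one, which is where the two preceding equations apply.\<close>
  have "(Rho D P \<bullet>\<^bsub>D\<^esub> (\<chi> \<odot>\<^bsub>D\<^esub> E)) \<odot>\<^bsub>D\<^esub> ?Z = (Rho D P \<odot>\<^bsub>D\<^esub> cid D R) \<bullet>\<^bsub>D\<^esub> ((\<chi> \<odot>\<^bsub>D\<^esub> E) \<odot>\<^bsub>D\<^esub> ?Z)"
    by (simp add: k ccmp_merge)
  also have "\<dots> = (cid D P \<odot>\<^bsub>D\<^esub> Lam D R) \<bullet>\<^bsub>D\<^esub> (Alp D P ?u R \<bullet>\<^bsub>D\<^esub> ((\<chi> \<odot>\<^bsub>D\<^esub> E) \<odot>\<^bsub>D\<^esub> ?Z))"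
    using triangle[of R P, symmetric] by (simp add: k cassoc)
  also have "\<dots> = (\<chi> \<odot>\<^bsub>D\<^esub> (Lam D R \<bullet>\<^bsub>D\<^esub> (E \<odot>\<^bsub>D\<^esub> ?Z))) \<bullet>\<^bsub>D\<^esub> Alp D p q (r \<cdot>\<^bsub>D\<^esub> s)"
    using Alp_nat[of ?Z E \<chi> R ?u P] by (simp add: k ccmp_merge_extend)
  also have "\<dots> = (\<chi> \<odot>\<^bsub>D\<^esub> (Rho D R \<bullet>\<^bsub>D\<^esub> ((V \<odot>\<^bsub>D\<^esub> ?W) \<bullet>\<^bsub>D\<^esub> (Alp D q' r' s \<bullet>\<^bsub>D\<^esub> ((c \<odot>\<^bsub>D\<^esub> cid D s) \<bullet>\<^bsub>D\<^esub> AlpI q r s))))) \<bullet>\<^bsub>D\<^esub> Alp D p q (r \<cdot>\<^bsub>D\<^esub> s)"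
    unfolding 1 2 by (simp add: k cassoc)
  also have "\<dots> = ((cid D P \<odot>\<^bsub>D\<^esub> Rho D R) \<bullet>\<^bsub>D\<^esub> (\<chi> \<odot>\<^bsub>D\<^esub> (V \<odot>\<^bsub>D\<^esub> ?W))) \<bullet>\<^bsub>D\<^esub> ((cid D p \<odot>\<^bsub>D\<^esub> Alp D q' r' s) \<bullet>\<^bsub>D\<^esub>
      ((cid D p \<odot>\<^bsub>D\<^esub> (c \<odot>\<^bsub>D\<^esub> cid D s)) \<bullet>\<^bsub>D\<^esub> ((cid D p \<odot>\<^bsub>D\<^esub> AlpI q r s) \<bullet>\<^bsub>D\<^esub> Alp D p q (r \<cdot>\<^bsub>D\<^esub> s))))"
    by (simp add: k ccmp_merge_extend ccmp_merge cassoc)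
  \<comment> \<open>Inserting an associator and its inverse completes the four remaining cells to
    \<open>mid_whisker\<close>.\<close>
  also have "\<dots> = ((cid D P \<odot>\<^bsub>D\<^esub> Rho D R) \<bullet>\<^bsub>D\<^esub> ((\<chi> \<odot>\<^bsub>D\<^esub> (V \<odot>\<^bsub>D\<^esub> ?W)) \<bullet>\<^bsub>D\<^esub> Alp D p q' (r' \<cdot>\<^bsub>D\<^esub> s))) \<bullet>\<^bsub>D\<^esub> mid_whisker D p q r q' r' s c"
    unfolding mid_whisker_def by (simp add: k cassoc hor.Cmp_assoc[of _ "AlpI p q' (r' \<cdot>\<^bsub>D\<^esub> s)" "Alp D p q' (r' \<cdot>\<^bsub>D\<^esub> s)"])
  also have "\<dots> = ((cid D P \<odot>\<^bsub>D\<^esub> Rho D R) \<bullet>\<^bsub>D\<^esub> (Alp D P R ?w \<bullet>\<^bsub>D\<^esub> ((\<chi> \<odot>\<^bsub>D\<^esub> V) \<odot>\<^bsub>D\<^esub> ?W))) \<bullet>\<^bsub>D\<^esub> mid_whisker D p q r q' r' s c"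
    using Alp_nat[of ?W V \<chi> ?w R P] by (simp add: k)
  also have "\<dots> = Rho D (P \<cdot>\<^bsub>D\<^esub> R) \<bullet>\<^bsub>D\<^esub> (((\<chi> \<odot>\<^bsub>D\<^esub> V) \<odot>\<^bsub>D\<^esub> ?W) \<bullet>\<^bsub>D\<^esub> mid_whisker D p q r q' r' s c)"
    using Rho_hcmp[of R P, symmetric] by (simp add: k cassoc mid_whisker_def)
  finally show ?thesis .
qed

end

section \<open>Lax functors and vertical transformations\<close>

lemma (in category) functor_inverse_arrows:
  assumes "is_functor C B F" "inverse_arrows C f g"
  shows "inverse_arrows B (far F f) (far F g)"
proof -
  from assms(2) have *: "f \<in> Arr C" "g \<in> Arr C" "Src C g = Tgt C f" "Tgt C g = Src C f"
      "Cmp C g f = Ide C (Src C f)" "Cmp C f g = Ide C (Tgt C f)"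
    unfolding inverse_arrows_def by auto
  have "Cmp B (far F g) (far F f) = far F (Cmp C g f)" "Cmp B (far F f) (far F g) = far F (Cmp C f g)"
    using assms(1) *(1-4) unfolding is_functor_def by simp_all
  then show ?thesis
    using assms(1) * Src_in[of f] Tgt_in[of f] unfolding inverse_arrows_def is_functor_def by simp
qed

lemma (in category) functor_is_iso: "is_functor C B F \<Longrightarrow> is_iso C f \<Longrightarrow> is_iso B (far F f)"
  unfolding is_iso_def using functor_inverse_arrows by blast

lemma lax_comp_simps [simp]:
  "fo (lax_comp C G F) x = fo G (fo F x)" "fv (lax_comp C G F) f = fv G (fv F f)"
  "fh (lax_comp C G F) r = fh G (fh F r)" "fc (lax_comp C G F) \<beta> = fc G (fc F \<beta>)"
  "fe (lax_comp C G F) x = fc G (fe F x) \<bullet>\<^bsub>C\<^esub> fe G (fo F x)"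
  "fm (lax_comp C G F) s r = fc G (fm F s r) \<bullet>\<^bsub>C\<^esub> fm G (fh F s) (fh F r)"
  by (simp_all add: lax_comp_def)

lemma lax_id_simps [simp]:
  "fo (lax_id C) x = x" "fv (lax_id C) f = f" "fh (lax_id C) r = r" "fc (lax_id C) \<beta> = \<beta>"
  "fe (lax_id C) x = cid C (hunit C x)" "fm (lax_id C) s r = cid C (s \<cdot>\<^bsub>C\<^esub> r)"
  by (simp_all add: lax_id_def)

context lax_functor begin

lemma lax_simps [simp]:
  "x \<in> Obj (Ver D) \<Longrightarrow> fo F x \<in> Obj (Ver E)"
  "f \<in> Arr (Ver D) \<Longrightarrow> fv F f \<in> Arr (Ver E)"
  "f \<in> Arr (Ver D) \<Longrightarrow> Src (Ver E) (fv F f) = fo F (Src (Ver D) f)"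
  "f \<in> Arr (Ver D) \<Longrightarrow> Tgt (Ver E) (fv F f) = fo F (Tgt (Ver D) f)"
  "x \<in> Obj (Ver D) \<Longrightarrow> fv F (vid D x) = vid E (fo F x)"
  "r \<in> Obj (Hor D) \<Longrightarrow> fh F r \<in> Obj (Hor E)"
  "r \<in> Obj (Hor D) \<Longrightarrow> hdom E (fh F r) = fo F (hdom D r)"
  "r \<in> Obj (Hor D) \<Longrightarrow> hcod E (fh F r) = fo F (hcod D r)"
  "\<beta> \<in> Arr (Hor D) \<Longrightarrow> fc F \<beta> \<in> Arr (Hor E)"
  "\<beta> \<in> Arr (Hor D) \<Longrightarrow> Src (Hor E) (fc F \<beta>) = fh F (Src (Hor D) \<beta>)"
  "\<beta> \<in> Arr (Hor D) \<Longrightarrow> Tgt (Hor E) (fc F \<beta>) = fh F (Tgt (Hor D) \<beta>)"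
  "\<beta> \<in> Arr (Hor D) \<Longrightarrow> cdom E (fc F \<beta>) = fv F (cdom D \<beta>)"
  "\<beta> \<in> Arr (Hor D) \<Longrightarrow> ccod E (fc F \<beta>) = fv F (ccod D \<beta>)"
  "r \<in> Obj (Hor D) \<Longrightarrow> fc F (cid D r) = cid E (fh F r)"
  using F0_functor F1_functor fh_boundary fc_boundary unfolding is_functor_def by auto

lemma fv_Cmp [simp]:
  "\<lbrakk>f \<in> Arr (Ver D); g \<in> Arr (Ver D); Src (Ver D) g = Tgt (Ver D) f\<rbrakk> \<Longrightarrow> fv F (g \<circ>\<^bsub>D\<^esub> f) = fv F g \<circ>\<^bsub>E\<^esub> fv F f"
  using F0_functor unfolding is_functor_def by auto

lemma fc_Cmp:
  "\<lbrakk>\<alpha> \<in> Arr (Hor D); \<beta> \<in> Arr (Hor D); Src (Hor D) \<beta> = Tgt (Hor D) \<alpha>\<rbrakk> \<Longrightarrow> fc F (\<beta> \<bullet>\<^bsub>D\<^esub> \<alpha>) = fc F \<beta> \<bullet>\<^bsub>E\<^esub> fc F \<alpha>"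
  using F1_functor unfolding is_functor_def by auto

lemma fe_simps [simp]:
  assumes "x \<in> Obj (Ver D)"
  shows "fe F x \<in> Arr (Hor E)" "Src (Hor E) (fe F x) = hunit E (fo F x)"
    "Tgt (Hor E) (fe F x) = fh F (hunit D x)" "cdom E (fe F x) = vid E (fo F x)"
    "ccod E (fe F x) = vid E (fo F x)"
  using cod.globular_simps[OF fe_globular[OF assms]] assms by simp_all

lemma fm_simps [simp]:
  assumes "r \<in> Obj (Hor D)" "s \<in> Obj (Hor D)" "hdom D s = hcod D r"
  shows "fm F s r \<in> Arr (Hor E)" "Src (Hor E) (fm F s r) = fh F s \<cdot>\<^bsub>E\<^esub> fh F r"
    "Tgt (Hor E) (fm F s r) = fh F (s \<cdot>\<^bsub>D\<^esub> r)" "cdom E (fm F s r) = vid E (fo F (hdom D r))"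
    "ccod E (fm F s r) = vid E (fo F (hcod D s))"
  using cod.globular_simps[OF fm_globular[OF assms]] assms by simp_all

lemma fm_nat:
  assumes "\<alpha> \<in> Arr (Hor D)" "\<beta> \<in> Arr (Hor D)" "cdom D \<beta> = ccod D \<alpha>" "Tgt (Hor D) \<alpha> = r'" "Tgt (Hor D) \<beta> = s'"
  shows "fm F s' r' \<bullet>\<^bsub>E\<^esub> (fc F \<beta> \<odot>\<^bsub>E\<^esub> fc F \<alpha>) = fc F (\<beta> \<odot>\<^bsub>D\<^esub> \<alpha>) \<bullet>\<^bsub>E\<^esub> fm F (Src (Hor D) \<beta>) (Src (Hor D) \<alpha>)"
  using fm_natural[of "Src (Hor D) \<alpha>" r' "cdom D \<alpha>" "ccod D \<alpha>" \<alpha> "Src (Hor D) \<beta>" s' "ccod D \<beta>" \<beta>] assms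
  unfolding cell_def by simp

lemma fm_unit_right_extend:
  assumes "r \<in> Obj (Hor D)" "hdom D r = x" "\<gamma> \<in> Arr (Hor E)" "Tgt (Hor E) \<gamma> = fh F r \<cdot>\<^bsub>E\<^esub> hunit E (fo F x)"
  shows "fc F (Rho D r) \<bullet>\<^bsub>E\<^esub> (fm F r (hunit D x) \<bullet>\<^bsub>E\<^esub> ((cid E (fh F r) \<odot>\<^bsub>E\<^esub> fe F x) \<bullet>\<^bsub>E\<^esub> \<gamma>)) = Rho E (fh F r) \<bullet>\<^bsub>E\<^esub> \<gamma>"
proof -
  have x: "x \<in> Obj (Ver D)" using assms(1,2) by auto
  show ?thesis
    unfolding fm_unit_right[OF assms(1), symmetric] assms(2) using assms x by (simp add: cod.cassoc)
qed

lemma fv_inverse_arrows: "inverse_arrows (Ver D) f g \<Longrightarrow> inverse_arrows (Ver E) (fv F f) (fv F g)"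
  using dom.ver.functor_inverse_arrows[OF F0_functor] .

lemma fv_is_iso: "is_iso (Ver D) f \<Longrightarrow> is_iso (Ver E) (fv F f)"
  using dom.ver.functor_is_iso[OF F0_functor] .

text \<open>A comparison cell \<tau> is specified through \<nu> alone. As cells out of
  \<open>(Ff)\<^sub>!\<close> are determined by their composite with \<nu>, both sides are compared
  there, and naturality of the unit constraint \<open>fe\<close> matches them.\<close>

lemma companion_comparison_delta:
  assumes "is_companion D f k" "f \<in> Arr (Ver D)" "is_companion E (fv F f) k'"
    and "globular E (comp_hor k') (fh F (comp_hor k)) \<tau>"
    and "\<tau> \<bullet>\<^bsub>E\<^esub> comp_nu k' = fc F (comp_nu k) \<bullet>\<^bsub>E\<^esub> fe F (Src (Ver D) f)"
  shows "fc F (comp_delta k) \<bullet>\<^bsub>E\<^esub> \<tau> = fe F (Tgt (Ver D) f) \<bullet>\<^bsub>E\<^esub> comp_delta k'"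
proof -
  have fF: "fv F f \<in> Arr (Ver E)" using assms(2) by simp
  note k = dom.is_companionD[OF assms(1,2)] and k' = cod.is_companionD[OF assms(3) fF] and f = assms(2)
  note t = cod.globular_simps[OF assms(4) k'(1)]
  let ?x = "Src (Ver D) f" and ?y = "Tgt (Ver D) f"
  let ?\<xi> = "fc F (cunit D f) \<bullet>\<^bsub>E\<^esub> fe F ?x"
  have "\<exists>!c. cell E (comp_hor k') (fh F (hunit D ?y)) (fv F f) (vid E (fo F ?y)) c \<and> c \<bullet>\<^bsub>E\<^esub> comp_nu k' = ?\<xi>"
    by (rule cod.companion_extend[OF assms(3) fF]) (simp_all add: f cell_def)
  moreover have "cell E (comp_hor k') (fh F (hunit D ?y)) (fv F f) (vid E (fo F ?y)) (fc F (comp_delta k) \<bullet>\<^bsub>E\<^esub> \<tau>)"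
    by (simp add: cell_def k k' t f)
  moreover have "(fc F (comp_delta k) \<bullet>\<^bsub>E\<^esub> \<tau>) \<bullet>\<^bsub>E\<^esub> comp_nu k' = ?\<xi>"
    by (simp add: k k' t f cod.cassoc assms(5) dom.cassoc flip: fc_Cmp)
       (simp add: k k' t f fc_Cmp[symmetric] cod.cassoc[symmetric])
  moreover have "cell E (comp_hor k') (fh F (hunit D ?y)) (fv F f) (vid E (fo F ?y)) (fe F ?y \<bullet>\<^bsub>E\<^esub> comp_delta k')"
    by (simp add: cell_def k k' f)
  moreover have "(fe F ?y \<bullet>\<^bsub>E\<^esub> comp_delta k') \<bullet>\<^bsub>E\<^esub> comp_nu k' = ?\<xi>"
    using fe_natural[OF f] by (simp add: k k' f cod.cassoc)
  ultimately show ?thesis by blast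
qed

text \<open>The same argument for conjoints, with \<eta> in place of \<nu>.\<close>

lemma conjoint_comparison_eps:
  assumes "is_conjoint D f k" "f \<in> Arr (Ver D)" "is_conjoint E (fv F f) k'"
    and "globular E (conj_hor k') (fh F (conj_hor k)) \<sigma>"
    and "\<sigma> \<bullet>\<^bsub>E\<^esub> conj_eta k' = fc F (conj_eta k) \<bullet>\<^bsub>E\<^esub> fe F (Src (Ver D) f)"
  shows "fc F (conj_eps k) \<bullet>\<^bsub>E\<^esub> \<sigma> = fe F (Tgt (Ver D) f) \<bullet>\<^bsub>E\<^esub> conj_eps k'"
proof -
  have fF: "fv F f \<in> Arr (Ver E)" using assms(2) by simp
  note k = dom.is_conjointD[OF assms(1,2)] and k' = cod.is_conjointD[OF assms(3) fF] and f = assms(2)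
  note t = cod.globular_simps[OF assms(4) k'(1)]
  let ?x = "Src (Ver D) f" and ?y = "Tgt (Ver D) f"
  let ?\<xi> = "fc F (cunit D f) \<bullet>\<^bsub>E\<^esub> fe F ?x"
  have "\<exists>!c. cell E (conj_hor k') (fh F (hunit D ?y)) (vid E (fo F ?y)) (fv F f) c \<and> c \<bullet>\<^bsub>E\<^esub> conj_eta k' = ?\<xi>"
    by (rule cod.conjoint_extend[OF assms(3) fF]) (simp_all add: f cell_def)
  moreover have "cell E (conj_hor k') (fh F (hunit D ?y)) (vid E (fo F ?y)) (fv F f) (fc F (conj_eps k) \<bullet>\<^bsub>E\<^esub> \<sigma>)"
    by (simp add: cell_def k k' t f)
  moreover have "(fc F (conj_eps k) \<bullet>\<^bsub>E\<^esub> \<sigma>) \<bullet>\<^bsub>E\<^esub> conj_eta k' = ?\<xi>"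
    by (simp add: k k' t f cod.cassoc assms(5))
       (simp add: k k' t f fc_Cmp[symmetric] cod.cassoc[symmetric])
  moreover have "cell E (conj_hor k') (fh F (hunit D ?y)) (vid E (fo F ?y)) (fv F f) (fe F ?y \<bullet>\<^bsub>E\<^esub> conj_eps k')"
    by (simp add: cell_def k k' f)
  moreover have "(fe F ?y \<bullet>\<^bsub>E\<^esub> conj_eps k') \<bullet>\<^bsub>E\<^esub> conj_eta k' = ?\<xi>"
    using fe_natural[OF f] by (simp add: k k' f cod.cassoc)
  ultimately show ?thesis by blast
qed

text \<open>A lax functor preserves restrictions along companions: the image of the restriction
  cell, lifted through the restriction cell of the image, inverts \<theta>. One composite reduces to
  the companion zigzag in \<open>E\<close>, the other to the one in \<open>D\<close> together with
  the unit coherence of \<open>F\<close>.\<close>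

lemma companion_comparison_is_iso:
  assumes "is_companion D f k" "f \<in> Arr (Ver D)" "is_companion E (fv F f) k'"
    and "globular E (comp_hor k') (fh F (comp_hor k)) \<tau>"
    and "\<tau> \<bullet>\<^bsub>E\<^esub> comp_nu k' = fc F (comp_nu k) \<bullet>\<^bsub>E\<^esub> fe F (Src (Ver D) f)"
    and "p \<in> Obj (Hor D)" "hdom D p = Tgt (Ver D) f"
  defines "\<theta> \<equiv> fm F p (comp_hor k) \<bullet>\<^bsub>E\<^esub> (cid E (fh F p) \<odot>\<^bsub>E\<^esub> \<tau>)"
  shows "fc F (Rho D p \<bullet>\<^bsub>D\<^esub> (cid D p \<odot>\<^bsub>D\<^esub> comp_delta k)) \<bullet>\<^bsub>E\<^esub> \<theta> = Rho E (fh F p) \<bullet>\<^bsub>E\<^esub> (cid E (fh F p) \<odot>\<^bsub>E\<^esub> comp_delta k')"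
    and "is_iso (Hor E) \<theta>"
proof -
  have fF: "fv F f \<in> Arr (Ver E)" using assms(2) by simp
  note k0 = dom.is_companionD[OF assms(1,2)] and k0' = cod.is_companionD[OF assms(3) fF] and f = assms(2,6,7)
  note t = cod.globular_simps[OF assms(4) k0'(1)]
  note k = k0 k0' f t
  let ?q = "comp_hor k" and ?q' = "comp_hor k'" and ?x = "Src (Ver D) f" and ?y = "Tgt (Ver D) f"
  let ?Z = "Rho D p \<bullet>\<^bsub>D\<^esub> (cid D p \<odot>\<^bsub>D\<^esub> comp_delta k)" and ?Z' = "Rho E (fh F p) \<bullet>\<^bsub>E\<^esub> (cid E (fh F p) \<odot>\<^bsub>E\<^esub> comp_delta k')"
  have "fc F ?Z \<bullet>\<^bsub>E\<^esub> \<theta> = fc F (Rho D p) \<bullet>\<^bsub>E\<^esub> ((fc F (cid D p \<odot>\<^bsub>D\<^esub> comp_delta k) \<bullet>\<^bsub>E\<^esub> fm F p ?q) \<bullet>\<^bsub>E\<^esub> (cid E (fh F p) \<odot>\<^bsub>E\<^esub> \<tau>))"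
    unfolding \<theta>_def by (simp add: k fc_Cmp cod.cassoc)
  also have "\<dots> = fc F (Rho D p) \<bullet>\<^bsub>E\<^esub> ((fm F p (hunit D ?y) \<bullet>\<^bsub>E\<^esub> (cid E (fh F p) \<odot>\<^bsub>E\<^esub> fc F (comp_delta k))) \<bullet>\<^bsub>E\<^esub> (cid E (fh F p) \<odot>\<^bsub>E\<^esub> \<tau>))"
    using fm_nat[of "comp_delta k" "cid D p" "hunit D ?y" p] by (simp add: k)
  also have "\<dots> = fc F (Rho D p) \<bullet>\<^bsub>E\<^esub> (fm F p (hunit D ?y) \<bullet>\<^bsub>E\<^esub> (cid E (fh F p) \<odot>\<^bsub>E\<^esub> (fc F (comp_delta k) \<bullet>\<^bsub>E\<^esub> \<tau>)))"
    by (simp add: k cod.cassoc cod.ccmp_merge)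
  also have "\<dots> = fc F (Rho D p) \<bullet>\<^bsub>E\<^esub> (fm F p (hunit D ?y) \<bullet>\<^bsub>E\<^esub> ((cid E (fh F p) \<odot>\<^bsub>E\<^esub> fe F ?y) \<bullet>\<^bsub>E\<^esub> (cid E (fh F p) \<odot>\<^bsub>E\<^esub> comp_delta k')))"
    using companion_comparison_delta[OF assms(1-5)] by (simp add: k cod.ccmp_merge)
  also have "\<dots> = ?Z'"
    using fm_unit_right[of p] by (simp add: k cod.cassoc[symmetric])
  finally show Z: "fc F ?Z \<bullet>\<^bsub>E\<^esub> \<theta> = ?Z'" .
  \<comment> \<open>The lift of the image of \<open>?Z\<close> through \<open>?Z'\<close>, as
    constructed in \<open>companion_whisker_lift\<close> with \<open>h\<close> an identity.\<close>
  let ?i = "(fc F ?Z \<odot>\<^bsub>E\<^esub> comp_nu k') \<bullet>\<^bsub>E\<^esub> cod.RhoI (fh F (p \<cdot>\<^bsub>D\<^esub> ?q))"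
  have th: "\<theta> \<in> Arr (Hor E)" "Src (Hor E) \<theta> = fh F p \<cdot>\<^bsub>E\<^esub> ?q'" "Tgt (Hor E) \<theta> = fh F (p \<cdot>\<^bsub>D\<^esub> ?q)"
    "cdom E \<theta> = vid E (fo F ?x)" "ccod E \<theta> = vid E (fo F (hcod D p))"
    unfolding \<theta>_def by (simp_all add: k)
  have z: "?Z \<in> Arr (Hor D)" "Src (Hor D) ?Z = p \<cdot>\<^bsub>D\<^esub> ?q" "Tgt (Hor D) ?Z = p" "cdom D ?Z = f" "ccod D ?Z = vid D (hcod D p)"
    by (simp_all add: k)
  have "?i \<bullet>\<^bsub>E\<^esub> \<theta> = (fc F ?Z \<odot>\<^bsub>E\<^esub> comp_nu k') \<bullet>\<^bsub>E\<^esub> ((\<theta> \<odot>\<^bsub>E\<^esub> cid E (hunit E (fo F ?x))) \<bullet>\<^bsub>E\<^esub> cod.RhoI (fh F p \<cdot>\<^bsub>E\<^esub> ?q'))"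
    using cod.RhoI_nat[of \<theta> "fh F (p \<cdot>\<^bsub>D\<^esub> ?q)"] by (simp add: k th z cod.cassoc del: dom.ccmp_simps dom.hor.Cmp_in)
  also have "\<dots> = (?Z' \<odot>\<^bsub>E\<^esub> comp_nu k') \<bullet>\<^bsub>E\<^esub> cod.RhoI (fh F p \<cdot>\<^bsub>E\<^esub> ?q')"
    using Z by (simp add: k th z cod.ccmp_merge_extend)
  also have "\<dots> = cid E (fh F p \<cdot>\<^bsub>E\<^esub> ?q')"
    using cod.companion_zigzag[OF assms(3) fF, of "fh F p"] by (simp add: k)
  finally have 1: "?i \<bullet>\<^bsub>E\<^esub> \<theta> = cid E (fh F p \<cdot>\<^bsub>E\<^esub> ?q')" .
  have "\<theta> \<bullet>\<^bsub>E\<^esub> ?i = fm F p ?q \<bullet>\<^bsub>E\<^esub> (((fc F ?Z) \<odot>\<^bsub>E\<^esub> (\<tau> \<bullet>\<^bsub>E\<^esub> comp_nu k')) \<bullet>\<^bsub>E\<^esub> cod.RhoI (fh F (p \<cdot>\<^bsub>D\<^esub> ?q)))"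
    unfolding \<theta>_def using z by (simp add: k cod.cassoc cod.ccmp_merge_extend)
  also have "\<dots> = fm F p ?q \<bullet>\<^bsub>E\<^esub> ((((fc F ?Z) \<odot>\<^bsub>E\<^esub> fc F (comp_nu k)) \<bullet>\<^bsub>E\<^esub> (cid E (fh F (p \<cdot>\<^bsub>D\<^esub> ?q)) \<odot>\<^bsub>E\<^esub> fe F ?x)) \<bullet>\<^bsub>E\<^esub> cod.RhoI (fh F (p \<cdot>\<^bsub>D\<^esub> ?q)))"
    using z by (simp add: k cod.ccmp_merge assms(5))
  also have "\<dots> = (fm F p ?q \<bullet>\<^bsub>E\<^esub> ((fc F ?Z) \<odot>\<^bsub>E\<^esub> fc F (comp_nu k))) \<bullet>\<^bsub>E\<^esub> ((cid E (fh F (p \<cdot>\<^bsub>D\<^esub> ?q)) \<odot>\<^bsub>E\<^esub> fe F ?x) \<bullet>\<^bsub>E\<^esub> cod.RhoI (fh F (p \<cdot>\<^bsub>D\<^esub> ?q)))"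
    using z by (simp add: k cod.cassoc)
  also have "\<dots> = fc F (?Z \<odot>\<^bsub>D\<^esub> comp_nu k) \<bullet>\<^bsub>E\<^esub> (fm F (p \<cdot>\<^bsub>D\<^esub> ?q) (hunit D ?x) \<bullet>\<^bsub>E\<^esub> ((cid E (fh F (p \<cdot>\<^bsub>D\<^esub> ?q)) \<odot>\<^bsub>E\<^esub> fe F ?x) \<bullet>\<^bsub>E\<^esub> cod.RhoI (fh F (p \<cdot>\<^bsub>D\<^esub> ?q))))"
    using z fm_nat[of "comp_nu k" ?Z ?q p] by (simp add: k cod.cassoc)
  also have "\<dots> = fc F (Rho D (p \<cdot>\<^bsub>D\<^esub> ?q)) \<bullet>\<^bsub>E\<^esub> (fm F (p \<cdot>\<^bsub>D\<^esub> ?q) (hunit D ?x) \<bullet>\<^bsub>E\<^esub> ((cid E (fh F (p \<cdot>\<^bsub>D\<^esub> ?q)) \<odot>\<^bsub>E\<^esub> fe F ?x) \<bullet>\<^bsub>E\<^esub> cod.RhoI (fh F (p \<cdot>\<^bsub>D\<^esub> ?q))))"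
    using dom.companion_zigzag[OF assms(1,2,6,7)] by simp
  also have "\<dots> = Rho E (fh F (p \<cdot>\<^bsub>D\<^esub> ?q)) \<bullet>\<^bsub>E\<^esub> cod.RhoI (fh F (p \<cdot>\<^bsub>D\<^esub> ?q))"
    by (simp add: k fm_unit_right_extend)
  finally have "\<theta> \<bullet>\<^bsub>E\<^esub> ?i = cid E (fh F (p \<cdot>\<^bsub>D\<^esub> ?q))"
    by (simp add: k)
  with 1 have "inverse_arrows (Hor E) \<theta> ?i"
    unfolding inverse_arrows_def using th z by (simp add: k)
  then show "is_iso (Hor E) \<theta>" unfolding is_iso_def by blast
qed

text \<open>Only the image of \<open>f\<close> is assumed invertible, so the inverse has to be built
  in \<open>E\<close>: a section of the image of \<delta>, relative to the unit constraint, is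
  tensored onto \<open>fh F p\<close> and composed with the lax constraint.\<close>

lemma companion_restriction_is_iso:
  assumes "is_companion D f k" "f \<in> Arr (Ver D)" "is_iso (Ver E) (fv F f)"
    and "p \<in> Obj (Hor D)" "hdom D p = Tgt (Ver D) f"
  shows "is_iso (Hor E) (fc F (Rho D p \<bullet>\<^bsub>D\<^esub> (cid D p \<odot>\<^bsub>D\<^esub> comp_delta k)))"
proof -
  define h where "h = inverse_in (Ver E) (fv F f)"
  let ?q = "comp_hor k" and ?x = "Src (Ver D) f" and ?y = "Tgt (Ver D) f"
  have h: "h \<in> Arr (Ver E)" "Src (Ver E) h = fo F ?y" "Tgt (Ver E) h = fo F ?x"
    "h \<circ>\<^bsub>E\<^esub> fv F f = vid E (fo F ?x)" "fv F f \<circ>\<^bsub>E\<^esub> h = vid E (fo F ?y)"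
    using cod.ver.inverse_in_simps[OF assms(3)] assms(2) unfolding h_def by simp_all
  note k = dom.is_companionD[OF assms(1,2)] h assms(2,4,5)
  let ?Z = "Rho D p \<bullet>\<^bsub>D\<^esub> (cid D p \<odot>\<^bsub>D\<^esub> comp_delta k)"
  have z: "?Z \<in> Arr (Hor D)" "Src (Hor D) ?Z = p \<cdot>\<^bsub>D\<^esub> ?q" "Tgt (Hor D) ?Z = p" "cdom D ?Z = f" "ccod D ?Z = vid D (hcod D p)"
    by (simp_all add: k)
  \<comment> \<open>The inverse \<open>h\<close> of Ff turns F\<nu> into this section: as \<delta> o
    \<nu> = \<open>1\<^sub>f\<close>, composing with F\<delta> leaves exactly
    \<open>fe F ?y\<close>.\<close>
  let ?c = "fc F (comp_nu k) \<bullet>\<^bsub>E\<^esub> (fe F ?x \<bullet>\<^bsub>E\<^esub> cunit E h)"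
  let ?i = "fm F p ?q \<bullet>\<^bsub>E\<^esub> ((cid E (fh F p) \<odot>\<^bsub>E\<^esub> ?c) \<bullet>\<^bsub>E\<^esub> cod.RhoI (fh F p))"
  have c1: "fc F (comp_delta k) \<bullet>\<^bsub>E\<^esub> ?c = fe F ?y"
  proof -
    have "fc F (comp_delta k) \<bullet>\<^bsub>E\<^esub> ?c = (fc F (cunit D f) \<bullet>\<^bsub>E\<^esub> fe F ?x) \<bullet>\<^bsub>E\<^esub> cunit E h"
      by (simp add: k cod.cassoc[symmetric] fc_Cmp[symmetric])
    also have "\<dots> = fe F ?y"
      using fe_natural[OF assms(2), symmetric] by (simp add: k cod.cassoc)
    finally show ?thesis .
  qed
  have "fc F ?Z \<bullet>\<^bsub>E\<^esub> ?i = fc F (Rho D p) \<bullet>\<^bsub>E\<^esub> ((fc F (cid D p \<odot>\<^bsub>D\<^esub> comp_delta k) \<bullet>\<^bsub>E\<^esub> fm F p ?q) \<bullet>\<^bsub>E\<^esub> ((cid E (fh F p) \<odot>\<^bsub>E\<^esub> ?c) \<bullet>\<^bsub>E\<^esub> cod.RhoI (fh F p)))"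
    by (simp add: k fc_Cmp cod.cassoc)
  also have "\<dots> = fc F (Rho D p) \<bullet>\<^bsub>E\<^esub> (fm F p (hunit D ?y) \<bullet>\<^bsub>E\<^esub> ((cid E (fh F p) \<odot>\<^bsub>E\<^esub> (fc F (comp_delta k) \<bullet>\<^bsub>E\<^esub> ?c)) \<bullet>\<^bsub>E\<^esub> cod.RhoI (fh F p)))"
    using fm_nat[of "comp_delta k" "cid D p" "hunit D ?y" p, symmetric] by (simp add: k cod.cassoc cod.ccmp_merge_extend)
  also have "\<dots> = Rho E (fh F p) \<bullet>\<^bsub>E\<^esub> cod.RhoI (fh F p)"
    unfolding c1 by (simp add: k fm_unit_right_extend)
  finally have 1: "fc F ?Z \<bullet>\<^bsub>E\<^esub> ?i = cid E (fh F p)" by (simp add: k)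
  \<comment> \<open>In the other composite, interchange moves the image of \<open>?Z\<close> past
    \<open>?c\<close>, where \<open>h\<close> cancels against Ff; the zigzag in \<open>D\<close> and
    the unit coherence of \<open>F\<close> remain.\<close>
  have "?i \<bullet>\<^bsub>E\<^esub> fc F ?Z = fm F p ?q \<bullet>\<^bsub>E\<^esub> (((cid E (fh F p) \<odot>\<^bsub>E\<^esub> ?c) \<bullet>\<^bsub>E\<^esub> (fc F ?Z \<odot>\<^bsub>E\<^esub> cunit E (fv F f))) \<bullet>\<^bsub>E\<^esub> cod.RhoI (fh F (p \<cdot>\<^bsub>D\<^esub> ?q)))"
    using z cod.RhoI_nat[of "fc F ?Z" "fh F p"] by (simp add: k cod.cassoc)
  also have "(cid E (fh F p) \<odot>\<^bsub>E\<^esub> ?c) \<bullet>\<^bsub>E\<^esub> (fc F ?Z \<odot>\<^bsub>E\<^esub> cunit E (fv F f))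
      = (fc F ?Z \<odot>\<^bsub>E\<^esub> fc F (comp_nu k)) \<bullet>\<^bsub>E\<^esub> (cid E (fh F (p \<cdot>\<^bsub>D\<^esub> ?q)) \<odot>\<^bsub>E\<^esub> fe F ?x)"
    using z by (simp add: k cod.ccmp_merge cod.cassoc)
  also have "fm F p ?q \<bullet>\<^bsub>E\<^esub> (\<dots> \<bullet>\<^bsub>E\<^esub> cod.RhoI (fh F (p \<cdot>\<^bsub>D\<^esub> ?q))) = (fm F p ?q \<bullet>\<^bsub>E\<^esub> (fc F ?Z \<odot>\<^bsub>E\<^esub> fc F (comp_nu k))) \<bullet>\<^bsub>E\<^esub> ((cid E (fh F (p \<cdot>\<^bsub>D\<^esub> ?q)) \<odot>\<^bsub>E\<^esub> fe F ?x) \<bullet>\<^bsub>E\<^esub> cod.RhoI (fh F (p \<cdot>\<^bsub>D\<^esub> ?q)))"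
    using z by (simp add: k cod.cassoc)
  also have "\<dots> = fc F (?Z \<odot>\<^bsub>D\<^esub> comp_nu k) \<bullet>\<^bsub>E\<^esub> (fm F (p \<cdot>\<^bsub>D\<^esub> ?q) (hunit D ?x) \<bullet>\<^bsub>E\<^esub> ((cid E (fh F (p \<cdot>\<^bsub>D\<^esub> ?q)) \<odot>\<^bsub>E\<^esub> fe F ?x) \<bullet>\<^bsub>E\<^esub> cod.RhoI (fh F (p \<cdot>\<^bsub>D\<^esub> ?q))))"
    using z fm_nat[of "comp_nu k" ?Z ?q p] by (simp add: k cod.cassoc)
  also have "\<dots> = fc F (Rho D (p \<cdot>\<^bsub>D\<^esub> ?q)) \<bullet>\<^bsub>E\<^esub> (fm F (p \<cdot>\<^bsub>D\<^esub> ?q) (hunit D ?x) \<bullet>\<^bsub>E\<^esub> ((cid E (fh F (p \<cdot>\<^bsub>D\<^esub> ?q)) \<odot>\<^bsub>E\<^esub> fe F ?x) \<bullet>\<^bsub>E\<^esub> cod.RhoI (fh F (p \<cdot>\<^bsub>D\<^esub> ?q))))"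
    using dom.companion_zigzag[OF assms(1,2,4,5)] by simp
  also have "\<dots> = Rho E (fh F (p \<cdot>\<^bsub>D\<^esub> ?q)) \<bullet>\<^bsub>E\<^esub> cod.RhoI (fh F (p \<cdot>\<^bsub>D\<^esub> ?q))"
    by (simp add: k fm_unit_right_extend)
  finally have "?i \<bullet>\<^bsub>E\<^esub> fc F ?Z = cid E (fh F (p \<cdot>\<^bsub>D\<^esub> ?q))"
    by (simp add: k)
  with 1 have "inverse_arrows (Hor E) (fc F ?Z) ?i"
    unfolding inverse_arrows_def using z by (simp add: k)
  then show ?thesis unfolding is_iso_def by blast
qed

end

context vertical_transformation begin

lemma vt_simps [simp]:
  "x \<in> Obj (Ver D) \<Longrightarrow> t0 \<phi> x \<in> Arr (Ver E)"
  "x \<in> Obj (Ver D) \<Longrightarrow> Src (Ver E) (t0 \<phi> x) = fo F x"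
  "x \<in> Obj (Ver D) \<Longrightarrow> Tgt (Ver E) (t0 \<phi> x) = fo G x"
  "r \<in> Obj (Hor D) \<Longrightarrow> t1 \<phi> r \<in> Arr (Hor E)"
  "r \<in> Obj (Hor D) \<Longrightarrow> Src (Hor E) (t1 \<phi> r) = fh F r"
  "r \<in> Obj (Hor D) \<Longrightarrow> Tgt (Hor E) (t1 \<phi> r) = fh G r"
  "r \<in> Obj (Hor D) \<Longrightarrow> cdom E (t1 \<phi> r) = t0 \<phi> (hdom D r)"
  "r \<in> Obj (Hor D) \<Longrightarrow> ccod E (t1 \<phi> r) = t0 \<phi> (hcod D r)"
  using t0_arrow t1_cell unfolding cell_def by auto

end

section \<open>Transport of algebra structures\<close>

locale lax_monad = T: lax_functor E E "mfun T"
  + mul: vertical_transformation E E "lax_comp E (mfun T) (mfun T)" "mfun T" "mmul T"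
  + uni: vertical_transformation E E "lax_id E" "mfun T" "muni T"
  for E :: "('p, 'w, 'k, 'd) dbl" and T :: "('p, 'w, 'k, 'd) mnd"
begin

lemma hlax_algebraD:
  assumes "is_hlax_algebra E T (x, a, \<upsilon>, \<mu>)"
  shows "x \<in> Obj (Ver E)" "a \<in> Obj (Hor E)" "hdom E a = fo (mfun T) x" "hcod E a = x"
    "\<upsilon> \<in> Arr (Hor E)" "Src (Hor E) \<upsilon> = hunit E x" "Tgt (Hor E) \<upsilon> = a" "cdom E \<upsilon> = t0 (muni T) x" "ccod E \<upsilon> = vid E x"
    "\<mu> \<in> Arr (Hor E)" "Src (Hor E) \<mu> = a \<cdot>\<^bsub>E\<^esub> fh (mfun T) a" "Tgt (Hor E) \<mu> = a" "cdom E \<mu> = t0 (mmul T) x"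
    "ccod E \<mu> = vid E x"
    "\<mu> \<bullet>\<^bsub>E\<^esub> (\<upsilon> \<odot>\<^bsub>E\<^esub> t1 (muni T) a) = Lam E a"
    "\<mu> \<bullet>\<^bsub>E\<^esub> (cid E a \<odot>\<^bsub>E\<^esub> (fc (mfun T) \<upsilon> \<bullet>\<^bsub>E\<^esub> fe (mfun T) x)) = Rho E a"
    "\<mu> \<bullet>\<^bsub>E\<^esub> (cid E a \<odot>\<^bsub>E\<^esub> (fc (mfun T) \<mu> \<bullet>\<^bsub>E\<^esub> fm (mfun T) a (fh (mfun T) a)))
      = \<mu> \<bullet>\<^bsub>E\<^esub> ((\<mu> \<odot>\<^bsub>E\<^esub> t1 (mmul T) a) \<bullet>\<^bsub>E\<^esub> T.dom.AlpI a (fh (mfun T) a) (fh (mfun T) (fh (mfun T) a)))"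
  using assms unfolding is_hlax_algebra_def cell_def by (simp_all add: Let_def)

lemma uni_naturality:
  "f \<in> Arr (Ver E) \<Longrightarrow> t0 (muni T) (Tgt (Ver E) f) \<circ>\<^bsub>E\<^esub> f = fv (mfun T) f \<circ>\<^bsub>E\<^esub> t0 (muni T) (Src (Ver E) f)"
  "\<beta> \<in> Arr (Hor E) \<Longrightarrow> t1 (muni T) (Tgt (Hor E) \<beta>) \<bullet>\<^bsub>E\<^esub> \<beta> = fc (mfun T) \<beta> \<bullet>\<^bsub>E\<^esub> t1 (muni T) (Src (Hor E) \<beta>)"
  using uni.t0_natural[of f] uni.t1_natural[of \<beta>] by simp_all

lemma mul_naturality:
  "f \<in> Arr (Ver E) \<Longrightarrow> t0 (mmul T) (Tgt (Ver E) f) \<circ>\<^bsub>E\<^esub> fv (mfun T) (fv (mfun T) f)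
     = fv (mfun T) f \<circ>\<^bsub>E\<^esub> t0 (mmul T) (Src (Ver E) f)"
  "\<beta> \<in> Arr (Hor E) \<Longrightarrow> t1 (mmul T) (Tgt (Hor E) \<beta>) \<bullet>\<^bsub>E\<^esub> fc (mfun T) (fc (mfun T) \<beta>)
     = fc (mfun T) \<beta> \<bullet>\<^bsub>E\<^esub> t1 (mmul T) (Src (Hor E) \<beta>)"
  using mul.t0_natural[of f] mul.t1_natural[of \<beta>] by simp_all

text \<open>After composition with \<zeta>, the equations \<open>zu\<close>, \<open>zm\<close> and
  naturality of the monad unit, the monad multiplication and the lax constraints turn each law over
  \<open>a\<close> into the corresponding law over \<open>b\<close>.\<close>

lemma hlax_algebra_transport:
  assumes "is_hlax_algebra E T (y, b, \<upsilon>, \<mu>)"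
    and "is_iso (Ver E) f" "Src (Ver E) f = x" "Tgt (Ver E) f = y"
    and "cell E a b (fv (mfun T) f) f \<zeta>" "is_iso (Hor E) \<zeta>"
    and "cell E (hunit E x) a (t0 (muni T) x) (vid E x) \<upsilon>'"
    and "cell E (a \<cdot>\<^bsub>E\<^esub> fh (mfun T) a) a (t0 (mmul T) x) (vid E x) \<mu>'"
    and zu: "\<zeta> \<bullet>\<^bsub>E\<^esub> \<upsilon>' = \<upsilon> \<bullet>\<^bsub>E\<^esub> cunit E f" and zm: "\<zeta> \<bullet>\<^bsub>E\<^esub> \<mu>' = \<mu> \<bullet>\<^bsub>E\<^esub> (\<zeta> \<odot>\<^bsub>E\<^esub> fc (mfun T) \<zeta>)"
  shows "is_hlax_algebra E T (x, a, \<upsilon>', \<mu>')"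
proof -
  have f: "f \<in> Arr (Ver E)" using assms(2) by (rule T.dom.ver.is_iso_Arr)
  have x: "x \<in> Obj (Ver E)" using T.dom.ver.Src_in[OF f] assms(3) by simp
  have a: "hdom E a = fo (mfun T) x" "hcod E a = x"
    using T.dom.cellD(10,12)[OF assms(5)] f assms(3) by auto
  have fe: "t0 (muni T) y \<circ>\<^bsub>E\<^esub> f = fv (mfun T) f \<circ>\<^bsub>E\<^esub> t0 (muni T) x"
    "t0 (mmul T) y \<circ>\<^bsub>E\<^esub> fv (mfun T) (fv (mfun T) f) = fv (mfun T) f \<circ>\<^bsub>E\<^esub> t0 (mmul T) x"
    using uni_naturality(1)[OF f] mul_naturality(1)[OF f] assms(3,4) by simp_all
  note b = hlax_algebraD(1-14)[OF assms(1)]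
  note b15 = hlax_algebraD(15)[OF assms(1)] and b16 = hlax_algebraD(16)[OF assms(1)] and b17 = hlax_algebraD(17)[OF assms(1)]
  note z = T.dom.cellD(1-7)[OF assms(5)] and u = T.dom.cellD(1-5)[OF assms(7)] and m = T.dom.cellD(1-5)[OF assms(8)]
  note k = b z u m a f assms(3,4) fe x
  let ?T = "fc (mfun T)" and ?Ta = "fh (mfun T) a" and ?TTa = "fh (mfun T) (fh (mfun T) a)"
  let ?Tb = "fh (mfun T) b" and ?TTb = "fh (mfun T) (fh (mfun T) b)"
  have cancel: "\<alpha> = \<beta>" if "\<alpha> \<in> Arr (Hor E)" "\<beta> \<in> Arr (Hor E)" "Tgt (Hor E) \<alpha> = a" "Tgt (Hor E) \<beta> = a"
    "\<zeta> \<bullet>\<^bsub>E\<^esub> \<alpha> = \<zeta> \<bullet>\<^bsub>E\<^esub> \<beta>" for \<alpha> \<beta>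
    using T.dom.hor.Cmp_left_cancel[OF assms(6) that(1,2)] that z by simp
  have "\<zeta> \<bullet>\<^bsub>E\<^esub> (\<mu>' \<bullet>\<^bsub>E\<^esub> (\<upsilon>' \<odot>\<^bsub>E\<^esub> t1 (muni T) a)) = (\<mu> \<bullet>\<^bsub>E\<^esub> (\<zeta> \<odot>\<^bsub>E\<^esub> ?T \<zeta>)) \<bullet>\<^bsub>E\<^esub> (\<upsilon>' \<odot>\<^bsub>E\<^esub> t1 (muni T) a)"
    by (simp add: k T.dom.cassoc flip: zm)
  also have "\<dots> = \<mu> \<bullet>\<^bsub>E\<^esub> ((\<zeta> \<bullet>\<^bsub>E\<^esub> \<upsilon>') \<odot>\<^bsub>E\<^esub> (?T \<zeta> \<bullet>\<^bsub>E\<^esub> t1 (muni T) a))"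
    by (simp add: k T.dom.cassoc T.dom.ccmp_merge)
  also have "\<dots> = \<mu> \<bullet>\<^bsub>E\<^esub> ((\<upsilon> \<bullet>\<^bsub>E\<^esub> cunit E f) \<odot>\<^bsub>E\<^esub> (t1 (muni T) b \<bullet>\<^bsub>E\<^esub> \<zeta>))"
    using uni_naturality(2)[OF z(1)] by (simp add: k zu)
  also have "\<dots> = (\<mu> \<bullet>\<^bsub>E\<^esub> (\<upsilon> \<odot>\<^bsub>E\<^esub> t1 (muni T) b)) \<bullet>\<^bsub>E\<^esub> (cunit E f \<odot>\<^bsub>E\<^esub> \<zeta>)"
    by (simp add: k T.dom.cassoc T.dom.ccmp_merge)
  also have "\<dots> = \<zeta> \<bullet>\<^bsub>E\<^esub> Lam E a"
    using T.dom.Lam_nat[of \<zeta> b f] by (simp add: k b15)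
  finally have 1: "\<mu>' \<bullet>\<^bsub>E\<^esub> (\<upsilon>' \<odot>\<^bsub>E\<^esub> t1 (muni T) a) = Lam E a"
    by - (rule cancel, simp_all add: k)
  have "\<zeta> \<bullet>\<^bsub>E\<^esub> (\<mu>' \<bullet>\<^bsub>E\<^esub> (cid E a \<odot>\<^bsub>E\<^esub> (?T \<upsilon>' \<bullet>\<^bsub>E\<^esub> fe (mfun T) x)))
      = (\<mu> \<bullet>\<^bsub>E\<^esub> (\<zeta> \<odot>\<^bsub>E\<^esub> ?T \<zeta>)) \<bullet>\<^bsub>E\<^esub> (cid E a \<odot>\<^bsub>E\<^esub> (?T \<upsilon>' \<bullet>\<^bsub>E\<^esub> fe (mfun T) x))"
    by (simp add: k T.dom.cassoc flip: zm)
  also have "\<dots> = \<mu> \<bullet>\<^bsub>E\<^esub> (\<zeta> \<odot>\<^bsub>E\<^esub> (?T (\<zeta> \<bullet>\<^bsub>E\<^esub> \<upsilon>') \<bullet>\<^bsub>E\<^esub> fe (mfun T) x))"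
    by (simp add: k T.dom.cassoc T.dom.ccmp_merge T.fc_Cmp)
  also have "\<dots> = \<mu> \<bullet>\<^bsub>E\<^esub> (\<zeta> \<odot>\<^bsub>E\<^esub> (?T \<upsilon> \<bullet>\<^bsub>E\<^esub> (?T (cunit E f) \<bullet>\<^bsub>E\<^esub> fe (mfun T) x)))"
    by (simp add: k zu T.fc_Cmp T.dom.cassoc)
  also have "\<dots> = \<mu> \<bullet>\<^bsub>E\<^esub> (\<zeta> \<odot>\<^bsub>E\<^esub> (?T \<upsilon> \<bullet>\<^bsub>E\<^esub> (fe (mfun T) y \<bullet>\<^bsub>E\<^esub> cunit E (fv (mfun T) f))))"
    using T.fe_natural[OF f] by (simp add: k)
  also have "\<dots> = (\<mu> \<bullet>\<^bsub>E\<^esub> (cid E b \<odot>\<^bsub>E\<^esub> (?T \<upsilon> \<bullet>\<^bsub>E\<^esub> fe (mfun T) y))) \<bullet>\<^bsub>E\<^esub> (\<zeta> \<odot>\<^bsub>E\<^esub> cunit E (fv (mfun T) f))"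
    by (simp add: k T.dom.cassoc T.dom.ccmp_merge)
  also have "\<dots> = \<zeta> \<bullet>\<^bsub>E\<^esub> Rho E a"
    using T.dom.Rho_nat[of \<zeta> b "fv (mfun T) f"] by (simp add: k b16)
  finally have 2: "\<mu>' \<bullet>\<^bsub>E\<^esub> (cid E a \<odot>\<^bsub>E\<^esub> (?T \<upsilon>' \<bullet>\<^bsub>E\<^esub> fe (mfun T) x)) = Rho E a"
    by - (rule cancel, simp_all add: k)
  \<comment> \<open>For associativity, naturality of the lax constraint and of the associator moves
    \<zeta>, T\<zeta> and TT\<zeta> past the law over \<open>b\<close>; naturality of the monad
    multiplication restores the form required over \<open>a\<close>.\<close>
  have "\<zeta> \<bullet>\<^bsub>E\<^esub> (\<mu>' \<bullet>\<^bsub>E\<^esub> (cid E a \<odot>\<^bsub>E\<^esub> (?T \<mu>' \<bullet>\<^bsub>E\<^esub> fm (mfun T) a ?Ta)))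
      = (\<mu> \<bullet>\<^bsub>E\<^esub> (\<zeta> \<odot>\<^bsub>E\<^esub> ?T \<zeta>)) \<bullet>\<^bsub>E\<^esub> (cid E a \<odot>\<^bsub>E\<^esub> (?T \<mu>' \<bullet>\<^bsub>E\<^esub> fm (mfun T) a ?Ta))"
    by (simp add: k T.dom.cassoc flip: zm)
  also have "\<dots> = \<mu> \<bullet>\<^bsub>E\<^esub> (\<zeta> \<odot>\<^bsub>E\<^esub> (?T (\<zeta> \<bullet>\<^bsub>E\<^esub> \<mu>') \<bullet>\<^bsub>E\<^esub> fm (mfun T) a ?Ta))"
    by (simp add: k T.dom.cassoc T.dom.ccmp_merge T.fc_Cmp)
  also have "\<dots> = \<mu> \<bullet>\<^bsub>E\<^esub> (\<zeta> \<odot>\<^bsub>E\<^esub> (?T \<mu> \<bullet>\<^bsub>E\<^esub> (?T (\<zeta> \<odot>\<^bsub>E\<^esub> ?T \<zeta>) \<bullet>\<^bsub>E\<^esub> fm (mfun T) a ?Ta)))"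
    by (simp add: k zm T.fc_Cmp T.dom.cassoc)
  also have "\<dots> = \<mu> \<bullet>\<^bsub>E\<^esub> (\<zeta> \<odot>\<^bsub>E\<^esub> (?T \<mu> \<bullet>\<^bsub>E\<^esub> (fm (mfun T) b ?Tb \<bullet>\<^bsub>E\<^esub> (?T \<zeta> \<odot>\<^bsub>E\<^esub> ?T (?T \<zeta>)))))"
    using T.fm_nat[of "?T \<zeta>" \<zeta> ?Tb b] by (simp add: k)
  also have "\<dots> = (\<mu> \<bullet>\<^bsub>E\<^esub> (cid E b \<odot>\<^bsub>E\<^esub> (?T \<mu> \<bullet>\<^bsub>E\<^esub> fm (mfun T) b ?Tb))) \<bullet>\<^bsub>E\<^esub> (\<zeta> \<odot>\<^bsub>E\<^esub> (?T \<zeta> \<odot>\<^bsub>E\<^esub> ?T (?T \<zeta>)))"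
    by (simp add: k T.dom.cassoc T.dom.ccmp_merge)
  also have "\<dots> = \<mu> \<bullet>\<^bsub>E\<^esub> ((\<mu> \<odot>\<^bsub>E\<^esub> t1 (mmul T) b) \<bullet>\<^bsub>E\<^esub> (T.dom.AlpI b ?Tb ?TTb \<bullet>\<^bsub>E\<^esub> (\<zeta> \<odot>\<^bsub>E\<^esub> (?T \<zeta> \<odot>\<^bsub>E\<^esub> ?T (?T \<zeta>)))))"
    unfolding b17 by (simp add: k T.dom.cassoc)
  also have "\<dots> = \<mu> \<bullet>\<^bsub>E\<^esub> (((\<mu> \<bullet>\<^bsub>E\<^esub> (\<zeta> \<odot>\<^bsub>E\<^esub> ?T \<zeta>)) \<odot>\<^bsub>E\<^esub> (t1 (mmul T) b \<bullet>\<^bsub>E\<^esub> ?T (?T \<zeta>))) \<bullet>\<^bsub>E\<^esub> T.dom.AlpI a ?Ta ?TTa)"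
    using T.dom.AlpI_nat[of "?T (?T \<zeta>)" "?T \<zeta>" \<zeta> ?TTb ?Tb b] by (simp add: k T.dom.ccmp_merge_extend)
  also have "\<dots> = \<mu> \<bullet>\<^bsub>E\<^esub> (((\<zeta> \<bullet>\<^bsub>E\<^esub> \<mu>') \<odot>\<^bsub>E\<^esub> (?T \<zeta> \<bullet>\<^bsub>E\<^esub> t1 (mmul T) a)) \<bullet>\<^bsub>E\<^esub> T.dom.AlpI a ?Ta ?TTa)"
    using mul_naturality(2)[OF z(1)] by (simp add: k zm)
  also have "\<dots> = (\<mu> \<bullet>\<^bsub>E\<^esub> (\<zeta> \<odot>\<^bsub>E\<^esub> ?T \<zeta>)) \<bullet>\<^bsub>E\<^esub> ((\<mu>' \<odot>\<^bsub>E\<^esub> t1 (mmul T) a) \<bullet>\<^bsub>E\<^esub> T.dom.AlpI a ?Ta ?TTa)"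
    by (simp add: k T.dom.cassoc T.dom.ccmp_merge_extend)
  also have "\<dots> = \<zeta> \<bullet>\<^bsub>E\<^esub> (\<mu>' \<bullet>\<^bsub>E\<^esub> ((\<mu>' \<odot>\<^bsub>E\<^esub> t1 (mmul T) a) \<bullet>\<^bsub>E\<^esub> T.dom.AlpI a ?Ta ?TTa))"
    by (simp add: k T.dom.cassoc flip: zm)
  finally have 3: "\<mu>' \<bullet>\<^bsub>E\<^esub> (cid E a \<odot>\<^bsub>E\<^esub> (?T \<mu>' \<bullet>\<^bsub>E\<^esub> fm (mfun T) a ?Ta)) = \<mu>' \<bullet>\<^bsub>E\<^esub> ((\<mu>' \<odot>\<^bsub>E\<^esub> t1 (mmul T) a) \<bullet>\<^bsub>E\<^esub> T.dom.AlpI a ?Ta ?TTa)"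
    by - (rule cancel, simp_all add: k)
  show ?thesis
    using 1 2 3 assms(7,8) a x z unfolding is_hlax_algebra_def by (simp add: Let_def)
qed

text \<open>The inverse of \<zeta> is again a morphism of algebras because both compatibility
  equations may be tested after \<zeta>.\<close>

lemma hlax_morphism_is_iso:
  assumes "is_hlax_algebra E T (x, a, \<upsilon>', \<mu>')" "is_hlax_algebra E T (y, b, \<upsilon>, \<mu>)"
    and "is_iso (Ver E) f" "Src (Ver E) f = x" "Tgt (Ver E) f = y"
    and "cell E a b (fv (mfun T) f) f \<zeta>" "is_iso (Hor E) \<zeta>"
    and zu: "\<zeta> \<bullet>\<^bsub>E\<^esub> \<upsilon>' = \<upsilon> \<bullet>\<^bsub>E\<^esub> cunit E f" and zm: "\<zeta> \<bullet>\<^bsub>E\<^esub> \<mu>' = \<mu> \<bullet>\<^bsub>E\<^esub> (\<zeta> \<odot>\<^bsub>E\<^esub> fc (mfun T) \<zeta>)"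
  shows "is_iso (HLaxAlg E T) ((x, a, \<upsilon>', \<mu>'), (f, \<zeta>), (y, b, \<upsilon>, \<mu>))"
proof -
  have f: "f \<in> Arr (Ver E)" using assms(3) by (rule T.dom.ver.is_iso_Arr)
  define h where "h = inverse_in (Ver E) f"
  define \<xi> where "\<xi> = inverse_in (Hor E) \<zeta>"
  have hi: "inverse_arrows (Ver E) f h" and xi: "inverse_arrows (Hor E) \<zeta> \<xi>"
    unfolding h_def \<xi>_def using assms(3,7) by (simp_all add: T.dom.ver.inverse_arrows_inverse_in T.dom.hor.inverse_arrows_inverse_in)
  note b = hlax_algebraD(1-14)[OF assms(2)] and a = hlax_algebraD(1-14)[OF assms(1)]
  note z = T.dom.cellD(1-7)[OF assms(6)]
  have h: "h \<in> Arr (Ver E)" "Src (Ver E) h = y" "Tgt (Ver E) h = x" "h \<circ>\<^bsub>E\<^esub> f = vid E x" "f \<circ>\<^bsub>E\<^esub> h = vid E y"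
    using hi assms(4,5) unfolding inverse_arrows_def by simp_all
  have xx: "\<xi> \<in> Arr (Hor E)" "Src (Hor E) \<xi> = b" "Tgt (Hor E) \<xi> = a" "\<xi> \<bullet>\<^bsub>E\<^esub> \<zeta> = cid E a" "\<zeta> \<bullet>\<^bsub>E\<^esub> \<xi> = cid E b"
    using xi z unfolding inverse_arrows_def by simp_all
  \<comment> \<open>The functors dom and cod preserve inverse pairs, and uniqueness of inverses
    identifies the boundary of \<xi> with \<open>h\<close> and its image under
    \<open>T\<close>.\<close>
  have "inverse_arrows (Ver E) (fv (mfun T) f) (cdom E \<xi>)" "inverse_arrows (Ver E) f (ccod E \<xi>)"
    using T.dom.hor.functor_inverse_arrows[OF T.dom.dom_functor xi] T.dom.hor.functor_inverse_arrows[OF T.dom.cod_functor xi] z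
    by simp_all
  then have bd: "cdom E \<xi> = fv (mfun T) h" "ccod E \<xi> = h"
    using T.dom.ver.inverse_arrows_unique T.fv_inverse_arrows[OF hi] hi by blast+
  note k = a b z h xx bd f assms(4,5)
  have cancel: "\<alpha> = \<beta>" if "\<alpha> \<in> Arr (Hor E)" "\<beta> \<in> Arr (Hor E)" "Tgt (Hor E) \<alpha> = a" "Tgt (Hor E) \<beta> = a"
    "\<zeta> \<bullet>\<^bsub>E\<^esub> \<alpha> = \<zeta> \<bullet>\<^bsub>E\<^esub> \<beta>" for \<alpha> \<beta>
    using T.dom.hor.Cmp_left_cancel[OF assms(7) that(1,2)] that z by simp
  have "\<zeta> \<bullet>\<^bsub>E\<^esub> (\<upsilon>' \<bullet>\<^bsub>E\<^esub> cunit E h) = (\<upsilon> \<bullet>\<^bsub>E\<^esub> cunit E f) \<bullet>\<^bsub>E\<^esub> cunit E h"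
    unfolding zu[symmetric] by (simp add: k T.dom.cassoc)
  also have "\<dots> = \<zeta> \<bullet>\<^bsub>E\<^esub> (\<xi> \<bullet>\<^bsub>E\<^esub> \<upsilon>)"
    by (simp add: k T.dom.cassoc) (simp add: k T.dom.cassoc[symmetric])
  finally have 1: "\<xi> \<bullet>\<^bsub>E\<^esub> \<upsilon> = \<upsilon>' \<bullet>\<^bsub>E\<^esub> cunit E h"
    by - (rule cancel[symmetric], simp_all add: k)
  have "\<zeta> \<bullet>\<^bsub>E\<^esub> (\<mu>' \<bullet>\<^bsub>E\<^esub> (\<xi> \<odot>\<^bsub>E\<^esub> fc (mfun T) \<xi>)) = (\<mu> \<bullet>\<^bsub>E\<^esub> (\<zeta> \<odot>\<^bsub>E\<^esub> fc (mfun T) \<zeta>)) \<bullet>\<^bsub>E\<^esub> (\<xi> \<odot>\<^bsub>E\<^esub> fc (mfun T) \<xi>)"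
    unfolding zm[symmetric] by (simp add: k T.dom.cassoc)
  also have "\<dots> = \<zeta> \<bullet>\<^bsub>E\<^esub> (\<xi> \<bullet>\<^bsub>E\<^esub> \<mu>)"
    by (simp add: k T.dom.cassoc T.dom.ccmp_merge T.fc_Cmp[symmetric]) (simp add: k T.dom.cassoc[symmetric])
  finally have 2: "\<xi> \<bullet>\<^bsub>E\<^esub> \<mu> = \<mu>' \<bullet>\<^bsub>E\<^esub> (\<xi> \<odot>\<^bsub>E\<^esub> fc (mfun T) \<xi>)"
    by - (rule cancel[symmetric], simp_all add: k)
  have "is_hlax_morphism E T (x, a, \<upsilon>', \<mu>') (f, \<zeta>) (y, b, \<upsilon>, \<mu>)"
    using f assms(4-6) zu zm unfolding is_hlax_morphism_def by simp
  moreover have "is_hlax_morphism E T (y, b, \<upsilon>, \<mu>) (h, \<xi>) (x, a, \<upsilon>', \<mu>')"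
    using 1 2 unfolding is_hlax_morphism_def cell_def by (simp add: k)
  ultimately have "inverse_arrows (HLaxAlg E T) ((x, a, \<upsilon>', \<mu>'), (f, \<zeta>), (y, b, \<upsilon>, \<mu>)) ((y, b, \<upsilon>, \<mu>), (h, \<xi>), (x, a, \<upsilon>', \<mu>'))"
    using assms(1,2) unfolding inverse_arrows_def HLaxAlg_def by (simp add: k)
  then show ?thesis unfolding is_iso_def by blast
qed

text \<open>Composition in \<open>HLaxAlg\<close> is componentwise, so the cell of an inverse arrow
  inverts \<zeta>.\<close>

lemma is_iso_HLaxAlg_cell:
  assumes "is_iso (HLaxAlg E T) ((x, a, \<upsilon>', \<mu>'), (f, \<zeta>), (y, b, \<upsilon>, \<mu>))"
  shows "is_iso (Hor E) \<zeta>"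
proof -
  obtain h \<xi> where i: "inverse_arrows (HLaxAlg E T) ((x, a, \<upsilon>', \<mu>'), (f, \<zeta>), (y, b, \<upsilon>, \<mu>)) ((y, b, \<upsilon>, \<mu>), (h, \<xi>), (x, a, \<upsilon>', \<mu>'))"
    using assms unfolding is_iso_def inverse_arrows_def HLaxAlg_def by auto
  then have "cell E a b (fv (mfun T) f) f \<zeta>" "cell E b a (fv (mfun T) h) h \<xi>" "\<xi> \<bullet>\<^bsub>E\<^esub> \<zeta> = cid E a" "\<zeta> \<bullet>\<^bsub>E\<^esub> \<xi> = cid E b"
    unfolding inverse_arrows_def HLaxAlg_def is_hlax_morphism_def by auto
  then have "inverse_arrows (Hor E) \<zeta> \<xi>"
    unfolding inverse_arrows_def cell_def by simp
  then show ?thesis unfolding is_iso_def by blast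
qed

end

section \<open>The algebra \<open>G\<^sub>!(y, b)\<close>\<close>

text \<open>The assumptions \<open>psi_unit\<close> and \<open>psi_mult\<close> are the vertical
  parts of the axioms of a monad lax morphism; they are the boundary equations under which
  \<open>e_comp\<close> and \<open>m_comp\<close> exist as lifts.\<close>

locale lax_morphism_algebra = D: pseudodouble_category D + E: pseudodouble_category E
  + S: lax_monad D S + T: lax_monad E T + G: lax_functor E D G
  + psi: vertical_transformation E D "lax_comp D (mfun S) G" "lax_comp D G (mfun T)" \<psi>
  for D :: "('o, 'v, 'h, 'c) dbl" and E :: "('p, 'w, 'k, 'd) dbl"
    and S :: "('o, 'v, 'h, 'c) mnd" and T :: "('p, 'w, 'k, 'd) mnd"
    and G :: "('p, 'w, 'k, 'd, 'o, 'v, 'h, 'c) laxf" and \<psi> :: "('p, 'k, 'v, 'c) vtr"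
    and cp :: "'v \<Rightarrow> ('h, 'c) comp" and y :: 'p and b :: 'k and \<upsilon> \<mu> :: 'd +
  assumes psi_unit: "x \<in> Obj (Ver E) \<Longrightarrow> t0 \<psi> x \<circ>\<^bsub>D\<^esub> t0 (muni S) (fo G x) = fv G (t0 (muni T) x)"
    and psi_mult: "x \<in> Obj (Ver E) \<Longrightarrow> t0 \<psi> x \<circ>\<^bsub>D\<^esub> t0 (mmul S) (fo G x)
      = fv G (t0 (mmul T) x) \<circ>\<^bsub>D\<^esub> (t0 \<psi> (fo (mfun T) x) \<circ>\<^bsub>D\<^esub> fv (mfun S) (t0 \<psi> x))"
    and cp: "companion_choice D cp"
    and alg: "is_hlax_algebra E T (y, b, \<upsilon>, \<mu>)"
begin

lemmas alg_simps [simp] = T.hlax_algebraD(1-14)[OF alg]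

lemma cp_companion: "f \<in> Arr (Ver D) \<Longrightarrow> is_companion D f (cp f)"
  using cp unfolding companion_choice_def by blast

lemmas cp_simps [simp] = D.is_companionD(1-14)[OF cp_companion]

abbreviation (input) "Gy \<equiv> fo G y"
abbreviation (input) "Ty \<equiv> fo (mfun T) y"
abbreviation (input) "Gb \<equiv> fh G b"
abbreviation (input) "Tb \<equiv> fh (mfun T) b"
abbreviation (input) "\<psi>y \<equiv> t0 \<psi> y"
abbreviation (input) "q \<equiv> comp_hor (cp \<psi>y)"

text \<open>The definite description is justified by the unique lift through a companion, here with
  the monad unit at \<open>Gy\<close> in the role of \<open>h\<close>.\<close>

lemma e_comp_props:
  "cell D (hunit D Gy) q (t0 (muni S) Gy) (fv G (t0 (muni T) y)) (e_comp D T S G \<psi> cp y)"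
  "comp_delta (cp \<psi>y) \<bullet>\<^bsub>D\<^esub> e_comp D T S G \<psi> cp y = cunit D (fv G (t0 (muni T) y))"
proof -
  have "\<exists>!c. cell D (hunit D Gy) q (t0 (muni S) Gy) (fv G (t0 (muni T) y)) c \<and>
      comp_delta (cp \<psi>y) \<bullet>\<^bsub>D\<^esub> c = cunit D (fv G (t0 (muni T) y))"
    by (rule D.companion_lift[OF cp_companion]) (simp_all add: cell_def psi_unit)
  from theI'[OF this] show
    "cell D (hunit D Gy) q (t0 (muni S) Gy) (fv G (t0 (muni T) y)) (e_comp D T S G \<psi> cp y)"
    "comp_delta (cp \<psi>y) \<bullet>\<^bsub>D\<^esub> e_comp D T S G \<psi> cp y = cunit D (fv G (t0 (muni T) y))"
    unfolding e_comp_def Let_def by blast+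
qed

lemma m_comp_props:
  defines "\<psi>T \<equiv> t0 \<psi> Ty" and "\<psi>S \<equiv> fv (mfun S) \<psi>y"
  shows "cell D (comp_hor (cp \<psi>T) \<cdot>\<^bsub>D\<^esub> comp_hor (cp \<psi>S)) q (t0 (mmul S) Gy) (fv G (t0 (mmul T) y)) (m_comp D T S G \<psi> cp y)"
    and "comp_delta (cp \<psi>y) \<bullet>\<^bsub>D\<^esub> m_comp D T S G \<psi> cp y = cunit D (fv G (t0 (mmul T) y)) \<bullet>\<^bsub>D\<^esub>
      (Rho D (hunit D (fo G (fo (mfun T) Ty))) \<bullet>\<^bsub>D\<^esub> (comp_delta (cp \<psi>T) \<odot>\<^bsub>D\<^esub> (cunit D \<psi>T \<bullet>\<^bsub>D\<^esub> comp_delta (cp \<psi>S))))"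
proof -
  have "\<exists>!c. cell D (comp_hor (cp \<psi>T) \<cdot>\<^bsub>D\<^esub> comp_hor (cp \<psi>S)) q (t0 (mmul S) Gy) (fv G (t0 (mmul T) y)) c \<and>
      comp_delta (cp \<psi>y) \<bullet>\<^bsub>D\<^esub> c = cunit D (fv G (t0 (mmul T) y)) \<bullet>\<^bsub>D\<^esub>
      (Rho D (hunit D (fo G (fo (mfun T) Ty))) \<bullet>\<^bsub>D\<^esub> (comp_delta (cp \<psi>T) \<odot>\<^bsub>D\<^esub> (cunit D \<psi>T \<bullet>\<^bsub>D\<^esub> comp_delta (cp \<psi>S))))"
    unfolding \<psi>T_def \<psi>S_def
    by (rule D.companion_lift[OF cp_companion]) (simp_all add: cell_def psi_mult)
  from theI'[OF this] show
    "cell D (comp_hor (cp \<psi>T) \<cdot>\<^bsub>D\<^esub> comp_hor (cp \<psi>S)) q (t0 (mmul S) Gy) (fv G (t0 (mmul T) y)) (m_comp D T S G \<psi> cp y)"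
    "comp_delta (cp \<psi>y) \<bullet>\<^bsub>D\<^esub> m_comp D T S G \<psi> cp y = cunit D (fv G (t0 (mmul T) y)) \<bullet>\<^bsub>D\<^esub>
      (Rho D (hunit D (fo G (fo (mfun T) Ty))) \<bullet>\<^bsub>D\<^esub> (comp_delta (cp \<psi>T) \<odot>\<^bsub>D\<^esub> (cunit D \<psi>T \<bullet>\<^bsub>D\<^esub> comp_delta (cp \<psi>S))))"
    unfolding m_comp_def Let_def \<psi>T_def \<psi>S_def by blast+
qed

lemma n_comp_props:
  defines "n \<equiv> n_comp E D cp (lax_comp D (mfun S) G) (lax_comp D G (mfun T)) \<psi> b"
  shows "globular D (q \<cdot>\<^bsub>D\<^esub> fh (mfun S) Gb) (fh G Tb \<cdot>\<^bsub>D\<^esub> comp_hor (cp (t0 \<psi> Ty))) n"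
    and "Rho D (fh G Tb) \<bullet>\<^bsub>D\<^esub> ((cid D (fh G Tb) \<odot>\<^bsub>D\<^esub> comp_delta (cp (t0 \<psi> Ty))) \<bullet>\<^bsub>D\<^esub> n)
      = Lam D (fh G Tb) \<bullet>\<^bsub>D\<^esub> (comp_delta (cp \<psi>y) \<odot>\<^bsub>D\<^esub> t1 \<psi> b)"
proof -
  have "\<exists>!c. cell D (q \<cdot>\<^bsub>D\<^esub> fh (mfun S) Gb) (fh G Tb \<cdot>\<^bsub>D\<^esub> comp_hor (cp (t0 \<psi> Ty)))
      (vid D (fo (mfun S) (fo G Ty))) (vid D (fo G Ty)) c \<and>
      Rho D (fh G Tb) \<bullet>\<^bsub>D\<^esub> ((cid D (fh G Tb) \<odot>\<^bsub>D\<^esub> comp_delta (cp (t0 \<psi> Ty))) \<bullet>\<^bsub>D\<^esub> c)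
      = Lam D (fh G Tb) \<bullet>\<^bsub>D\<^esub> (comp_delta (cp \<psi>y) \<odot>\<^bsub>D\<^esub> t1 \<psi> b)"
    by (rule D.companion_whisker_lift[OF cp_companion]) (simp_all add: cell_def)
  then have "\<exists>!n. globular D (q \<cdot>\<^bsub>D\<^esub> fh (mfun S) Gb) (fh G Tb \<cdot>\<^bsub>D\<^esub> comp_hor (cp (t0 \<psi> Ty))) n \<and>
      Rho D (fh G Tb) \<bullet>\<^bsub>D\<^esub> ((cid D (fh G Tb) \<odot>\<^bsub>D\<^esub> comp_delta (cp (t0 \<psi> Ty))) \<bullet>\<^bsub>D\<^esub> n)
      = Lam D (fh G Tb) \<bullet>\<^bsub>D\<^esub> (comp_delta (cp \<psi>y) \<odot>\<^bsub>D\<^esub> t1 \<psi> b)"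
    unfolding globular_def by simp
  from theI'[OF this] show "globular D (q \<cdot>\<^bsub>D\<^esub> fh (mfun S) Gb) (fh G Tb \<cdot>\<^bsub>D\<^esub> comp_hor (cp (t0 \<psi> Ty))) n"
    "Rho D (fh G Tb) \<bullet>\<^bsub>D\<^esub> ((cid D (fh G Tb) \<odot>\<^bsub>D\<^esub> comp_delta (cp (t0 \<psi> Ty))) \<bullet>\<^bsub>D\<^esub> n)
      = Lam D (fh G Tb) \<bullet>\<^bsub>D\<^esub> (comp_delta (cp \<psi>y) \<odot>\<^bsub>D\<^esub> t1 \<psi> b)"
    unfolding n_def n_comp_def Let_def by simp_all
qed

lemma tau_comp_props:
  assumes "f \<in> Arr (Ver D)"
  shows "globular D (comp_hor (cp (fv (mfun S) f))) (fh (mfun S) (comp_hor (cp f))) (tau_comp D (mfun S) cp f)"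
    and "tau_comp D (mfun S) cp f \<bullet>\<^bsub>D\<^esub> comp_nu (cp (fv (mfun S) f))
      = fc (mfun S) (comp_nu (cp f)) \<bullet>\<^bsub>D\<^esub> fe (mfun S) (Src (Ver D) f)"
proof -
  let ?k = "cp (fv (mfun S) f)"
  have "\<exists>!c. cell D (comp_hor ?k) (fh (mfun S) (comp_hor (cp f))) (vid D (fo (mfun S) (Src (Ver D) f)))
      (vid D (fo (mfun S) (Tgt (Ver D) f))) c \<and> c \<bullet>\<^bsub>D\<^esub> comp_nu ?k = fc (mfun S) (comp_nu (cp f)) \<bullet>\<^bsub>D\<^esub> fe (mfun S) (Src (Ver D) f)"
    by (rule D.companion_extend[OF cp_companion]) (simp_all add: cell_def assms)
  then have "\<exists>!c. globular D (comp_hor ?k) (fh (mfun S) (comp_hor (cp f))) c \<and>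
      c \<bullet>\<^bsub>D\<^esub> comp_nu ?k = fc (mfun S) (comp_nu (cp f)) \<bullet>\<^bsub>D\<^esub> fe (mfun S) (Src (Ver D) f)"
    unfolding globular_def by (simp add: assms)
  from theI'[OF this] show "globular D (comp_hor ?k) (fh (mfun S) (comp_hor (cp f))) (tau_comp D (mfun S) cp f)"
    "tau_comp D (mfun S) cp f \<bullet>\<^bsub>D\<^esub> comp_nu ?k = fc (mfun S) (comp_nu (cp f)) \<bullet>\<^bsub>D\<^esub> fe (mfun S) (Src (Ver D) f)"
    unfolding tau_comp_def Let_def by simp_all
qed

text \<open>The components of \<open>G_shriek\<close> receive opaque names, so that the simplifier
  treats the carrier as a single horizontal 1-cell with known boundary and not as a
  composite.\<close>

definition "pull_hor = Gb \<cdot>\<^bsub>D\<^esub> q"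
definition "pull_unit = ((fc G \<upsilon> \<bullet>\<^bsub>D\<^esub> fe G y) \<odot>\<^bsub>D\<^esub> e_comp D T S G \<psi> cp y) \<bullet>\<^bsub>D\<^esub> D.LamI (hunit D Gy)"
definition "pull_mult =
  ((fc G \<mu> \<bullet>\<^bsub>D\<^esub> fm G b Tb) \<odot>\<^bsub>D\<^esub> m_comp D T S G \<psi> cp y) \<bullet>\<^bsub>D\<^esub>
    (mid_whisker D Gb q (fh (mfun S) Gb) (fh G Tb) (comp_hor (cp (t0 \<psi> Ty))) (comp_hor (cp (fv (mfun S) \<psi>y)))
       (n_comp E D cp (lax_comp D (mfun S) G) (lax_comp D G (mfun T)) \<psi> b) \<bullet>\<^bsub>D\<^esub>
     (cid D (Gb \<cdot>\<^bsub>D\<^esub> q) \<odot>\<^bsub>D\<^esub> inverse_in (Hor D) (theta'_cmp D (mfun S) cp Gb \<psi>y)))"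
definition "pull_cell = Rho D Gb \<bullet>\<^bsub>D\<^esub> (cid D Gb \<odot>\<^bsub>D\<^esub> comp_delta (cp \<psi>y))"

lemma G_shriek_eq: "G_shriek E D T S G \<psi> cp (y, b, \<upsilon>, \<mu>) = (Gy, pull_hor, pull_unit, pull_mult)"
  unfolding G_shriek_def Let_def pull_hor_def pull_unit_def pull_mult_def by simp

lemma pull_hor_simps [simp]:
  "pull_hor \<in> Obj (Hor D)" "hdom D pull_hor = fo (mfun S) Gy" "hcod D pull_hor = Gy"
  unfolding pull_hor_def by simp_all

lemma pull_cell_simps [simp]:
  "pull_cell \<in> Arr (Hor D)" "Src (Hor D) pull_cell = pull_hor" "Tgt (Hor D) pull_cell = Gb"
  "cdom D pull_cell = \<psi>y" "ccod D pull_cell = vid D Gy"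
  unfolding pull_hor_def pull_cell_def by simp_all

lemma pull_unit_simps [simp]:
  "pull_unit \<in> Arr (Hor D)" "Src (Hor D) pull_unit = hunit D Gy" "Tgt (Hor D) pull_unit = pull_hor"
  "cdom D pull_unit = t0 (muni S) Gy" "ccod D pull_unit = vid D Gy"
  unfolding pull_hor_def pull_unit_def using D.cellD(1-5)[OF e_comp_props(1)] by simp_all

text \<open>Under \<delta> the cell \<open>e_comp\<close> becomes a unit cell, which \<rho> absorbs
  by naturality; the leftover unitors at the unit cancel by \<open>Lam_hunit\<close>.\<close>

lemma pull_cell_unit: "pull_cell \<bullet>\<^bsub>D\<^esub> pull_unit = fc G \<upsilon> \<bullet>\<^bsub>D\<^esub> fe G y"
proof -
  note e = D.cellD(1-5)[OF e_comp_props(1)] e_comp_props(2)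
  have "pull_cell \<bullet>\<^bsub>D\<^esub> pull_unit
      = (Rho D Gb \<bullet>\<^bsub>D\<^esub> ((fc G \<upsilon> \<bullet>\<^bsub>D\<^esub> fe G y) \<odot>\<^bsub>D\<^esub> cunit D (fv G (t0 (muni T) y)))) \<bullet>\<^bsub>D\<^esub> D.LamI (hunit D Gy)"
    unfolding pull_cell_def pull_unit_def by (simp add: e D.cassoc D.ccmp_merge_extend)
  also have "\<dots> = (fc G \<upsilon> \<bullet>\<^bsub>D\<^esub> fe G y) \<bullet>\<^bsub>D\<^esub> (Rho D (hunit D Gy) \<bullet>\<^bsub>D\<^esub> D.LamI (hunit D Gy))"
    using D.Rho_nat[of "fc G \<upsilon> \<bullet>\<^bsub>D\<^esub> fe G y" Gb "fv G (t0 (muni T) y)"] by (simp add: D.cassoc)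
  finally show ?thesis by (simp flip: D.Lam_hunit)
qed

text \<open>Both facts are instances of the preservation of restrictions, for the underlying lax
  functor of \<open>S\<close>.\<close>

lemma theta'_is_iso: "is_iso (Hor D) (theta'_cmp D (mfun S) cp Gb \<psi>y)"
  and pull_cell_theta': "fc (mfun S) pull_cell \<bullet>\<^bsub>D\<^esub> theta'_cmp D (mfun S) cp Gb \<psi>y
    = Rho D (fh (mfun S) Gb) \<bullet>\<^bsub>D\<^esub> (cid D (fh (mfun S) Gb) \<odot>\<^bsub>D\<^esub> comp_delta (cp (fv (mfun S) \<psi>y)))"
  using S.T.companion_comparison_is_iso[OF cp_companion _ cp_companion tau_comp_props, of \<psi>y Gb]
  unfolding theta'_cmp_def pull_cell_def by simp_all

lemma theta'_simps:
  defines "\<theta> \<equiv> theta'_cmp D (mfun S) cp Gb \<psi>y"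
  shows "\<theta> \<in> Arr (Hor D)" "Src (Hor D) \<theta> = fh (mfun S) Gb \<cdot>\<^bsub>D\<^esub> comp_hor (cp (fv (mfun S) \<psi>y))"
    "Tgt (Hor D) \<theta> = fh (mfun S) pull_hor"
    "cdom D \<theta> = vid D (fo (mfun S) (fo (mfun S) Gy))" "ccod D \<theta> = vid D (fo (mfun S) Gy)"
  unfolding \<theta>_def theta'_cmp_def pull_hor_def
  using D.globular_simps[OF tau_comp_props(1)[of \<psi>y]] by simp_all

lemma theta'_inverse_simps:
  defines "\<theta> \<equiv> inverse_in (Hor D) (theta'_cmp D (mfun S) cp Gb \<psi>y)"
  shows "\<theta> \<in> Arr (Hor D)" "Tgt (Hor D) \<theta> = fh (mfun S) Gb \<cdot>\<^bsub>D\<^esub> comp_hor (cp (fv (mfun S) \<psi>y))"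
    "Src (Hor D) \<theta> = fh (mfun S) pull_hor"
    "cdom D \<theta> = vid D (fo (mfun S) (fo (mfun S) Gy))" "ccod D \<theta> = vid D (fo (mfun S) Gy)"
    "theta'_cmp D (mfun S) cp Gb \<psi>y \<bullet>\<^bsub>D\<^esub> \<theta> = cid D (fh (mfun S) pull_hor)"
  unfolding \<theta>_def
  using D.inverse_in_facts[OF theta'_is_iso]
    D.inverse_in_boundary[OF theta'_is_iso theta'_simps(4,5)] theta'_simps by simp_all

lemma mid_whisker_n_comp_simps:
  defines "M \<equiv> mid_whisker D Gb q (fh (mfun S) Gb) (fh G Tb) (comp_hor (cp (t0 \<psi> Ty))) (comp_hor (cp (fv (mfun S) \<psi>y)))
       (n_comp E D cp (lax_comp D (mfun S) G) (lax_comp D G (mfun T)) \<psi> b)"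
  shows "M \<in> Arr (Hor D)" "Src (Hor D) M = (Gb \<cdot>\<^bsub>D\<^esub> q) \<cdot>\<^bsub>D\<^esub> (fh (mfun S) Gb \<cdot>\<^bsub>D\<^esub> comp_hor (cp (fv (mfun S) \<psi>y)))"
    "Tgt (Hor D) M = (Gb \<cdot>\<^bsub>D\<^esub> fh G Tb) \<cdot>\<^bsub>D\<^esub> (comp_hor (cp (t0 \<psi> Ty)) \<cdot>\<^bsub>D\<^esub> comp_hor (cp (fv (mfun S) \<psi>y)))"
    "cdom D M = vid D (fo (mfun S) (fo (mfun S) Gy))" "ccod D M = vid D Gy"
  unfolding M_def mid_whisker_def using D.globular_simps[OF n_comp_props(1)] by simp_all

lemma pull_mult_simps [simp]:
  "pull_mult \<in> Arr (Hor D)" "Src (Hor D) pull_mult = pull_hor \<cdot>\<^bsub>D\<^esub> fh (mfun S) pull_hor"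
  "Tgt (Hor D) pull_mult = pull_hor" "cdom D pull_mult = t0 (mmul S) Gy" "ccod D pull_mult = vid D Gy"
  unfolding pull_hor_def pull_mult_def
  using D.cellD(1-5)[OF m_comp_props(1)] theta'_inverse_simps mid_whisker_n_comp_simps
  by (simp_all flip: pull_hor_def)

text \<open>Seen through \<open>pull_cell\<close>, the multiplication of
  \<open>G\<^sub>!(y, b)\<close> reduces to that of \<open>b\<close>, with
  \<open>t1 \<psi> b\<close> passing from \<open>S\<close> to \<open>T\<close>. The ingredients are
  the defining equations of \<open>m_comp\<close> and \<open>n_comp\<close> and the cancellation of
  \<theta>'.\<close>

lemma pull_cell_mult:
  "pull_cell \<bullet>\<^bsub>D\<^esub> pull_mult = (fc G \<mu> \<bullet>\<^bsub>D\<^esub> fm G b Tb) \<bullet>\<^bsub>D\<^esub> (pull_cell \<odot>\<^bsub>D\<^esub> (t1 \<psi> b \<bullet>\<^bsub>D\<^esub> fc (mfun S) pull_cell))"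
proof -
  let ?\<theta> = "inverse_in (Hor D) (theta'_cmp D (mfun S) cp Gb \<psi>y)"
  let ?M = "mid_whisker D Gb q (fh (mfun S) Gb) (fh G Tb) (comp_hor (cp (t0 \<psi> Ty))) (comp_hor (cp (fv (mfun S) \<psi>y)))
       (n_comp E D cp (lax_comp D (mfun S) G) (lax_comp D G (mfun T)) \<psi> b)"
  let ?E = "cunit D (t0 \<psi> Ty) \<bullet>\<^bsub>D\<^esub> comp_delta (cp (fv (mfun S) \<psi>y))"
  let ?R = "Rho D (hunit D (fo G (fo (mfun T) Ty))) \<bullet>\<^bsub>D\<^esub> (comp_delta (cp (t0 \<psi> Ty)) \<odot>\<^bsub>D\<^esub> ?E)"
  let ?G\<mu> = "fc G \<mu> \<bullet>\<^bsub>D\<^esub> fm G b Tb" and ?X = "Rho D (fh G Tb) \<bullet>\<^bsub>D\<^esub> (t1 \<psi> b \<odot>\<^bsub>D\<^esub> ?E)"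
  note m = D.cellD(1-5)[OF m_comp_props(1)] and me = m_comp_props(2)
  note M = mid_whisker_n_comp_simps and t = theta'_inverse_simps(1-5)[unfolded pull_hor_def]
  \<comment> \<open>Instance of \<open>unitor_tensor\<close> with identity cells for \<chi> and
    \<open>V\<close>; its hypothesis on the comparison is the defining equation of
    \<open>n_comp\<close>.\<close>
  have tensor: "pull_cell \<odot>\<^bsub>D\<^esub> ?X = Rho D (Gb \<cdot>\<^bsub>D\<^esub> fh G Tb) \<bullet>\<^bsub>D\<^esub> ((cid D (Gb \<cdot>\<^bsub>D\<^esub> fh G Tb) \<odot>\<^bsub>D\<^esub> ?R) \<bullet>\<^bsub>D\<^esub> ?M)"
    unfolding pull_cell_def
    using D.unitor_tensor[of Gb Gb "vid D (fo G Ty)" "vid D Gy" "cid D Gb" q "fo G Ty" \<psi>y "comp_delta (cp \<psi>y)"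
        "fh (mfun S) Gb" "fh G Tb" "t0 \<psi> Ty" "t1 \<psi> b" "comp_hor (cp (fv (mfun S) \<psi>y))" "fo G (fo (mfun T) Ty)"
        "t0 \<psi> Ty \<circ>\<^bsub>D\<^esub> fv (mfun S) \<psi>y" ?E "fh G Tb" "vid D (fo G (fo (mfun T) Ty))" "cid D (fh G Tb)"
        "comp_hor (cp (t0 \<psi> Ty))" "comp_delta (cp (t0 \<psi> Ty))"]
      n_comp_props
    by (simp add: cell_def D.cassoc D.globular_simps[OF n_comp_props(1)])
  \<comment> \<open>By naturality of \<rho>, \<open>?X\<close> is \<open>t1 \<psi> b\<close> after a
    restriction cell, which \<open>pull_cell_theta'\<close> expresses through \<theta>'; the inverse
    of \<theta>' then cancels.\<close>
  have X: "?X \<bullet>\<^bsub>D\<^esub> ?\<theta> = t1 \<psi> b \<bullet>\<^bsub>D\<^esub> fc (mfun S) pull_cell"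
  proof -
    have "?X = Rho D (fh G Tb) \<bullet>\<^bsub>D\<^esub> ((t1 \<psi> b \<odot>\<^bsub>D\<^esub> cunit D (t0 \<psi> Ty)) \<bullet>\<^bsub>D\<^esub> (cid D (fh (mfun S) Gb) \<odot>\<^bsub>D\<^esub> comp_delta (cp (fv (mfun S) \<psi>y))))"
      by (simp add: D.ccmp_merge)
    also have "\<dots> = t1 \<psi> b \<bullet>\<^bsub>D\<^esub> (fc (mfun S) pull_cell \<bullet>\<^bsub>D\<^esub> theta'_cmp D (mfun S) cp Gb \<psi>y)"
      using D.Rho_nat[of "t1 \<psi> b" "fh G Tb" "t0 \<psi> Ty"] by (simp add: pull_cell_theta' D.cassoc[symmetric])
    finally have "?X \<bullet>\<^bsub>D\<^esub> ?\<theta> = t1 \<psi> b \<bullet>\<^bsub>D\<^esub> (fc (mfun S) pull_cell \<bullet>\<^bsub>D\<^esub> (theta'_cmp D (mfun S) cp Gb \<psi>y \<bullet>\<^bsub>D\<^esub> ?\<theta>))"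
      using theta'_simps theta'_inverse_simps(1-5) by (simp add: D.cassoc)
    then show ?thesis using theta'_inverse_simps(6) by simp
  qed
  have "pull_cell \<bullet>\<^bsub>D\<^esub> pull_mult = Rho D Gb \<bullet>\<^bsub>D\<^esub> ((?G\<mu> \<odot>\<^bsub>D\<^esub> (cunit D (fv G (t0 (mmul T) y)) \<bullet>\<^bsub>D\<^esub> ?R)) \<bullet>\<^bsub>D\<^esub> (?M \<bullet>\<^bsub>D\<^esub> (cid D (Gb \<cdot>\<^bsub>D\<^esub> q) \<odot>\<^bsub>D\<^esub> ?\<theta>)))"
    unfolding pull_cell_def pull_mult_def by (simp add: m me M t D.cassoc D.ccmp_merge_extend)
  also have "\<dots> = (Rho D Gb \<bullet>\<^bsub>D\<^esub> (?G\<mu> \<odot>\<^bsub>D\<^esub> cunit D (fv G (t0 (mmul T) y)))) \<bullet>\<^bsub>D\<^esub>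
      ((cid D (Gb \<cdot>\<^bsub>D\<^esub> fh G Tb) \<odot>\<^bsub>D\<^esub> ?R) \<bullet>\<^bsub>D\<^esub> (?M \<bullet>\<^bsub>D\<^esub> (cid D (Gb \<cdot>\<^bsub>D\<^esub> q) \<odot>\<^bsub>D\<^esub> ?\<theta>)))"
    by (simp add: M t D.cassoc D.ccmp_merge_extend)
  also have "\<dots> = ?G\<mu> \<bullet>\<^bsub>D\<^esub> ((Rho D (Gb \<cdot>\<^bsub>D\<^esub> fh G Tb) \<bullet>\<^bsub>D\<^esub> ((cid D (Gb \<cdot>\<^bsub>D\<^esub> fh G Tb) \<odot>\<^bsub>D\<^esub> ?R) \<bullet>\<^bsub>D\<^esub> ?M)) \<bullet>\<^bsub>D\<^esub> (cid D (Gb \<cdot>\<^bsub>D\<^esub> q) \<odot>\<^bsub>D\<^esub> ?\<theta>))"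
    using D.Rho_nat[of ?G\<mu> Gb "fv G (t0 (mmul T) y)"] by (simp add: M t D.cassoc)
  also have "\<dots> = ?G\<mu> \<bullet>\<^bsub>D\<^esub> ((pull_cell \<odot>\<^bsub>D\<^esub> ?X) \<bullet>\<^bsub>D\<^esub> (cid D pull_hor \<odot>\<^bsub>D\<^esub> ?\<theta>))"
    unfolding tensor pull_hor_def ..
  also have "\<dots> = ?G\<mu> \<bullet>\<^bsub>D\<^esub> (pull_cell \<odot>\<^bsub>D\<^esub> (?X \<bullet>\<^bsub>D\<^esub> ?\<theta>))"
    using theta'_inverse_simps(1-5) by (simp add: D.ccmp_merge)
  finally show ?thesis unfolding X .
qed

end

section \<open>The counit at \<open>(y, b)\<close>\<close>

text \<open>The unit of the conjunction enters through the mate identities \<open>mate0\<close> and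
  \<open>mate1\<close>. The two invertibility assumptions are stated at the carrier of
  \<open>G\<^sub>!(y, b)\<close>, the instance at which \<open>F_shriek\<close> inverts
  cells.\<close>

locale shriek_counit_at = lax_morphism_algebra D E S T G \<psi> cp y b \<upsilon> \<mu>
  + F: lax_functor D E F
  + phi: vertical_transformation D E "lax_comp E F (mfun S)" "lax_comp E (mfun T) F" \<phi>
  + eps: vertical_transformation E E "lax_comp E F G" "lax_id E" \<epsilon>
  for D :: "('o, 'v, 'h, 'c) dbl" and E :: "('p, 'w, 'k, 'd) dbl"
    and S :: "('o, 'v, 'h, 'c) mnd" and T :: "('p, 'w, 'k, 'd) mnd"
    and F :: "('o, 'v, 'h, 'c, 'p, 'w, 'k, 'd) laxf" and \<phi> :: "('o, 'h, 'w, 'd) vtr"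
    and G :: "('p, 'w, 'k, 'd, 'o, 'v, 'h, 'c) laxf" and \<psi> :: "('p, 'k, 'v, 'c) vtr"
    and \<epsilon> :: "('p, 'k, 'w, 'd) vtr"
    and cj :: "'w \<Rightarrow> ('k, 'd) conj" and cp :: "'v \<Rightarrow> ('h, 'c) comp"
    and y :: 'p and b :: 'k and \<upsilon> \<mu> :: 'd +
  assumes phi_unit: "x \<in> Obj (Ver D) \<Longrightarrow> t0 \<phi> x \<circ>\<^bsub>E\<^esub> fv F (t0 (muni S) x) = t0 (muni T) (fo F x)"
    and phi_mult: "x \<in> Obj (Ver D) \<Longrightarrow> t0 \<phi> x \<circ>\<^bsub>E\<^esub> fv F (t0 (mmul S) x)
      = t0 (mmul T) (fo F x) \<circ>\<^bsub>E\<^esub> (fv (mfun T) (t0 \<phi> x) \<circ>\<^bsub>E\<^esub> t0 \<phi> (fo (mfun S) x))"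
    and mate0: "z \<in> Obj (Ver E) \<Longrightarrow> t0 \<epsilon> (fo (mfun T) z) \<circ>\<^bsub>E\<^esub> fv F (t0 \<psi> z) = fv (mfun T) (t0 \<epsilon> z) \<circ>\<^bsub>E\<^esub> t0 \<phi> (fo G z)"
    and mate1: "r \<in> Obj (Hor E) \<Longrightarrow> t1 \<epsilon> (fh (mfun T) r) \<bullet>\<^bsub>E\<^esub> fc F (t1 \<psi> r) = fc (mfun T) (t1 \<epsilon> r) \<bullet>\<^bsub>E\<^esub> t1 \<phi> (fh G r)"
    and cj: "conjoint_choice E cj"
    and strong: "is_iso (Hor E) (n_conj D E cj (lax_comp E F (mfun S)) (lax_comp E (mfun T) F) \<phi> (fh G b \<cdot>\<^bsub>D\<^esub> comp_hor (cp (t0 \<psi> y))))"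
    and theta_is_iso: "is_iso (Hor E) (theta_cmp E (mfun T) cj (fh F (fh G b \<cdot>\<^bsub>D\<^esub> comp_hor (cp (t0 \<psi> y)))) (t0 \<phi> (fo G y)))"
begin

lemma cj_conjoint: "f \<in> Arr (Ver E) \<Longrightarrow> is_conjoint E f (cj f)"
  using cj unfolding conjoint_choice_def by blast

lemmas cj_simps [simp] = E.is_conjointD(1-14)[OF cj_conjoint]

abbreviation (input) "FGy \<equiv> fo F Gy"
abbreviation (input) "a \<equiv> pull_hor"
abbreviation (input) "Fa \<equiv> fh F a"
abbreviation (input) "TFa \<equiv> fh (mfun T) Fa"
abbreviation (input) "FSa \<equiv> fh F (fh (mfun S) a)"
abbreviation (input) "\<phi>x \<equiv> t0 \<phi> Gy"
abbreviation (input) "\<phi>S \<equiv> t0 \<phi> (fo (mfun S) Gy)"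
abbreviation (input) "\<phi>T \<equiv> fv (mfun T) (t0 \<phi> Gy)"
abbreviation (input) "p \<equiv> conj_hor (cj \<phi>x)"
abbreviation (input) "pS \<equiv> conj_hor (cj \<phi>S)"
abbreviation (input) "pT \<equiv> conj_hor (cj \<phi>T)"
abbreviation (input) "T\<epsilon> \<equiv> fv (mfun T) (t0 \<epsilon> y)"
abbreviation (input) "TT\<epsilon> \<equiv> fv (mfun T) (fv (mfun T) (t0 \<epsilon> y))"

section \<open>The uniquely determined cells that enter \<open>F\<^sub>!\<close> and the comparison
  for the counit\<close>

lemma e_conj_props:
  "cell E (hunit E FGy) p (t0 (muni T) FGy) (fv F (t0 (muni S) Gy)) (e_conj E S T F \<phi> cj Gy)"
  "conj_eps (cj \<phi>x) \<bullet>\<^bsub>E\<^esub> e_conj E S T F \<phi> cj Gy = cunit E (t0 (muni T) FGy)"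
proof -
  have "\<exists>!c. cell E (hunit E FGy) p (t0 (muni T) FGy) (fv F (t0 (muni S) Gy)) c \<and>
      conj_eps (cj \<phi>x) \<bullet>\<^bsub>E\<^esub> c = cunit E (t0 (muni T) FGy)"
    by (rule E.conjoint_lift[OF cj_conjoint]) (simp_all add: cell_def phi_unit)
  from theI'[OF this] show
    "cell E (hunit E FGy) p (t0 (muni T) FGy) (fv F (t0 (muni S) Gy)) (e_conj E S T F \<phi> cj Gy)"
    "conj_eps (cj \<phi>x) \<bullet>\<^bsub>E\<^esub> e_conj E S T F \<phi> cj Gy = cunit E (t0 (muni T) FGy)"
    unfolding e_conj_def Let_def by blast+
qed

lemma m_conj_props:
  "cell E (pS \<cdot>\<^bsub>E\<^esub> pT) p (t0 (mmul T) FGy) (fv F (t0 (mmul S) Gy)) (m_conj E S T F \<phi> cj Gy)"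
  "conj_eps (cj \<phi>x) \<bullet>\<^bsub>E\<^esub> m_conj E S T F \<phi> cj Gy = cunit E (t0 (mmul T) FGy) \<bullet>\<^bsub>E\<^esub>
      (Rho E (hunit E (fo (mfun T) (fo (mfun T) FGy))) \<bullet>\<^bsub>E\<^esub> ((cunit E \<phi>T \<bullet>\<^bsub>E\<^esub> conj_eps (cj \<phi>S)) \<odot>\<^bsub>E\<^esub> conj_eps (cj \<phi>T)))"
proof -
  have "\<exists>!c. cell E (pS \<cdot>\<^bsub>E\<^esub> pT) p (t0 (mmul T) FGy) (fv F (t0 (mmul S) Gy)) c \<and>
      conj_eps (cj \<phi>x) \<bullet>\<^bsub>E\<^esub> c = cunit E (t0 (mmul T) FGy) \<bullet>\<^bsub>E\<^esub>
      (Rho E (hunit E (fo (mfun T) (fo (mfun T) FGy))) \<bullet>\<^bsub>E\<^esub> ((cunit E \<phi>T \<bullet>\<^bsub>E\<^esub> conj_eps (cj \<phi>S)) \<odot>\<^bsub>E\<^esub> conj_eps (cj \<phi>T)))"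
    by (rule E.conjoint_lift[OF cj_conjoint]) (simp_all add: cell_def phi_mult)
  from theI'[OF this] show
    "cell E (pS \<cdot>\<^bsub>E\<^esub> pT) p (t0 (mmul T) FGy) (fv F (t0 (mmul S) Gy)) (m_conj E S T F \<phi> cj Gy)"
    "conj_eps (cj \<phi>x) \<bullet>\<^bsub>E\<^esub> m_conj E S T F \<phi> cj Gy = cunit E (t0 (mmul T) FGy) \<bullet>\<^bsub>E\<^esub>
      (Rho E (hunit E (fo (mfun T) (fo (mfun T) FGy))) \<bullet>\<^bsub>E\<^esub> ((cunit E \<phi>T \<bullet>\<^bsub>E\<^esub> conj_eps (cj \<phi>S)) \<odot>\<^bsub>E\<^esub> conj_eps (cj \<phi>T)))"
    unfolding m_conj_def Let_def by blast+
qed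

definition "n_phi = n_conj D E cj (lax_comp E F (mfun S)) (lax_comp E (mfun T) F) \<phi> a"

lemma n_phi_props:
  "globular E (FSa \<cdot>\<^bsub>E\<^esub> pS) (p \<cdot>\<^bsub>E\<^esub> TFa) n_phi"
  "Lam E TFa \<bullet>\<^bsub>E\<^esub> ((conj_eps (cj \<phi>x) \<odot>\<^bsub>E\<^esub> cid E TFa) \<bullet>\<^bsub>E\<^esub> n_phi) = Rho E TFa \<bullet>\<^bsub>E\<^esub> (t1 \<phi> a \<odot>\<^bsub>E\<^esub> conj_eps (cj \<phi>S))"
proof -
  have "\<exists>!c. cell E (FSa \<cdot>\<^bsub>E\<^esub> pS) (p \<cdot>\<^bsub>E\<^esub> TFa) (vid E (fo (mfun T) (fo F (fo (mfun S) Gy)))) (vid E (fo F (fo (mfun S) Gy))) c \<and>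
      Lam E TFa \<bullet>\<^bsub>E\<^esub> ((conj_eps (cj \<phi>x) \<odot>\<^bsub>E\<^esub> cid E TFa) \<bullet>\<^bsub>E\<^esub> c) = Rho E TFa \<bullet>\<^bsub>E\<^esub> (t1 \<phi> a \<odot>\<^bsub>E\<^esub> conj_eps (cj \<phi>S))"
    by (rule E.conjoint_whisker_lift[OF cj_conjoint]) (simp_all add: cell_def)
  then have "\<exists>!n. globular E (FSa \<cdot>\<^bsub>E\<^esub> pS) (p \<cdot>\<^bsub>E\<^esub> TFa) n \<and>
      Lam E TFa \<bullet>\<^bsub>E\<^esub> ((conj_eps (cj \<phi>x) \<odot>\<^bsub>E\<^esub> cid E TFa) \<bullet>\<^bsub>E\<^esub> n) = Rho E TFa \<bullet>\<^bsub>E\<^esub> (t1 \<phi> a \<odot>\<^bsub>E\<^esub> conj_eps (cj \<phi>S))"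
    unfolding globular_def by simp
  from theI'[OF this] show "globular E (FSa \<cdot>\<^bsub>E\<^esub> pS) (p \<cdot>\<^bsub>E\<^esub> TFa) n_phi"
    "Lam E TFa \<bullet>\<^bsub>E\<^esub> ((conj_eps (cj \<phi>x) \<odot>\<^bsub>E\<^esub> cid E TFa) \<bullet>\<^bsub>E\<^esub> n_phi) = Rho E TFa \<bullet>\<^bsub>E\<^esub> (t1 \<phi> a \<odot>\<^bsub>E\<^esub> conj_eps (cj \<phi>S))"
    unfolding n_phi_def n_conj_def Let_def by simp_all
qed

lemma n_eps_props:
  defines "n \<equiv> n_conj E E cj (lax_comp E F G) (lax_id E) \<epsilon> b"
  shows "globular E (fh F Gb \<cdot>\<^bsub>E\<^esub> conj_hor (cj (t0 \<epsilon> Ty))) (conj_hor (cj (t0 \<epsilon> y)) \<cdot>\<^bsub>E\<^esub> b) n"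
    and "Lam E b \<bullet>\<^bsub>E\<^esub> ((conj_eps (cj (t0 \<epsilon> y)) \<odot>\<^bsub>E\<^esub> cid E b) \<bullet>\<^bsub>E\<^esub> n) = Rho E b \<bullet>\<^bsub>E\<^esub> (t1 \<epsilon> b \<odot>\<^bsub>E\<^esub> conj_eps (cj (t0 \<epsilon> Ty)))"
proof -
  have "\<exists>!c. cell E (fh F Gb \<cdot>\<^bsub>E\<^esub> conj_hor (cj (t0 \<epsilon> Ty))) (conj_hor (cj (t0 \<epsilon> y)) \<cdot>\<^bsub>E\<^esub> b) (vid E Ty) (vid E FGy) c \<and>
      Lam E b \<bullet>\<^bsub>E\<^esub> ((conj_eps (cj (t0 \<epsilon> y)) \<odot>\<^bsub>E\<^esub> cid E b) \<bullet>\<^bsub>E\<^esub> c) = Rho E b \<bullet>\<^bsub>E\<^esub> (t1 \<epsilon> b \<odot>\<^bsub>E\<^esub> conj_eps (cj (t0 \<epsilon> Ty)))"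
    by (rule E.conjoint_whisker_lift[OF cj_conjoint]) (simp_all add: cell_def)
  then have "\<exists>!n. globular E (fh F Gb \<cdot>\<^bsub>E\<^esub> conj_hor (cj (t0 \<epsilon> Ty))) (conj_hor (cj (t0 \<epsilon> y)) \<cdot>\<^bsub>E\<^esub> b) n \<and>
      Lam E b \<bullet>\<^bsub>E\<^esub> ((conj_eps (cj (t0 \<epsilon> y)) \<odot>\<^bsub>E\<^esub> cid E b) \<bullet>\<^bsub>E\<^esub> n) = Rho E b \<bullet>\<^bsub>E\<^esub> (t1 \<epsilon> b \<odot>\<^bsub>E\<^esub> conj_eps (cj (t0 \<epsilon> Ty)))"
    unfolding globular_def by simp
  from theI'[OF this] show "globular E (fh F Gb \<cdot>\<^bsub>E\<^esub> conj_hor (cj (t0 \<epsilon> Ty))) (conj_hor (cj (t0 \<epsilon> y)) \<cdot>\<^bsub>E\<^esub> b) n"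
    "Lam E b \<bullet>\<^bsub>E\<^esub> ((conj_eps (cj (t0 \<epsilon> y)) \<odot>\<^bsub>E\<^esub> cid E b) \<bullet>\<^bsub>E\<^esub> n) = Rho E b \<bullet>\<^bsub>E\<^esub> (t1 \<epsilon> b \<odot>\<^bsub>E\<^esub> conj_eps (cj (t0 \<epsilon> Ty)))"
    unfolding n_def n_conj_def Let_def by simp_all
qed

lemma sigma_conj_props:
  assumes "f \<in> Arr (Ver E)"
  shows "globular E (conj_hor (cj (fv (mfun T) f))) (fh (mfun T) (conj_hor (cj f))) (sigma_conj E (mfun T) cj f)"
    and "sigma_conj E (mfun T) cj f \<bullet>\<^bsub>E\<^esub> conj_eta (cj (fv (mfun T) f))
      = fc (mfun T) (conj_eta (cj f)) \<bullet>\<^bsub>E\<^esub> fe (mfun T) (Src (Ver E) f)"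
proof -
  let ?k = "cj (fv (mfun T) f)"
  have "\<exists>!c. cell E (conj_hor ?k) (fh (mfun T) (conj_hor (cj f))) (vid E (fo (mfun T) (Tgt (Ver E) f)))
      (vid E (fo (mfun T) (Src (Ver E) f))) c \<and> c \<bullet>\<^bsub>E\<^esub> conj_eta ?k = fc (mfun T) (conj_eta (cj f)) \<bullet>\<^bsub>E\<^esub> fe (mfun T) (Src (Ver E) f)"
    by (rule E.conjoint_extend[OF cj_conjoint]) (simp_all add: cell_def assms)
  then have "\<exists>!c. globular E (conj_hor ?k) (fh (mfun T) (conj_hor (cj f))) c \<and>
      c \<bullet>\<^bsub>E\<^esub> conj_eta ?k = fc (mfun T) (conj_eta (cj f)) \<bullet>\<^bsub>E\<^esub> fe (mfun T) (Src (Ver E) f)"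
    unfolding globular_def by (simp add: assms)
  from theI'[OF this] show "globular E (conj_hor ?k) (fh (mfun T) (conj_hor (cj f))) (sigma_conj E (mfun T) cj f)"
    "sigma_conj E (mfun T) cj f \<bullet>\<^bsub>E\<^esub> conj_eta ?k = fc (mfun T) (conj_eta (cj f)) \<bullet>\<^bsub>E\<^esub> fe (mfun T) (Src (Ver E) f)"
    unfolding sigma_conj_def Let_def by simp_all
qed

section \<open>The components of \<open>F\<^sub>!G\<^sub>!(y, b)\<close> and the counit cell\<close>

definition "theta = theta_cmp E (mfun T) cj Fa \<phi>x"
definition "push_hor = Fa \<cdot>\<^bsub>E\<^esub> p"
definition "push_unit = ((fc F pull_unit \<bullet>\<^bsub>E\<^esub> fe F Gy) \<odot>\<^bsub>E\<^esub> e_conj E S T F \<phi> cj Gy) \<bullet>\<^bsub>E\<^esub> E.LamI (hunit E FGy)"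
definition "push_mid = mid_whisker E Fa p TFa FSa pS pT (inverse_in (Hor E) n_phi)"
definition "push_mult = ((fc F pull_mult \<bullet>\<^bsub>E\<^esub> fm F a (fh (mfun S) a)) \<odot>\<^bsub>E\<^esub> m_conj E S T F \<phi> cj Gy) \<bullet>\<^bsub>E\<^esub>
  (push_mid \<bullet>\<^bsub>E\<^esub> (cid E (Fa \<cdot>\<^bsub>E\<^esub> p) \<odot>\<^bsub>E\<^esub> inverse_in (Hor E) theta))"
definition "chi = t1 \<epsilon> b \<bullet>\<^bsub>E\<^esub> fc F pull_cell"
definition "counit_cell = Rho E b \<bullet>\<^bsub>E\<^esub> (chi \<odot>\<^bsub>E\<^esub> (cunit E T\<epsilon> \<bullet>\<^bsub>E\<^esub> conj_eps (cj \<phi>x)))"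

lemma F_shriek_eq: "F_shriek D E S T F \<phi> cj (Gy, pull_hor, pull_unit, pull_mult) = (FGy, push_hor, push_unit, push_mult)"
  unfolding F_shriek_def Let_def push_hor_def push_unit_def push_mult_def push_mid_def theta_def n_phi_def by simp

text \<open>The domain of \<open>chi\<close> first appears as \<open>t0 \<epsilon> Ty\<close> after
  the image of \<psi>y; \<open>mate0\<close> rewrites it to the codomain of the cell with which
  \<open>chi\<close> is tensored in \<open>counit_cell\<close>.\<close>

lemma chi_simps [simp]:
  "chi \<in> Arr (Hor E)" "Src (Hor E) chi = Fa" "Tgt (Hor E) chi = b"
  "cdom E chi = T\<epsilon> \<circ>\<^bsub>E\<^esub> \<phi>x" "ccod E chi = t0 \<epsilon> y"
  unfolding chi_def by (simp_all add: mate0)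

lemma push_hor_simps [simp]:
  "push_hor \<in> Obj (Hor E)" "hdom E push_hor = fo (mfun T) FGy" "hcod E push_hor = FGy"
  unfolding push_hor_def by simp_all

lemma counit_cell_simps [simp]:
  "counit_cell \<in> Arr (Hor E)" "Src (Hor E) counit_cell = push_hor" "Tgt (Hor E) counit_cell = b"
  "cdom E counit_cell = T\<epsilon>" "ccod E counit_cell = t0 \<epsilon> y"
  unfolding counit_cell_def push_hor_def by simp_all

lemma push_unit_simps [simp]:
  "push_unit \<in> Arr (Hor E)" "Src (Hor E) push_unit = hunit E FGy" "Tgt (Hor E) push_unit = push_hor"
  "cdom E push_unit = t0 (muni T) FGy" "ccod E push_unit = vid E FGy"
  unfolding push_hor_def push_unit_def using E.cellD(1-5)[OF e_conj_props(1)] by simp_all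

lemma n_phi_simps:
  "n_phi \<in> Arr (Hor E)" "Src (Hor E) n_phi = FSa \<cdot>\<^bsub>E\<^esub> pS" "Tgt (Hor E) n_phi = p \<cdot>\<^bsub>E\<^esub> TFa"
  "cdom E n_phi = vid E (fo (mfun T) (fo F (fo (mfun S) Gy)))" "ccod E n_phi = vid E (fo F (fo (mfun S) Gy))"
  using E.globular_simps[OF n_phi_props(1)] by simp_all

lemma n_phi_is_iso: "is_iso (Hor E) n_phi"
  using strong unfolding n_phi_def pull_hor_def .

lemma n_phi_inverse_simps:
  "inverse_in (Hor E) n_phi \<in> Arr (Hor E)" "Tgt (Hor E) (inverse_in (Hor E) n_phi) = FSa \<cdot>\<^bsub>E\<^esub> pS"
  "Src (Hor E) (inverse_in (Hor E) n_phi) = p \<cdot>\<^bsub>E\<^esub> TFa"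
  "cdom E (inverse_in (Hor E) n_phi) = vid E (fo (mfun T) (fo F (fo (mfun S) Gy)))"
  "ccod E (inverse_in (Hor E) n_phi) = vid E (fo F (fo (mfun S) Gy))"
  "n_phi \<bullet>\<^bsub>E\<^esub> inverse_in (Hor E) n_phi = cid E (p \<cdot>\<^bsub>E\<^esub> TFa)"
  using E.inverse_in_facts[OF n_phi_is_iso] E.inverse_in_boundary[OF n_phi_is_iso n_phi_simps(4,5)] n_phi_simps
  by simp_all

lemma theta_simps:
  "theta \<in> Arr (Hor E)" "Src (Hor E) theta = TFa \<cdot>\<^bsub>E\<^esub> pT" "Tgt (Hor E) theta = fh (mfun T) push_hor"
  "cdom E theta = vid E (fo (mfun T) (fo (mfun T) FGy))" "ccod E theta = vid E (fo (mfun T) FGy)"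
  unfolding theta_def theta_cmp_def push_hor_def
  using E.globular_simps[OF sigma_conj_props(1)[of \<phi>x]] by simp_all

lemma theta_iso: "is_iso (Hor E) theta"
  using theta_is_iso unfolding theta_def pull_hor_def .

lemma theta_inverse_simps:
  "inverse_in (Hor E) theta \<in> Arr (Hor E)" "Tgt (Hor E) (inverse_in (Hor E) theta) = TFa \<cdot>\<^bsub>E\<^esub> pT"
  "Src (Hor E) (inverse_in (Hor E) theta) = fh (mfun T) push_hor"
  "cdom E (inverse_in (Hor E) theta) = vid E (fo (mfun T) (fo (mfun T) FGy))"
  "ccod E (inverse_in (Hor E) theta) = vid E (fo (mfun T) FGy)"
  "theta \<bullet>\<^bsub>E\<^esub> inverse_in (Hor E) theta = cid E (fh (mfun T) push_hor)"
  using E.inverse_in_facts[OF theta_iso] E.inverse_in_boundary[OF theta_iso theta_simps(4,5)] theta_simps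
  by simp_all

lemma push_mid_simps:
  "push_mid \<in> Arr (Hor E)" "Src (Hor E) push_mid = (Fa \<cdot>\<^bsub>E\<^esub> p) \<cdot>\<^bsub>E\<^esub> (TFa \<cdot>\<^bsub>E\<^esub> pT)"
  "Tgt (Hor E) push_mid = (Fa \<cdot>\<^bsub>E\<^esub> FSa) \<cdot>\<^bsub>E\<^esub> (pS \<cdot>\<^bsub>E\<^esub> pT)"
  "cdom E push_mid = vid E (fo (mfun T) (fo (mfun T) FGy))" "ccod E push_mid = vid E FGy"
  unfolding push_mid_def mid_whisker_def using n_phi_inverse_simps by simp_all

lemma push_mult_simps [simp]:
  "push_mult \<in> Arr (Hor E)" "Src (Hor E) push_mult = push_hor \<cdot>\<^bsub>E\<^esub> fh (mfun T) push_hor"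
  "Tgt (Hor E) push_mult = push_hor" "cdom E push_mult = t0 (mmul T) FGy" "ccod E push_mult = vid E FGy"
  unfolding push_hor_def push_mult_def
  using E.cellD(1-5)[OF m_conj_props(1)] theta_inverse_simps push_mid_simps
  by (simp_all flip: push_hor_def)

section \<open>Compatibility of the counit cell with units and multiplications\<close>

lemma chi_unit: "chi \<bullet>\<^bsub>E\<^esub> (fc F pull_unit \<bullet>\<^bsub>E\<^esub> fe F Gy) = \<upsilon> \<bullet>\<^bsub>E\<^esub> cunit E (t0 \<epsilon> y)"
proof -
  have "chi \<bullet>\<^bsub>E\<^esub> (fc F pull_unit \<bullet>\<^bsub>E\<^esub> fe F Gy) = t1 \<epsilon> b \<bullet>\<^bsub>E\<^esub> (fc F (pull_cell \<bullet>\<^bsub>D\<^esub> pull_unit) \<bullet>\<^bsub>E\<^esub> fe F Gy)"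
    unfolding chi_def by (simp add: E.cassoc F.fc_Cmp)
  also have "\<dots> = (t1 \<epsilon> b \<bullet>\<^bsub>E\<^esub> fc F (fc G \<upsilon>)) \<bullet>\<^bsub>E\<^esub> (fc F (fe G y) \<bullet>\<^bsub>E\<^esub> fe F Gy)"
    by (simp add: pull_cell_unit F.fc_Cmp E.cassoc)
  \<comment> \<open>Naturality of the counit at \<upsilon>. What remains is its unit axiom, for the
    composite lax functor whose unit constraint is the bracketed cell.\<close>
  also have "\<dots> = \<upsilon> \<bullet>\<^bsub>E\<^esub> (t1 \<epsilon> (hunit E y) \<bullet>\<^bsub>E\<^esub> (fc F (fe G y) \<bullet>\<^bsub>E\<^esub> fe F Gy))"
    using eps.t1_natural[of \<upsilon>] by (simp add: E.cassoc)
  also have "\<dots> = \<upsilon> \<bullet>\<^bsub>E\<^esub> cunit E (t0 \<epsilon> y)"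
    using eps.t1_unit[of y] by simp
  finally show ?thesis .
qed

text \<open>The equation of \<open>pull_cell_mult\<close> is carried through \<open>F\<close>:
  naturality of the counit at \<mu> and its compatibility with composites account for \<mu>, and
  \<open>mate1\<close> exchanges \<psi> for \<phi>.\<close>

lemma chi_mult:
  "chi \<bullet>\<^bsub>E\<^esub> (fc F pull_mult \<bullet>\<^bsub>E\<^esub> fm F a (fh (mfun S) a)) = \<mu> \<bullet>\<^bsub>E\<^esub> (chi \<odot>\<^bsub>E\<^esub> (fc (mfun T) chi \<bullet>\<^bsub>E\<^esub> t1 \<phi> a))"
proof -
  let ?X = "t1 \<psi> b \<bullet>\<^bsub>D\<^esub> fc (mfun S) pull_cell"
  \<comment> \<open>The mate identity on cells, followed by naturality of \<phi> at
    \<open>pull_cell\<close>.\<close>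
  have X: "t1 \<epsilon> Tb \<bullet>\<^bsub>E\<^esub> fc F ?X = fc (mfun T) chi \<bullet>\<^bsub>E\<^esub> t1 \<phi> a"
  proof -
    have "t1 \<epsilon> Tb \<bullet>\<^bsub>E\<^esub> fc F ?X = (t1 \<epsilon> Tb \<bullet>\<^bsub>E\<^esub> fc F (t1 \<psi> b)) \<bullet>\<^bsub>E\<^esub> fc F (fc (mfun S) pull_cell)"
      by (simp add: F.fc_Cmp E.cassoc)
    also have "\<dots> = fc (mfun T) (t1 \<epsilon> b) \<bullet>\<^bsub>E\<^esub> (t1 \<phi> Gb \<bullet>\<^bsub>E\<^esub> fc F (fc (mfun S) pull_cell))"
      by (simp add: mate1 E.cassoc)
    also have "\<dots> = fc (mfun T) (t1 \<epsilon> b) \<bullet>\<^bsub>E\<^esub> (fc (mfun T) (fc F pull_cell) \<bullet>\<^bsub>E\<^esub> t1 \<phi> a)"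
      using phi.t1_natural[of pull_cell] by simp
    finally show ?thesis unfolding chi_def by (simp add: T.T.fc_Cmp E.cassoc)
  qed
  have "chi \<bullet>\<^bsub>E\<^esub> (fc F pull_mult \<bullet>\<^bsub>E\<^esub> fm F a (fh (mfun S) a))
      = t1 \<epsilon> b \<bullet>\<^bsub>E\<^esub> (fc F (pull_cell \<bullet>\<^bsub>D\<^esub> pull_mult) \<bullet>\<^bsub>E\<^esub> fm F a (fh (mfun S) a))"
    unfolding chi_def by (simp add: E.cassoc F.fc_Cmp)
  also have "\<dots> = (t1 \<epsilon> b \<bullet>\<^bsub>E\<^esub> fc F (fc G \<mu>)) \<bullet>\<^bsub>E\<^esub> (fc F (fm G b Tb) \<bullet>\<^bsub>E\<^esub> (fc F (pull_cell \<odot>\<^bsub>D\<^esub> ?X) \<bullet>\<^bsub>E\<^esub> fm F a (fh (mfun S) a)))"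
    by (simp add: pull_cell_mult F.fc_Cmp E.cassoc)
  also have "\<dots> = (\<mu> \<bullet>\<^bsub>E\<^esub> t1 \<epsilon> (b \<cdot>\<^bsub>E\<^esub> Tb)) \<bullet>\<^bsub>E\<^esub> (fc F (fm G b Tb) \<bullet>\<^bsub>E\<^esub> (fm F Gb (fh G Tb) \<bullet>\<^bsub>E\<^esub> (fc F pull_cell \<odot>\<^bsub>E\<^esub> fc F ?X)))"
    using eps.t1_natural[of \<mu>] F.fm_nat[of ?X pull_cell "fh G Tb" Gb] by simp
  also have "\<dots> = \<mu> \<bullet>\<^bsub>E\<^esub> ((t1 \<epsilon> (b \<cdot>\<^bsub>E\<^esub> Tb) \<bullet>\<^bsub>E\<^esub> (fc F (fm G b Tb) \<bullet>\<^bsub>E\<^esub> fm F Gb (fh G Tb))) \<bullet>\<^bsub>E\<^esub> (fc F pull_cell \<odot>\<^bsub>E\<^esub> fc F ?X))"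
    by (simp add: E.cassoc)
  also have "\<dots> = \<mu> \<bullet>\<^bsub>E\<^esub> ((t1 \<epsilon> b \<odot>\<^bsub>E\<^esub> t1 \<epsilon> Tb) \<bullet>\<^bsub>E\<^esub> (fc F pull_cell \<odot>\<^bsub>E\<^esub> fc F ?X))"
    using eps.t1_comp[of Tb b] by simp
  also have "\<dots> = \<mu> \<bullet>\<^bsub>E\<^esub> (chi \<odot>\<^bsub>E\<^esub> (t1 \<epsilon> Tb \<bullet>\<^bsub>E\<^esub> fc F ?X))"
    unfolding chi_def by (simp add: E.ccmp_merge)
  finally show ?thesis unfolding X .
qed

text \<open>The mechanism of \<open>pull_cell_unit\<close> again; naturality of the monad unit at
  \<open>t0 \<epsilon> y\<close> aligns the boundaries before \<rho> absorbs the unit cell.\<close>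

lemma counit_cell_unit: "counit_cell \<bullet>\<^bsub>E\<^esub> push_unit = \<upsilon> \<bullet>\<^bsub>E\<^esub> cunit E (t0 \<epsilon> y)"
proof -
  note e = E.cellD(1-5)[OF e_conj_props(1)] e_conj_props(2)
  have n: "T\<epsilon> \<circ>\<^bsub>E\<^esub> t0 (muni T) FGy = t0 (muni T) y \<circ>\<^bsub>E\<^esub> t0 \<epsilon> y"
    using T.uni_naturality(1)[of "t0 \<epsilon> y"] by simp
  have "counit_cell \<bullet>\<^bsub>E\<^esub> push_unit
      = Rho E b \<bullet>\<^bsub>E\<^esub> (((chi \<bullet>\<^bsub>E\<^esub> (fc F pull_unit \<bullet>\<^bsub>E\<^esub> fe F Gy)) \<odot>\<^bsub>E\<^esub> (cunit E T\<epsilon> \<bullet>\<^bsub>E\<^esub> cunit E (t0 (muni T) FGy))) \<bullet>\<^bsub>E\<^esub> E.LamI (hunit E FGy))"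
    unfolding counit_cell_def push_unit_def by (simp add: e E.cassoc E.ccmp_merge_extend del: E.cunit_Cmp)
  also have "\<dots> = (Rho E b \<bullet>\<^bsub>E\<^esub> ((\<upsilon> \<bullet>\<^bsub>E\<^esub> cunit E (t0 \<epsilon> y)) \<odot>\<^bsub>E\<^esub> cunit E (t0 (muni T) y \<circ>\<^bsub>E\<^esub> t0 \<epsilon> y))) \<bullet>\<^bsub>E\<^esub> E.LamI (hunit E FGy)"
    by (simp add: chi_unit E.cassoc n)
  also have "\<dots> = (\<upsilon> \<bullet>\<^bsub>E\<^esub> cunit E (t0 \<epsilon> y)) \<bullet>\<^bsub>E\<^esub> (Rho E (hunit E FGy) \<bullet>\<^bsub>E\<^esub> E.LamI (hunit E FGy))"
    using E.Rho_nat[of "\<upsilon> \<bullet>\<^bsub>E\<^esub> cunit E (t0 \<epsilon> y)" b "t0 (muni T) y \<circ>\<^bsub>E\<^esub> t0 \<epsilon> y"] by (simp add: E.cassoc)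
  finally show ?thesis by (simp flip: E.Lam_hunit)
qed

text \<open>\<open>T\<close> need not preserve the conjoint of \<phi>x. Composition with
  \<open>theta\<close> makes up for this and puts the second factor of the multiplication into the
  shape that \<open>unitor_tensor\<close> accepts.\<close>

lemma counit_cell_theta:
  "fc (mfun T) counit_cell \<bullet>\<^bsub>E\<^esub> theta = Rho E Tb \<bullet>\<^bsub>E\<^esub> (fc (mfun T) chi \<odot>\<^bsub>E\<^esub> (cunit E TT\<epsilon> \<bullet>\<^bsub>E\<^esub> conj_eps (cj \<phi>T)))"
proof -
  let ?\<sigma> = "sigma_conj E (mfun T) cj \<phi>x" and ?T = "fc (mfun T)"
  note s = E.globular_simps[OF sigma_conj_props(1)[of \<phi>x]]
  \<comment> \<open>\<open>conjoint_comparison_eps\<close> replaces the image of a conjoint counit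
    by the counit of the conjoint of \<phi>T, at the cost of a unit constraint of \<open>T\<close>;
    the unit coherence of \<open>T\<close> removes that constraint at the end.\<close>
  have "?T (cunit E T\<epsilon> \<bullet>\<^bsub>E\<^esub> conj_eps (cj \<phi>x)) \<bullet>\<^bsub>E\<^esub> ?\<sigma> = ?T (cunit E T\<epsilon>) \<bullet>\<^bsub>E\<^esub> (?T (conj_eps (cj \<phi>x)) \<bullet>\<^bsub>E\<^esub> ?\<sigma>)"
    by (simp add: s T.T.fc_Cmp E.cassoc)
  also have "\<dots> = (?T (cunit E T\<epsilon>) \<bullet>\<^bsub>E\<^esub> fe (mfun T) (fo (mfun T) FGy)) \<bullet>\<^bsub>E\<^esub> conj_eps (cj \<phi>T)"
    using T.T.conjoint_comparison_eps[OF cj_conjoint _ cj_conjoint sigma_conj_props, of \<phi>x] by (simp add: E.cassoc)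
  also have "\<dots> = fe (mfun T) Ty \<bullet>\<^bsub>E\<^esub> (cunit E TT\<epsilon> \<bullet>\<^bsub>E\<^esub> conj_eps (cj \<phi>T))"
    using T.T.fe_natural[of T\<epsilon>, symmetric] by (simp add: E.cassoc)
  finally have 1: "?T (cunit E T\<epsilon> \<bullet>\<^bsub>E\<^esub> conj_eps (cj \<phi>x)) \<bullet>\<^bsub>E\<^esub> ?\<sigma> = fe (mfun T) Ty \<bullet>\<^bsub>E\<^esub> (cunit E TT\<epsilon> \<bullet>\<^bsub>E\<^esub> conj_eps (cj \<phi>T))" .
  have "?T counit_cell \<bullet>\<^bsub>E\<^esub> theta = ?T (Rho E b) \<bullet>\<^bsub>E\<^esub> ((?T (chi \<odot>\<^bsub>E\<^esub> (cunit E T\<epsilon> \<bullet>\<^bsub>E\<^esub> conj_eps (cj \<phi>x))) \<bullet>\<^bsub>E\<^esub> fm (mfun T) Fa p) \<bullet>\<^bsub>E\<^esub> (cid E TFa \<odot>\<^bsub>E\<^esub> ?\<sigma>))"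
    unfolding counit_cell_def theta_def theta_cmp_def by (simp add: s T.T.fc_Cmp E.cassoc)
  also have "\<dots> = ?T (Rho E b) \<bullet>\<^bsub>E\<^esub> ((fm (mfun T) b (hunit E Ty) \<bullet>\<^bsub>E\<^esub> (?T chi \<odot>\<^bsub>E\<^esub> ?T (cunit E T\<epsilon> \<bullet>\<^bsub>E\<^esub> conj_eps (cj \<phi>x)))) \<bullet>\<^bsub>E\<^esub> (cid E TFa \<odot>\<^bsub>E\<^esub> ?\<sigma>))"
    using T.T.fm_nat[of "cunit E T\<epsilon> \<bullet>\<^bsub>E\<^esub> conj_eps (cj \<phi>x)" chi "hunit E Ty" b] by simp
  also have "\<dots> = ?T (Rho E b) \<bullet>\<^bsub>E\<^esub> (fm (mfun T) b (hunit E Ty) \<bullet>\<^bsub>E\<^esub> (?T chi \<odot>\<^bsub>E\<^esub> (?T (cunit E T\<epsilon> \<bullet>\<^bsub>E\<^esub> conj_eps (cj \<phi>x)) \<bullet>\<^bsub>E\<^esub> ?\<sigma>)))"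
    by (simp add: s E.cassoc E.ccmp_merge)
  also have "\<dots> = ?T (Rho E b) \<bullet>\<^bsub>E\<^esub> (fm (mfun T) b (hunit E Ty) \<bullet>\<^bsub>E\<^esub> ((cid E Tb \<odot>\<^bsub>E\<^esub> fe (mfun T) Ty) \<bullet>\<^bsub>E\<^esub> (?T chi \<odot>\<^bsub>E\<^esub> (cunit E TT\<epsilon> \<bullet>\<^bsub>E\<^esub> conj_eps (cj \<phi>T)))))"
    unfolding 1 by (simp add: E.ccmp_merge)
  also have "\<dots> = Rho E Tb \<bullet>\<^bsub>E\<^esub> (?T chi \<odot>\<^bsub>E\<^esub> (cunit E TT\<epsilon> \<bullet>\<^bsub>E\<^esub> conj_eps (cj \<phi>T)))"
    by (simp add: T.T.fm_unit_right_extend)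
  finally show ?thesis .
qed

text \<open>Composition with \<open>counit_cell\<close> replaces every lifted cell by its defining
  equation. \<open>unitor_tensor\<close>, now with the inverse of \<open>n_phi\<close>, then
  recognises the tensor of two counit cells up to the \<open>theta\<close> that
  \<open>push_mult\<close> inverts.\<close>

lemma counit_cell_mult: "counit_cell \<bullet>\<^bsub>E\<^esub> push_mult = \<mu> \<bullet>\<^bsub>E\<^esub> (counit_cell \<odot>\<^bsub>E\<^esub> fc (mfun T) counit_cell)"
proof -
  let ?E = "cunit E T\<epsilon> \<bullet>\<^bsub>E\<^esub> conj_eps (cj \<phi>x)" and ?E' = "cunit E TT\<epsilon> \<bullet>\<^bsub>E\<^esub> conj_eps (cj \<phi>T)"
  let ?E1 = "cunit E (TT\<epsilon> \<circ>\<^bsub>E\<^esub> \<phi>T) \<bullet>\<^bsub>E\<^esub> conj_eps (cj \<phi>S)"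
  let ?X = "fc (mfun T) chi" and ?V = "fc (mfun T) chi \<bullet>\<^bsub>E\<^esub> t1 \<phi> a"
  let ?n = "inverse_in (Hor E) n_phi" and ?w = "hunit E (fo (mfun T) Ty)" and ?w' = "hunit E (fo (mfun T) (fo (mfun T) FGy))"
  let ?R = "Rho E ?w' \<bullet>\<^bsub>E\<^esub> ((cunit E \<phi>T \<bullet>\<^bsub>E\<^esub> conj_eps (cj \<phi>S)) \<odot>\<^bsub>E\<^esub> conj_eps (cj \<phi>T))"
  let ?W = "Rho E ?w \<bullet>\<^bsub>E\<^esub> (?E1 \<odot>\<^bsub>E\<^esub> ?E')"
  note n = n_phi_simps and ni = n_phi_inverse_simps and M = push_mid_simps and th = theta_simps and thi = theta_inverse_simps(1-5)
  note m = E.cellD(1-5)[OF m_conj_props(1)] m_conj_props(2)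
  \<comment> \<open>The defining equation of \<open>n_phi\<close> is composed with the inverse of
    \<open>n_phi\<close>; naturality of both unitors then gives the hypothesis of
    \<open>unitor_tensor\<close>.\<close>
  have "Lam E Tb \<bullet>\<^bsub>E\<^esub> (?E \<odot>\<^bsub>E\<^esub> ?X) = (Lam E Tb \<bullet>\<^bsub>E\<^esub> (cunit E T\<epsilon> \<odot>\<^bsub>E\<^esub> ?X)) \<bullet>\<^bsub>E\<^esub> (conj_eps (cj \<phi>x) \<odot>\<^bsub>E\<^esub> cid E TFa)"
    by (simp add: E.cassoc E.ccmp_merge)
  also have "\<dots> = ?X \<bullet>\<^bsub>E\<^esub> (Lam E TFa \<bullet>\<^bsub>E\<^esub> ((conj_eps (cj \<phi>x) \<odot>\<^bsub>E\<^esub> cid E TFa) \<bullet>\<^bsub>E\<^esub> (n_phi \<bullet>\<^bsub>E\<^esub> ?n)))"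
    using E.Lam_nat[of ?X Tb T\<epsilon>] by (simp add: E.cassoc ni(6))
  also have "\<dots> = ?X \<bullet>\<^bsub>E\<^esub> ((Lam E TFa \<bullet>\<^bsub>E\<^esub> ((conj_eps (cj \<phi>x) \<odot>\<^bsub>E\<^esub> cid E TFa) \<bullet>\<^bsub>E\<^esub> n_phi)) \<bullet>\<^bsub>E\<^esub> ?n)"
    using n ni(1-5) by (simp add: E.cassoc)
  also have "\<dots> = (Rho E Tb \<bullet>\<^bsub>E\<^esub> (?X \<odot>\<^bsub>E\<^esub> cunit E (TT\<epsilon> \<circ>\<^bsub>E\<^esub> \<phi>T))) \<bullet>\<^bsub>E\<^esub> ((t1 \<phi> a \<odot>\<^bsub>E\<^esub> conj_eps (cj \<phi>S)) \<bullet>\<^bsub>E\<^esub> ?n)"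
    unfolding n_phi_props(2) using E.Rho_nat[of ?X Tb "TT\<epsilon> \<circ>\<^bsub>E\<^esub> \<phi>T"] ni(1-5) by (simp add: E.cassoc)
  also have "\<dots> = Rho E Tb \<bullet>\<^bsub>E\<^esub> ((?V \<odot>\<^bsub>E\<^esub> ?E1) \<bullet>\<^bsub>E\<^esub> ?n)"
    using ni(1-5) by (simp add: E.cassoc E.ccmp_merge_extend)
  finally have hyp: "Lam E Tb \<bullet>\<^bsub>E\<^esub> (?E \<odot>\<^bsub>E\<^esub> ?X) = Rho E Tb \<bullet>\<^bsub>E\<^esub> ((?V \<odot>\<^bsub>E\<^esub> ?E1) \<bullet>\<^bsub>E\<^esub> ?n)" .
  have glob: "globular E (p \<cdot>\<^bsub>E\<^esub> TFa) (FSa \<cdot>\<^bsub>E\<^esub> pS) ?n"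
    unfolding globular_def cell_def using ni by simp
  \<comment> \<open>The values of \<open>f\<close>, \<open>h\<close> and \<open>l\<close> are the
    domains of \<open>chi\<close>, of its image under \<open>T\<close>, and of that image after
    \<open>t1 \<phi> a\<close>. They agree with the codomains of \<open>?E\<close>,
    \<open>?E'\<close> and \<open>?E1\<close>.\<close>
  have tensor: "counit_cell \<odot>\<^bsub>E\<^esub> (Rho E Tb \<bullet>\<^bsub>E\<^esub> (?X \<odot>\<^bsub>E\<^esub> ?E')) = Rho E (b \<cdot>\<^bsub>E\<^esub> Tb) \<bullet>\<^bsub>E\<^esub> (((chi \<odot>\<^bsub>E\<^esub> ?V) \<odot>\<^bsub>E\<^esub> ?W) \<bullet>\<^bsub>E\<^esub> push_mid)"
    unfolding counit_cell_def push_mid_def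
    by (rule E.unitor_tensor[where u = Ty and w = "fo (mfun T) Ty" and f = "T\<epsilon> \<circ>\<^bsub>E\<^esub> \<phi>x" and g = "t0 \<epsilon> y" and f' = T\<epsilon>
          and h = "TT\<epsilon> \<circ>\<^bsub>E\<^esub> \<phi>T" and i = TT\<epsilon> and l = "TT\<epsilon> \<circ>\<^bsub>E\<^esub> (\<phi>T \<circ>\<^bsub>E\<^esub> \<phi>S)"])
       (use hyp glob in \<open>simp_all add: cell_def\<close>)
  have mt: "T\<epsilon> \<circ>\<^bsub>E\<^esub> t0 (mmul T) FGy = t0 (mmul T) y \<circ>\<^bsub>E\<^esub> TT\<epsilon>"
    using T.mul_naturality(1)[of "t0 \<epsilon> y"] by simp
  \<comment> \<open>The right factor produced by \<open>m_conj\<close> is brought to the form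
    \<open>?W\<close> by naturality of the monad multiplication at \<open>t0 \<epsilon> y\<close>
    and of \<rho> at a unit cell.\<close>
  have "cunit E T\<epsilon> \<bullet>\<^bsub>E\<^esub> (cunit E (t0 (mmul T) FGy) \<bullet>\<^bsub>E\<^esub> ?R) = cunit E (t0 (mmul T) y) \<bullet>\<^bsub>E\<^esub> (cunit E TT\<epsilon> \<bullet>\<^bsub>E\<^esub> ?R)"
    by (simp add: E.cunit_Cmp_extend mt)
  also have "cunit E TT\<epsilon> \<bullet>\<^bsub>E\<^esub> ?R = (Rho E ?w \<bullet>\<^bsub>E\<^esub> (cunit E TT\<epsilon> \<odot>\<^bsub>E\<^esub> cunit E TT\<epsilon>)) \<bullet>\<^bsub>E\<^esub> ((cunit E \<phi>T \<bullet>\<^bsub>E\<^esub> conj_eps (cj \<phi>S)) \<odot>\<^bsub>E\<^esub> conj_eps (cj \<phi>T))"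
    using E.Rho_nat[of "cunit E TT\<epsilon>" ?w TT\<epsilon>] by (simp add: E.cassoc)
  also have "\<dots> = ?W"
    by (simp add: E.cassoc E.ccmp_merge E.cunit_Cmp_extend)
  finally have W: "cunit E T\<epsilon> \<bullet>\<^bsub>E\<^esub> (cunit E (t0 (mmul T) FGy) \<bullet>\<^bsub>E\<^esub> ?R) = cunit E (t0 (mmul T) y) \<bullet>\<^bsub>E\<^esub> ?W" .
  have "counit_cell \<bullet>\<^bsub>E\<^esub> push_mult
      = Rho E b \<bullet>\<^bsub>E\<^esub> (((chi \<bullet>\<^bsub>E\<^esub> (fc F pull_mult \<bullet>\<^bsub>E\<^esub> fm F a (fh (mfun S) a))) \<odot>\<^bsub>E\<^esub> (cunit E T\<epsilon> \<bullet>\<^bsub>E\<^esub> (conj_eps (cj \<phi>x) \<bullet>\<^bsub>E\<^esub> m_conj E S T F \<phi> cj Gy)))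
          \<bullet>\<^bsub>E\<^esub> (push_mid \<bullet>\<^bsub>E\<^esub> (cid E (Fa \<cdot>\<^bsub>E\<^esub> p) \<odot>\<^bsub>E\<^esub> inverse_in (Hor E) theta)))"
    unfolding counit_cell_def push_mult_def using thi
    by (simp add: m(1-5) M E.cassoc E.ccmp_merge_extend flip: push_hor_def)
  also have "\<dots> = Rho E b \<bullet>\<^bsub>E\<^esub> (((\<mu> \<bullet>\<^bsub>E\<^esub> (chi \<odot>\<^bsub>E\<^esub> ?V)) \<odot>\<^bsub>E\<^esub> (cunit E (t0 (mmul T) y) \<bullet>\<^bsub>E\<^esub> ?W))
          \<bullet>\<^bsub>E\<^esub> (push_mid \<bullet>\<^bsub>E\<^esub> (cid E (Fa \<cdot>\<^bsub>E\<^esub> p) \<odot>\<^bsub>E\<^esub> inverse_in (Hor E) theta)))"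
    unfolding chi_mult m(6) W ..
  also have "\<dots> = (Rho E b \<bullet>\<^bsub>E\<^esub> (\<mu> \<odot>\<^bsub>E\<^esub> cunit E (t0 (mmul T) y))) \<bullet>\<^bsub>E\<^esub> (((chi \<odot>\<^bsub>E\<^esub> ?V) \<odot>\<^bsub>E\<^esub> ?W)
          \<bullet>\<^bsub>E\<^esub> (push_mid \<bullet>\<^bsub>E\<^esub> (cid E (Fa \<cdot>\<^bsub>E\<^esub> p) \<odot>\<^bsub>E\<^esub> inverse_in (Hor E) theta)))"
    using thi by (simp add: M E.cassoc E.ccmp_merge_extend flip: push_hor_def)
  also have "\<dots> = \<mu> \<bullet>\<^bsub>E\<^esub> ((Rho E (b \<cdot>\<^bsub>E\<^esub> Tb) \<bullet>\<^bsub>E\<^esub> (((chi \<odot>\<^bsub>E\<^esub> ?V) \<odot>\<^bsub>E\<^esub> ?W) \<bullet>\<^bsub>E\<^esub> push_mid)) \<bullet>\<^bsub>E\<^esub> (cid E (Fa \<cdot>\<^bsub>E\<^esub> p) \<odot>\<^bsub>E\<^esub> inverse_in (Hor E) theta))"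
    using E.Rho_nat[of \<mu> b "t0 (mmul T) y"] thi by (simp add: M E.cassoc flip: push_hor_def)
  also have "\<dots> = \<mu> \<bullet>\<^bsub>E\<^esub> ((counit_cell \<odot>\<^bsub>E\<^esub> (fc (mfun T) counit_cell \<bullet>\<^bsub>E\<^esub> theta)) \<bullet>\<^bsub>E\<^esub> (cid E push_hor \<odot>\<^bsub>E\<^esub> inverse_in (Hor E) theta))"
    unfolding tensor[symmetric] counit_cell_theta push_hor_def ..
  \<comment> \<open>Interchange brings \<open>theta\<close> and its inverse next to each other,
    where they cancel.\<close>
  also have "\<dots> = \<mu> \<bullet>\<^bsub>E\<^esub> (counit_cell \<odot>\<^bsub>E\<^esub> (fc (mfun T) counit_cell \<bullet>\<^bsub>E\<^esub> (theta \<bullet>\<^bsub>E\<^esub> inverse_in (Hor E) theta)))"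
    using th thi by (simp add: E.ccmp_merge E.cassoc)
  finally show ?thesis by (simp add: theta_inverse_simps(6))
qed

section \<open>Invertibility of the counit\<close>

lemma counit_cell_is_iso_iff:
  assumes "is_iso (Ver E) (t0 \<epsilon> y)" "is_iso (Ver E) (fv F \<psi>y)"
  shows "is_iso (Hor E) counit_cell \<longleftrightarrow> is_iso (Hor E) (n_conj E E cj (lax_comp E F G) (lax_id E) \<epsilon> b)"
proof -
  let ?n = "n_conj E E cj (lax_comp E F G) (lax_id E) \<epsilon> b"
  let ?K = "Rho E b \<bullet>\<^bsub>E\<^esub> (t1 \<epsilon> b \<odot>\<^bsub>E\<^esub> conj_eps (cj (t0 \<epsilon> Ty)))" and ?L = "Lam E b \<bullet>\<^bsub>E\<^esub> (conj_eps (cj (t0 \<epsilon> y)) \<odot>\<^bsub>E\<^esub> cid E b)"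
  note n = E.globular_simps[OF n_eps_props(1)]
  \<comment> \<open>\<open>mate0\<close> is the commuting square. Of its two sides, T\<epsilon> is
    invertible because functors preserve isomorphisms, and the image of \<psi>y under
    \<open>F\<close> is so by hypothesis.\<close>
  obtain \<tau> where t: "cell E p (conj_hor (cj (t0 \<epsilon> Ty))) T\<epsilon> (fv F \<psi>y) \<tau>"
    "conj_eps (cj (t0 \<epsilon> Ty)) \<bullet>\<^bsub>E\<^esub> \<tau> = cunit E T\<epsilon> \<bullet>\<^bsub>E\<^esub> conj_eps (cj \<phi>x)" "is_iso (Hor E) \<tau>"
    by (rule E.conjoint_square_iso[of \<phi>x "cj \<phi>x" "t0 \<epsilon> Ty" "cj (t0 \<epsilon> Ty)" T\<epsilon> "fv F \<psi>y"])
       (simp_all add: cj_conjoint T.T.fv_is_iso assms mate0)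
  note tf = E.cellD(1-5)[OF t(1)]
  have pc: "is_iso (Hor E) (fc F pull_cell)"
    unfolding pull_cell_def using assms(2) by (intro F.companion_restriction_is_iso[OF cp_companion]) simp_all
  \<comment> \<open>Splitting \<open>chi\<close> into its two factors and rewriting the conjoint
    counit through \<tau> separates an invertible horizontal composite from
    \<open>?K\<close>.\<close>
  have "counit_cell = ?K \<bullet>\<^bsub>E\<^esub> (fc F pull_cell \<odot>\<^bsub>E\<^esub> \<tau>)"
    unfolding counit_cell_def chi_def by (simp add: tf E.cassoc E.ccmp_merge flip: t(2))
  moreover have "is_iso (Hor E) (fc F pull_cell \<odot>\<^bsub>E\<^esub> \<tau>)"
    using pc t(3) by (rule_tac E.is_iso_ccmp) (simp_all add: tf)
  ultimately have 1: "is_iso (Hor E) counit_cell \<longleftrightarrow> is_iso (Hor E) ?K"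
    using E.hor.is_iso_Cmp_right_iff[of "fc F pull_cell \<odot>\<^bsub>E\<^esub> \<tau>" ?K] by (simp add: tf)
  have L: "is_iso (Hor E) ?L"
    using assms(1) by (intro E.hor.is_iso_Cmp E.is_iso_ccmp E.conjoint_eps_is_iso[OF cj_conjoint]) simp_all
  \<comment> \<open>This is the defining equation of the comparison, rebracketed so that the
    invertible \<open>?L\<close> stands on the left.\<close>
  have "?K = ?L \<bullet>\<^bsub>E\<^esub> ?n"
    using n_eps_props(2) n by (simp add: E.cassoc)
  then have "is_iso (Hor E) ?K \<longleftrightarrow> is_iso (Hor E) ?n"
    using E.hor.is_iso_Cmp_left_iff[OF L, of ?n] n by simp
  with 1 show ?thesis by simp
qed

text \<open>Transposing an identity leaves just \<open>pull_cell\<close> under \<open>F\<close>, and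
  the vertical part reduces to \<open>t0 \<epsilon> y\<close> because \<open>F\<close> preserves
  identities.\<close>

lemma shriek_counit_eq:
  "shriek_counit D E S T F \<phi> G \<psi> \<epsilon> cj cp (y, b, \<upsilon>, \<mu>)
    = ((FGy, push_hor, push_unit, push_mult), (t0 \<epsilon> y, counit_cell), (y, b, \<upsilon>, \<mu>))"
proof -
  have "(cid D Gb \<odot>\<^bsub>D\<^esub> comp_delta (cp \<psi>y)) \<bullet>\<^bsub>D\<^esub> cid D pull_hor = cid D Gb \<odot>\<^bsub>D\<^esub> comp_delta (cp \<psi>y)"
    by (simp add: pull_hor_def)
  then show ?thesis
    unfolding shriek_counit_def shriek_transpose_def
    by (simp add: G_shriek_eq HLaxAlg_def Let_def F_shriek_eq counit_cell_def chi_def pull_cell_def)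
qed

lemma shriek_counit_is_iso_iff:
  assumes "is_iso (Ver E) (t0 \<epsilon> y)" "is_iso (Ver E) (fv F \<psi>y)"
  shows "is_iso (HLaxAlg E T) (shriek_counit D E S T F \<phi> G \<psi> \<epsilon> cj cp (y, b, \<upsilon>, \<mu>))
    \<longleftrightarrow> is_iso (Hor E) (n_conj E E cj (lax_comp E F G) (lax_id E) \<epsilon> b)"
proof -
  have "is_iso (HLaxAlg E T) ((FGy, push_hor, push_unit, push_mult), (t0 \<epsilon> y, counit_cell), (y, b, \<upsilon>, \<mu>))"
    if "is_iso (Hor E) counit_cell"
  proof -
    have c: "cell E push_hor b T\<epsilon> (t0 \<epsilon> y) counit_cell"
      by (simp add: cell_def)
    \<comment> \<open>Arrows of \<open>HLaxAlg\<close> include their source algebra, so this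
      membership has to be settled before an inverse arrow makes sense.\<close>
    have "is_hlax_algebra E T (FGy, push_hor, push_unit, push_mult)"
      by (rule T.hlax_algebra_transport[OF alg assms(1) _ _ c that])
         (simp_all add: cell_def counit_cell_unit counit_cell_mult)
    then show ?thesis
      by (rule T.hlax_morphism_is_iso[OF _ alg assms(1) _ _ c that])
         (simp_all add: counit_cell_unit counit_cell_mult)
  qed
  then have "is_iso (HLaxAlg E T) (shriek_counit D E S T F \<phi> G \<psi> \<epsilon> cj cp (y, b, \<upsilon>, \<mu>)) \<longleftrightarrow> is_iso (Hor E) counit_cell"
    unfolding shriek_counit_eq using T.is_iso_HLaxAlg_cell by blast
  then show ?thesis using counit_cell_is_iso_iff[OF assms] by simp
qed

end

text \<open>Standard mate calculus: expand \<phi> by the formula of the conjunction, slide the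
  counit and then \<psi> by naturality, and remove the rest by the triangle identity for
  \<open>G\<close>. The two claims are the vertical and the cell part of one equation.\<close>

lemma conjunction_mate:
  assumes "conjunction D E S T F \<phi> G \<psi> \<eta> \<epsilon>" "is_monad D S" "is_monad E T"
  shows "z \<in> Obj (Ver E) \<Longrightarrow> t0 \<epsilon> (fo (mfun T) z) \<circ>\<^bsub>E\<^esub> fv F (t0 \<psi> z) = fv (mfun T) (t0 \<epsilon> z) \<circ>\<^bsub>E\<^esub> t0 \<phi> (fo G z)"
    and "r \<in> Obj (Hor E) \<Longrightarrow> t1 \<epsilon> (fh (mfun T) r) \<bullet>\<^bsub>E\<^esub> fc F (t1 \<psi> r) = fc (mfun T) (t1 \<epsilon> r) \<bullet>\<^bsub>E\<^esub> t1 \<phi> (fh G r)"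
proof -
  from assms(1) have adj: "lax_adjunction D E F G \<eta> \<epsilon>" and psi: "vertical_transformation E D (lax_comp D (mfun S) G) (lax_comp D G (mfun T)) \<psi>"
    and phi: "vt_eq D \<phi> (vt_comp E (vt_pre \<epsilon> (lax_comp E (mfun T) F))
       (vt_comp E (vt_post F (vt_pre \<psi> F)) (vt_post F (vt_post (mfun S) \<eta>))))"
    unfolding conjunction_def monad_lax_morphism_def by blast+
  interpret F: lax_functor D E F using adj unfolding lax_adjunction_def by blast
  interpret G: lax_functor E D G using adj unfolding lax_adjunction_def by blast
  interpret S: lax_functor D D "mfun S" using assms(2) unfolding is_monad_def by blast
  interpret T: lax_functor E E "mfun T" using assms(3) unfolding is_monad_def by blast
  interpret psi: vertical_transformation E D "lax_comp D (mfun S) G" "lax_comp D G (mfun T)" \<psi> by (rule psi)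
  interpret eta: vertical_transformation D D "lax_id D" "lax_comp D G F" \<eta> using adj unfolding lax_adjunction_def by blast
  interpret eps: vertical_transformation E E "lax_comp E F G" "lax_id E" \<epsilon> using adj unfolding lax_adjunction_def by blast
  have "vt_eq E (vt_comp D (vt_post G \<epsilon>) (vt_pre \<eta> G)) (vt_id D G)"
    using adj unfolding lax_adjunction_def by blast
  then have tri: "\<And>z. z \<in> Obj (Ver E) \<Longrightarrow> fv G (t0 \<epsilon> z) \<circ>\<^bsub>D\<^esub> t0 \<eta> (fo G z) = vid D (fo G z)"
    "\<And>r. r \<in> Obj (Hor E) \<Longrightarrow> fc G (t1 \<epsilon> r) \<bullet>\<^bsub>D\<^esub> t1 \<eta> (fh G r) = cid D (fh G r)"
    unfolding vt_eq_def vt_comp_def vt_post_def vt_pre_def vt_id_def by simp_all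
  show "t0 \<epsilon> (fo (mfun T) z) \<circ>\<^bsub>E\<^esub> fv F (t0 \<psi> z) = fv (mfun T) (t0 \<epsilon> z) \<circ>\<^bsub>E\<^esub> t0 \<phi> (fo G z)" if z: "z \<in> Obj (Ver E)"
  proof -
    let ?Te = "fv (mfun T) (t0 \<epsilon> z)" and ?FGz = "fo F (fo G z)"
    have "?Te \<circ>\<^bsub>E\<^esub> t0 \<phi> (fo G z) = ?Te \<circ>\<^bsub>E\<^esub> (t0 \<epsilon> (fo (mfun T) ?FGz) \<circ>\<^bsub>E\<^esub> (fv F (t0 \<psi> ?FGz) \<circ>\<^bsub>E\<^esub> fv F (fv (mfun S) (t0 \<eta> (fo G z)))))"
      using phi z unfolding vt_eq_def vt_comp_def vt_post_def vt_pre_def by simp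
    \<comment> \<open>Naturality of the counit at \<open>?Te\<close> exchanges the order of the two
      counits.\<close>
    also have "\<dots> = (t0 \<epsilon> (fo (mfun T) z) \<circ>\<^bsub>E\<^esub> fv F (fv G ?Te)) \<circ>\<^bsub>E\<^esub> (fv F (t0 \<psi> ?FGz) \<circ>\<^bsub>E\<^esub> fv F (fv (mfun S) (t0 \<eta> (fo G z))))"
      using eps.t0_natural[of ?Te] z F.cod.ver.Cmp_assoc by simp
    also have "\<dots> = t0 \<epsilon> (fo (mfun T) z) \<circ>\<^bsub>E\<^esub> (fv F (fv G ?Te \<circ>\<^bsub>D\<^esub> t0 \<psi> ?FGz) \<circ>\<^bsub>E\<^esub> fv F (fv (mfun S) (t0 \<eta> (fo G z))))"
      using z by simp
    \<comment> \<open>Naturality of \<psi> at the counit component assembles the triangle identity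
      under \<open>S\<close>.\<close>
    also have "\<dots> = t0 \<epsilon> (fo (mfun T) z) \<circ>\<^bsub>E\<^esub> fv F (t0 \<psi> z \<circ>\<^bsub>D\<^esub> fv (mfun S) (fv G (t0 \<epsilon> z) \<circ>\<^bsub>D\<^esub> t0 \<eta> (fo G z)))"
      using psi.t0_natural[of "t0 \<epsilon> z", symmetric] z by simp
    finally show ?thesis using tri z by simp
  qed
  show "t1 \<epsilon> (fh (mfun T) r) \<bullet>\<^bsub>E\<^esub> fc F (t1 \<psi> r) = fc (mfun T) (t1 \<epsilon> r) \<bullet>\<^bsub>E\<^esub> t1 \<phi> (fh G r)" if r: "r \<in> Obj (Hor E)"
  proof -
    let ?Te = "fc (mfun T) (t1 \<epsilon> r)" and ?FGr = "fh F (fh G r)"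
    have tri0: "fv G (t0 \<epsilon> (hdom E r)) \<circ>\<^bsub>D\<^esub> t0 \<eta> (fo G (hdom E r)) = vid D (fo G (hdom E r))" using tri(1) r by simp
    have "?Te \<bullet>\<^bsub>E\<^esub> t1 \<phi> (fh G r) = ?Te \<bullet>\<^bsub>E\<^esub> (t1 \<epsilon> (fh (mfun T) ?FGr) \<bullet>\<^bsub>E\<^esub> (fc F (t1 \<psi> ?FGr) \<bullet>\<^bsub>E\<^esub> fc F (fc (mfun S) (t1 \<eta> (fh G r)))))"
      using phi r unfolding vt_eq_def vt_comp_def vt_post_def vt_pre_def by simp
    also have "\<dots> = (?Te \<bullet>\<^bsub>E\<^esub> t1 \<epsilon> (fh (mfun T) ?FGr)) \<bullet>\<^bsub>E\<^esub> (fc F (t1 \<psi> ?FGr) \<bullet>\<^bsub>E\<^esub> fc F (fc (mfun S) (t1 \<eta> (fh G r))))"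
      using r by (simp add: F.cod.cassoc)
    also have "\<dots> = t1 \<epsilon> (fh (mfun T) r) \<bullet>\<^bsub>E\<^esub> (fc F (fc G ?Te \<bullet>\<^bsub>D\<^esub> t1 \<psi> ?FGr) \<bullet>\<^bsub>E\<^esub> fc F (fc (mfun S) (t1 \<eta> (fh G r))))"
      using eps.t1_natural[of ?Te, symmetric] r by (simp add: F.cod.cassoc F.fc_Cmp)
    also have "\<dots> = t1 \<epsilon> (fh (mfun T) r) \<bullet>\<^bsub>E\<^esub> fc F (t1 \<psi> r \<bullet>\<^bsub>D\<^esub> fc (mfun S) (fc G (t1 \<epsilon> r) \<bullet>\<^bsub>D\<^esub> t1 \<eta> (fh G r)))"
      using psi.t1_natural[of "t1 \<epsilon> r", symmetric] r by (simp add: F.cod.cassoc F.fc_Cmp S.fc_Cmp)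
    finally show ?thesis using tri(2) r by simp
  qed
qed

text \<open>\<open>F_shriek_defined\<close> asserts invertibility of the \<theta> that the
  multiplication of \<open>F\<^sub>!G\<^sub>!(y, b)\<close> inverts. The choices \<open>cj\<close>
  and \<open>cp\<close> are arbitrary, so the equivalence holds for every choice of conjoints and
  companions.\<close>

theorem lemma6p2:
  fixes D :: "('o, 'v, 'h, 'c) dbl" and E :: "('p, 'w, 'k, 'd) dbl"
    and S :: "('o, 'v, 'h, 'c) mnd" and T :: "('p, 'w, 'k, 'd) mnd"
    and F :: "('o, 'v, 'h, 'c, 'p, 'w, 'k, 'd) laxf" and \<phi> :: "('o, 'h, 'w, 'd) vtr"
    and G :: "('p, 'w, 'k, 'd, 'o, 'v, 'h, 'c) laxf" and \<psi> :: "('p, 'k, 'v, 'c) vtr"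
    and \<eta> :: "('o, 'h, 'v, 'c) vtr" and \<epsilon> :: "('p, 'k, 'w, 'd) vtr"
    and cj :: "'w \<Rightarrow> ('k, 'd) conj" and cp :: "'v \<Rightarrow> ('h, 'c) comp"
    and y :: 'p and b :: 'k and \<upsilon> \<mu> :: 'd
  assumes "equipment D" and "equipment E"
    and "is_monad D S" and "is_monad E T"
    and "conjoint_choice E cj" and "companion_choice D cp"
    and "conjunction D E S T F \<phi> G \<psi> \<eta> \<epsilon>"
    and "strong_conjoint D E cj (lax_comp E F (mfun S)) (lax_comp E (mfun T) F) \<phi>"
    and "strong_conjoint D E cj (lax_comp E (mfun T) (lax_comp E F (mfun S)))
           (lax_comp E (mfun T) (lax_comp E (mfun T) F)) (vt_post (mfun T) \<phi>)"
    and "is_hlax_algebra E T (y, b, \<upsilon>, \<mu>)"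
    and F_shriek_defined: "case G_shriek E D T S G \<psi> cp (y, b, \<upsilon>, \<mu>) of (x, a, _, _) \<Rightarrow>
           is_iso (Hor E) (theta_cmp E (mfun T) cj (fh F a) (t0 \<phi> x))"
    and "is_iso (Ver E) (t0 \<epsilon> y)" and "is_iso (Ver E) (fv F (t0 \<psi> y))"
  shows "is_iso (HLaxAlg E T) (shriek_counit D E S T F \<phi> G \<psi> \<epsilon> cj cp (y, b, \<upsilon>, \<mu>))
     \<longleftrightarrow> is_iso (Hor E) (n_conj E E cj (lax_comp E F G) (lax_id E) \<epsilon> b)"
proof -
  have mon: "lax_monad D S" "lax_monad E T"
    using assms(3,4) unfolding lax_monad_def is_monad_def by blast+
  from assms(7) have op: "monad_oplax_morphism D E S T F \<phi>" and lx: "monad_lax_morphism E D T S G \<psi>"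
    and adj: "lax_adjunction D E F G \<eta> \<epsilon>"
    unfolding conjunction_def by blast+
  interpret G: lax_morphism_algebra D E S T G \<psi> cp y b \<upsilon> \<mu>
    using assms(1,2,6,10) mon lx
    unfolding lax_morphism_algebra_def lax_morphism_algebra_axioms_def equipment_def monad_lax_morphism_def
      vt_eq_def vt_comp_def vt_pre_def vt_post_def
    by auto
  \<comment> \<open>Strength of the conjoint of \<phi> is specialised to the carrier of
    \<open>G\<^sub>!(y, b)\<close>, the horizontal 1-cell at which \<open>F_shriek\<close> inverts
    the comparison.\<close>
  have strong: "is_iso (Hor E) (n_conj D E cj (lax_comp E F (mfun S)) (lax_comp E (mfun T) F) \<phi> G.pull_hor)"
    using assms(8) unfolding strong_conjoint_def by simp
  \<comment> \<open>By \<open>G_shriek_eq\<close> the case expression selects \<open>fo G y\<close>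
    and \<open>G.pull_hor\<close>.\<close>
  have theta: "is_iso (Hor E) (theta_cmp E (mfun T) cj (fh F G.pull_hor) (t0 \<phi> (fo G y)))"
    using F_shriek_defined unfolding G.G_shriek_eq by simp
  interpret shriek_counit_at D E S T F \<phi> G \<psi> \<epsilon> cj cp y b \<upsilon> \<mu>
    using op adj assms(5) strong theta conjunction_mate[OF assms(7,3,4)] G.lax_morphism_algebra_axioms
    unfolding shriek_counit_at_def shriek_counit_at_axioms_def monad_oplax_morphism_def lax_adjunction_def
      vt_eq_def vt_comp_def vt_pre_def vt_post_def G.pull_hor_def
    by auto
  show ?thesis
    by (rule shriek_counit_is_iso_iff[OF assms(12,13)])
qed

end
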